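(* Let $y \in |\mathbb{P}^1|$ be a closed point of degree $d$, and let $\Phi_y$ be the unramified Hecke operator given by the characteristic function of $K\begin{pmatrix}\pi_y & 0\\ 0 & 1\end{pmatrix}K$, where $\pi_y$ is a uniformizer of $y$. Then $\dim_{\mathbb{C}} \mathcal{A}^{K}(\Phi_y,\lambda)=d$ for every $\lambda\in\mathbb{C}^{\times}$.
   Context: Let $q$ be a prime power and $F=\mathbb{F}_q(t)$ the function field of $\mathbb{P}^1$ over $\mathbb{F}_q$; $|\mathbb{P}^1|$ is the set of closed points (equivalently, places of $F$). For $y\in|\mathbb{P}^1|$: $F_y$ is the completion of $F$ at $y$, $\mathcal{O}_y$ its ring of integers, $\pi_y\in F$ a uniformizer, $\kappa(y)=\mathcal{O}_y/(\pi_y)$, the degree of $y$ is $|y|=[\kappa(y):\mathbb{F}_q]$, and $|\cdot|_y$ is the absolute value with $|\pi_y|_y=q^{-|y|}$. $\mathbb{A}$ is the adele ring of $F$, $\mathcal{O}_{\mathbb{A}}=\prod_y\mathcal{O}_y$, $G=\mathrm{GL}_2$, $Z$ is the center of $G(\mathbb{A})$, $K=\mathrm{GL}_2(\mathcal{O}_{\mathbb{A}})$. A matrix in $\mathrm{GL}_2(F_y)$ is viewed in $G(\mathbb{A})$ by putting the identity at all other places. $G(\mathbb{A})$ carries the Haar measure with $\mathrm{vol}(K)=1$. A locally constant, compactly supported, bi-$K$-invariant function $\Phi:G(\mathbb{A})\to\mathbb{C}$ (unramified Hecke operator) acts on functions by $\Phi(f)(g)=\int_{G(\mathbb{A})}\Phi(h)f(gh)\,dh$.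 $\mathcal{A}^{K}$ is the complex vector space of functions $f:G(\mathbb{A})\to\mathbb{C}$ that are left $G(F)$-invariant, $Z$-invariant, right $K$-invariant, and of moderate growth, i.e. there are constants $C,N$ with $|f(g)|\le C|g|^N$ for all $g\in G(\mathbb{A})$. Here $|g|=\prod_y |g_y|_y$, with $|g_y|_y$ the maximum of the $y$-adic absolute values of the entries of $g_y$ and of $\det(g_y)^{-1}$. (Equivalently, functions of moderate growth on $G(F)\backslash G(\mathbb{A})/ZK$.) For $\lambda\in\mathbb{C}$, $\mathcal{A}^{K}(\Phi,\lambda)=\{f\in\mathcal{A}^{K}\mid\Phi(f)=\lambda f\}$. *)

theory Defs
  imports
    "HOL-Analysis.Analysis"
    "HOL-Algebra.QuotRing"
    "HOL-Algebra.Embedded_Algebras"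
    "HOL-Algebra.Algebraic_Closure_Type"
    "HOL-Computational_Algebra.Polynomial"
    "HOL-Computational_Algebra.Fraction_Field"
    "HOL-Library.Function_Algebras"
    "HOL-Library.Groups_Big_Fun"
begin

hide_const (open) Polynomials.degree

section \<open>Places of the rational function field\<close>

text \<open>The finite field is a type \<^typ>\<open>'k\<close> of sort \<open>{finite, field}\<close>, with \<open>q = CARD('k)\<close>; the field
  \<open>F\<close> of rational functions over it is \<^typ>\<open>'k poly fract\<close>.\<close>

type_synonym 'k ratfun = "'k poly fract"

text \<open>A place is a normalised discrete valuation. These are automatically trivial on the finite
  field of constants. The value at \<open>0\<close>, which should be infinite, is fixed to be \<open>0\<close>, so that a
  place is counted only once; it is never used below.\<close>

definition discrete_valuation :: "('a::field \<Rightarrow> int) \<Rightarrow> bool" where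
  "discrete_valuation v \<longleftrightarrow>
     v 0 = 0 \<and>
     v ` (UNIV - {0}) = UNIV \<and>
     (\<forall>a b. a \<noteq> 0 \<longrightarrow> b \<noteq> 0 \<longrightarrow> v (a * b) = v a + v b) \<and>
     (\<forall>a b. a \<noteq> 0 \<longrightarrow> b \<noteq> 0 \<longrightarrow> a + b \<noteq> 0 \<longrightarrow> min (v a) (v b) \<le> v (a + b))"

text \<open>The valuation at infinity, needed to see that the type of places is inhabited.\<close>

definition ord_infinity :: "'k::{finite,field} ratfun \<Rightarrow> int" where
  "ord_infinity x = (if x = 0 then 0 else
     (THE n. \<exists>a b. a \<noteq> 0 \<and> b \<noteq> 0 \<and> x = Fract a b \<and> n = int (degree b) - int (degree a)))"

lemma Fract_eq_0_iff: "b \<noteq> 0 \<Longrightarrow> Fract a b = 0 \<longleftrightarrow> a = 0"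
  unfolding Zero_fract_def by (subst eq_fract(1)) simp_all

lemma ord_infinity_Fract:
  assumes "a \<noteq> 0" "b \<noteq> 0"
  shows "ord_infinity (Fract a b) = int (degree b) - int (degree a)"
proof -
  have nz: "Fract a b \<noteq> 0"
    using assms by (simp add: Fract_eq_0_iff)
  have uniq: "n = int (degree b) - int (degree a)"
    if "c \<noteq> 0" "e \<noteq> 0" "Fract a b = Fract c e" "n = int (degree e) - int (degree c)" for n c e
  proof -
    have "a * e = c * b" using that assms by (simp add: eq_fract)
    hence "degree a + degree e = degree c + degree b"
      using that assms by (metis degree_mult_eq)
    thus ?thesis using that by simp
  qed
  let ?P = "\<lambda>n. \<exists>c e. c \<noteq> 0 \<and> e \<noteq> 0 \<and> Fract a b = Fract c e \<and>
                  n = int (degree e) - int (degree c)"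
  have "(THE n. ?P n) = int (degree b) - int (degree a)"
  proof (rule the_equality)
    show "?P (int (degree b) - int (degree a))" using assms by blast
  next
    fix n assume "?P n"
    then obtain c e where "c \<noteq> 0" "e \<noteq> 0" "Fract a b = Fract c e"
      "n = int (degree e) - int (degree c)" by blast
    thus "n = int (degree b) - int (degree a)" by (rule uniq)
  qed
  thus ?thesis unfolding ord_infinity_def using nz by simp
qed

lemma discrete_valuation_ord_infinity:
  "discrete_valuation (ord_infinity :: 'k::{finite,field} ratfun \<Rightarrow> int)"
proof -
  have rep: "\<exists>a b. a \<noteq> 0 \<and> b \<noteq> 0 \<and> x = Fract a b" if "x \<noteq> 0" for x :: "'k ratfun"
  proof (cases x)
    case (Fract a b)
    with that have "a \<noteq> 0" by (auto simp: Fract_eq_0_iff)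
    with Fract show ?thesis by blast
  qed
  have mult: "ord_infinity (x * y) = ord_infinity x + ord_infinity y"
    if xy: "x \<noteq> 0" "y \<noteq> 0" for x y :: "'k ratfun"
  proof -
    obtain a b where x: "a \<noteq> 0" "b \<noteq> 0" "x = Fract a b" using rep[OF xy(1)] by blast
    obtain c e where y: "c \<noteq> 0" "e \<noteq> 0" "y = Fract c e" using rep[OF xy(2)] by blast
    show ?thesis using x y by (simp add: ord_infinity_Fract degree_mult_eq)
  qed
  have add: "min (ord_infinity x) (ord_infinity y) \<le> ord_infinity (x + y)"
    if xy: "x \<noteq> 0" "y \<noteq> 0" "x + y \<noteq> 0" for x y :: "'k ratfun"
  proof -
    obtain a b where x: "a \<noteq> 0" "b \<noteq> 0" "x = Fract a b" using rep[OF xy(1)] by blast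
    obtain c e where y: "c \<noteq> 0" "e \<noteq> 0" "y = Fract c e" using rep[OF xy(2)] by blast
    have sum: "x + y = Fract (a * e + c * b) (b * e)" using x y by simp
    have nz: "a * e + c * b \<noteq> 0" using xy(3) sum x y by (auto simp: Fract_eq_0_iff)
    have "degree (a * e + c * b) \<le> max (degree (a * e)) (degree (c * b))"
      by (rule degree_add_le_max)
    also have "\<dots> = max (degree a + degree e) (degree c + degree b)"
      using x y by (simp add: degree_mult_eq)
    finally have "degree (a * e + c * b) \<le> max (degree a + degree e) (degree c + degree b)" .
    moreover have "ord_infinity (x + y) = int (degree b + degree e) - int (degree (a * e + c * b))"
      using sum nz x y by (simp add: ord_infinity_Fract degree_mult_eq)
    ultimately show ?thesis using x y by (simp add: ord_infinity_Fract)
  qed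
  have ex: "\<exists>x :: 'k ratfun. x \<noteq> 0 \<and> ord_infinity x = n" for n
  proof -
    define x :: "'k ratfun" where "x = Fract (Polynomial.monom 1 (nat (- n))) (Polynomial.monom 1 (nat n))"
    have nz: "Polynomial.monom (1 :: 'k) m \<noteq> 0" for m
      by simp
    have deg: "degree (Polynomial.monom (1 :: 'k) m) = m" for m
      by (rule degree_monom_eq) (rule one_neq_zero)
    have "ord_infinity x = n"
      unfolding x_def ord_infinity_Fract[OF nz nz] deg by (cases "n \<ge> 0") auto
    moreover have "x \<noteq> 0"
      unfolding x_def using nz by (simp add: Fract_eq_0_iff)
    ultimately have "x \<noteq> 0 \<and> ord_infinity x = n" by (rule conjI[rotated])
    thus ?thesis by (rule exI)
  qed
  have surj: "ord_infinity ` (UNIV - {0 :: 'k ratfun}) = UNIV"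
  proof (rule UNIV_eq_I[symmetric])
    fix n
    obtain x :: "'k ratfun" where "x \<noteq> 0" "ord_infinity x = n" using ex by blast
    thus "n \<in> ord_infinity ` (UNIV - {0 :: 'k ratfun})" by auto
  qed
  show ?thesis
    unfolding discrete_valuation_def
  proof (intro conjI allI impI)
    show "ord_infinity (0 :: 'k ratfun) = 0" by (simp add: ord_infinity_def)
  qed (fact surj mult add)+
qed

typedef (overloaded) ('k::"{finite,field}") place =
  "{v :: 'k ratfun \<Rightarrow> int. discrete_valuation v}"
  morphisms ord Abs_place
  using discrete_valuation_ord_infinity by blast

definition uniformizer :: "'k::{finite,field} place \<Rightarrow> 'k ratfun \<Rightarrow> bool" where
  "uniformizer y p \<longleftrightarrow> ord y p = 1"


section \<open>Completions\<close>

definition ord_ge :: "'k::{finite,field} place \<Rightarrow> int \<Rightarrow> 'k ratfun \<Rightarrow> bool" where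
  "ord_ge y N x \<longleftrightarrow> x = 0 \<or> N \<le> ord y x"

definition Cauchy_seqs :: "'k::{finite,field} place \<Rightarrow> (nat \<Rightarrow> 'k ratfun) set" where
  "Cauchy_seqs y = {s. \<forall>N. \<exists>M. \<forall>m\<ge>M. \<forall>n\<ge>M. ord_ge y N (s m - s n)}"

definition null_seqs :: "'k::{finite,field} place \<Rightarrow> (nat \<Rightarrow> 'k ratfun) set" where
  "null_seqs y = {s. \<forall>N. \<exists>M. \<forall>n\<ge>M. ord_ge y N (s n)}"

definition Cauchy_ring :: "'k::{finite,field} place \<Rightarrow> (nat \<Rightarrow> 'k ratfun) ring" where
  "Cauchy_ring y = \<lparr>carrier = Cauchy_seqs y,
     monoid.mult = (\<lambda>s t n. s n * t n), one = (\<lambda>n. 1),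
     ring.zero = (\<lambda>n. 0), add = (\<lambda>s t n. s n + t n)\<rparr>"

type_synonym 'k local_elt = "(nat \<Rightarrow> 'k ratfun) set"

definition completion :: "'k::{finite,field} place \<Rightarrow> 'k local_elt ring" where
  "completion y = Cauchy_ring y Quot null_seqs y"

definition to_completion :: "'k::{finite,field} place \<Rightarrow> 'k ratfun \<Rightarrow> 'k local_elt" where
  "to_completion y a = null_seqs y +>\<^bsub>Cauchy_ring y\<^esub> (\<lambda>n. a)"

text \<open>The extension of the valuation to nonzero elements of the completion: the valuation is
  eventually constant along a Cauchy sequence that is not a null sequence.\<close>

definition local_ord :: "'k::{finite,field} place \<Rightarrow> 'k local_elt \<Rightarrow> int" where
  "local_ord y x = (THE k. \<forall>s\<in>x. \<forall>\<^sub>F n in sequentially. ord y (s n) = k)"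

definition local_integers :: "'k::{finite,field} place \<Rightarrow> 'k local_elt set" where
  "local_integers y =
     {x \<in> carrier (completion y). x = \<zero>\<^bsub>completion y\<^esub> \<or> 0 \<le> local_ord y x}"

definition local_integer_ring :: "'k::{finite,field} place \<Rightarrow> 'k local_elt ring" where
  "local_integer_ring y = (completion y)\<lparr>carrier := local_integers y\<rparr>"

definition max_ideal :: "'k::{finite,field} place \<Rightarrow> 'k local_elt set" where
  "max_ideal y = PIdl\<^bsub>local_integer_ring y\<^esub> (to_completion y (SOME p. uniformizer y p))"

definition residue_field :: "'k::{finite,field} place \<Rightarrow> 'k local_elt set ring" where
  "residue_field y = local_integer_ring y Quot max_ideal y"

definition constants_in_residue_field :: "'k::{finite,field} place \<Rightarrow> 'k local_elt set set" where
  "constants_in_residue_field y =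
     range (\<lambda>c. max_ideal y +>\<^bsub>local_integer_ring y\<^esub> to_completion y (Fract [:c:] 1))"

definition place_degree :: "'k::{finite,field} place \<Rightarrow> nat" where
  "place_degree y =
     ring.dim (residue_field y) (constants_in_residue_field y) (carrier (residue_field y))"

definition local_abs :: "'k::{finite,field} place \<Rightarrow> 'k local_elt \<Rightarrow> real" where
  "local_abs y x = (if x = \<zero>\<^bsub>completion y\<^esub> then 0
     else real CARD('k) powi (- (int (place_degree y) * local_ord y x)))"

text \<open>The case distinction makes the distance symmetric on the whole type, as
  \<^locale>\<open>Metric_space\<close> demands.\<close>

definition local_dist :: "'k::{finite,field} place \<Rightarrow> 'k local_elt \<Rightarrow> 'k local_elt \<Rightarrow> real" where
  "local_dist y x x' = (if x \<in> carrier (completion y) \<and> x' \<in> carrier (completion y)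
     then local_abs y (x \<ominus>\<^bsub>completion y\<^esub> x') else 0)"

definition local_topology :: "'k::{finite,field} place \<Rightarrow> 'k local_elt topology" where
  "local_topology y = Metric_space.mtopology (carrier (completion y)) (local_dist y)"


section \<open>Adeles\<close>

type_synonym 'k adele = "'k place \<Rightarrow> 'k local_elt"

definition adele_ring :: "'k::{finite,field} adele ring" where
  "adele_ring = \<lparr>carrier = {a. (\<forall>y. a y \<in> carrier (completion y)) \<and>
                               finite {y. a y \<notin> local_integers y}},
     monoid.mult = (\<lambda>a b y. a y \<otimes>\<^bsub>completion y\<^esub> b y),
     one = (\<lambda>y. \<one>\<^bsub>completion y\<^esub>),
     ring.zero = (\<lambda>y. \<zero>\<^bsub>completion y\<^esub>),
     add = (\<lambda>a b y. a y \<oplus>\<^bsub>completion y\<^esub> b y)\<rparr>"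

definition integral_adele_ring :: "'k::{finite,field} adele ring" where
  "integral_adele_ring = adele_ring\<lparr>carrier := {a. \<forall>y. a y \<in> local_integers y}\<rparr>"

definition principal_adele :: "'k::{finite,field} ratfun \<Rightarrow> 'k adele" where
  "principal_adele x = (\<lambda>y. to_completion y x)"

definition adele_topology :: "'k::{finite,field} adele topology" where
  "adele_topology = topology_generated_by
     {{a. \<forall>y. a y \<in> U y} | U.
        (\<forall>y. openin (local_topology y) (U y)) \<and> finite {y. U y \<noteq> local_integers y}}"


section \<open>The group \<open>GL\<^sub>2\<close>\<close>

text \<open>In the index type \<^typ>\<open>2\<close> the two elements are \<open>1\<close> and \<open>2 = 0\<close>.\<close>

type_synonym 'r mat2 = "2 \<Rightarrow> 2 \<Rightarrow> 'r"

definition mat2_monoid :: "'r ring \<Rightarrow> 'r mat2 monoid" where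
  "mat2_monoid R = \<lparr>carrier = {A. \<forall>i j. A i j \<in> carrier R},
     monoid.mult = (\<lambda>A B i j. A i 1 \<otimes>\<^bsub>R\<^esub> B 1 j \<oplus>\<^bsub>R\<^esub> A i 2 \<otimes>\<^bsub>R\<^esub> B 2 j),
     one = (\<lambda>i j. if i = j then \<one>\<^bsub>R\<^esub> else \<zero>\<^bsub>R\<^esub>)\<rparr>"

definition GL2 :: "'r ring \<Rightarrow> 'r mat2 monoid" where
  "GL2 R = units_of (mat2_monoid R)"

definition det2 :: "'r ring \<Rightarrow> 'r mat2 \<Rightarrow> 'r" where
  "det2 R A = A 1 1 \<otimes>\<^bsub>R\<^esub> A 2 2 \<ominus>\<^bsub>R\<^esub> A 1 2 \<otimes>\<^bsub>R\<^esub> A 2 1"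

definition diag2 :: "'r ring \<Rightarrow> 'r \<Rightarrow> 'r \<Rightarrow> 'r mat2" where
  "diag2 R a b = (\<lambda>i j. if i = j then (if i = 1 then a else b) else \<zero>\<^bsub>R\<^esub>)"

definition group_center :: "('g, 'x) monoid_scheme \<Rightarrow> 'g set" where
  "group_center G = {z \<in> carrier G. \<forall>g\<in>carrier G. z \<otimes>\<^bsub>G\<^esub> g = g \<otimes>\<^bsub>G\<^esub> z}"

abbreviation GA :: "'k::{finite,field} adele mat2 monoid" where
  "GA \<equiv> GL2 adele_ring"

definition ZA :: "'k::{finite,field} adele mat2 set" where
  "ZA = group_center GA"

definition KA :: "'k::{finite,field} adele mat2 set" where
  "KA = carrier (GL2 integral_adele_ring)"

definition GF :: "'k::{finite,field} adele mat2 set" where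
  "GF = (\<lambda>A i j. principal_adele (A i j)) ` carrier (GL2 (ring_of_type_algebra :: 'k ratfun ring))"

definition local_component :: "'k place \<Rightarrow> 'k adele mat2 \<Rightarrow> 'k local_elt mat2" where
  "local_component y g = (\<lambda>i j. g i j y)"

definition local_inclusion ::
    "'k::{finite,field} place \<Rightarrow> 'k local_elt mat2 \<Rightarrow> 'k adele mat2" where
  "local_inclusion y A = (\<lambda>i j w. if w = y then A i j else \<one>\<^bsub>mat2_monoid (completion w)\<^esub> i j)"

definition mat2_topology :: "'r topology \<Rightarrow> 'r mat2 topology" where
  "mat2_topology T = product_topology (\<lambda>i. product_topology (\<lambda>j. T) UNIV) UNIV"

text \<open>The usual topology on the unit group of a topological ring: the inverse has to be
  continuous, so it is induced by \<open>g \<mapsto> (g, g\<^sup>-\<^sup>1)\<close> rather than by the inclusion into all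
  matrices.\<close>

definition GA_topology :: "'k::{finite,field} adele mat2 topology" where
  "GA_topology = pullback_topology (carrier GA) (\<lambda>g. (g, inv\<^bsub>GA\<^esub> g))
     (prod_topology (mat2_topology adele_topology) (mat2_topology adele_topology))"


section \<open>Haar measure and Hecke operators\<close>

text \<open>A left-invariant, nonzero Radon measure on the Borel sets of the group \<open>G\<close> with topology
  \<open>T\<close>.\<close>

definition haar_measure :: "('g, 'x) monoid_scheme \<Rightarrow> 'g topology \<Rightarrow> 'g measure \<Rightarrow> bool" where
  "haar_measure G T \<mu> \<longleftrightarrow>
     sets \<mu> = sets (sigma (topspace T) {U. openin T U}) \<and>
     (\<forall>g\<in>carrier G. \<forall>A\<in>sets \<mu>. emeasure \<mu> ((\<lambda>h. g \<otimes>\<^bsub>G\<^esub> h) ` A) = emeasure \<mu> A) \<and>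
     (\<forall>C. compactin T C \<longrightarrow> emeasure \<mu> C < \<infinity>) \<and>
     (\<forall>A\<in>sets \<mu>. emeasure \<mu> A = (INF U\<in>{U. openin T U \<and> A \<subseteq> U}. emeasure \<mu> U)) \<and>
     (\<forall>U. openin T U \<longrightarrow> emeasure \<mu> U = (SUP C\<in>{C. compactin T C \<and> C \<subseteq> U}. emeasure \<mu> C)) \<and>
     emeasure \<mu> (carrier G) \<noteq> 0"

text \<open>A function on the group is represented by its extension by \<open>0\<close> to the whole matrix type.\<close>

definition hecke_action :: "'k::{finite,field} adele mat2 measure \<Rightarrow>
    ('k adele mat2 \<Rightarrow> complex) \<Rightarrow> ('k adele mat2 \<Rightarrow> complex) \<Rightarrow> 'k adele mat2 \<Rightarrow> complex" where
  "hecke_action \<mu> \<Phi> f g =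
     (if g \<in> carrier GA then (\<integral>h. \<Phi> h * f (g \<otimes>\<^bsub>GA\<^esub> h) \<partial>\<mu>) else 0)"

definition hecke_place ::
    "'k::{finite,field} place \<Rightarrow> 'k ratfun \<Rightarrow> 'k adele mat2 \<Rightarrow> complex" where
  "hecke_place y p = indicator
     ((KA #>\<^bsub>GA\<^esub> local_inclusion y
         (diag2 (completion y) (to_completion y p) \<one>\<^bsub>completion y\<^esub>)) <#>\<^bsub>GA\<^esub> KA)"


section \<open>Unramified automorphic forms\<close>

definition local_height :: "'k::{finite,field} place \<Rightarrow> 'k local_elt mat2 \<Rightarrow> real" where
  "local_height y A = Max (insert (local_abs y (inv\<^bsub>completion y\<^esub> (det2 (completion y) A)))
     (range (\<lambda>(i, j). local_abs y (A i j))))"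

definition height :: "'k::{finite,field} adele mat2 \<Rightarrow> real" where
  "height g = Prod_any (\<lambda>y. local_height y (local_component y g))"

definition unramified_automorphic_forms :: "('k::{finite,field} adele mat2 \<Rightarrow> complex) set" where
  "unramified_automorphic_forms = {f.
     (\<forall>g. g \<notin> carrier GA \<longrightarrow> f g = 0) \<and>
     (\<forall>\<gamma>\<in>GF. \<forall>g\<in>carrier GA. f (\<gamma> \<otimes>\<^bsub>GA\<^esub> g) = f g) \<and>
     (\<forall>z\<in>ZA. \<forall>g\<in>carrier GA. f (z \<otimes>\<^bsub>GA\<^esub> g) = f g) \<and>
     (\<forall>k\<in>KA. \<forall>g\<in>carrier GA. f (g \<otimes>\<^bsub>GA\<^esub> k) = f g) \<and>
     (\<exists>C N :: real. \<forall>g\<in>carrier GA. norm (f g) \<le> C * height g powr N)}"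

definition hecke_eigenspace :: "'k::{finite,field} adele mat2 measure \<Rightarrow>
    ('k adele mat2 \<Rightarrow> complex) \<Rightarrow> complex \<Rightarrow> ('k adele mat2 \<Rightarrow> complex) set" where
  "hecke_eigenspace \<mu> \<Phi> c =
     {f \<in> unramified_automorphic_forms. hecke_action \<mu> \<Phi> f = (\<lambda>g. c * f g)}"

definition fun_scale :: "complex \<Rightarrow> ('a \<Rightarrow> complex) \<Rightarrow> 'a \<Rightarrow> complex" where
  "fun_scale c f = (\<lambda>x. c * f x)"

lemma vector_space_fun_scale: "vector_space fun_scale"
  by (rule vector_space.intro) (simp_all add: fun_scale_def fun_eq_iff distrib_left distrib_right)

text \<open>The dimension is \<open>0\<close> by convention if there is no finite basis.\<close>

definition fun_dim :: "('a \<Rightarrow> complex) set \<Rightarrow> nat" where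
  "fun_dim = vector_space.dim fun_scale"

end

theory Submission
  imports Defs
begin

text \<open>The double cosets of rational, central and maximal compact elements in \<open>GL\<^sub>2\<close>
  of the adeles are the rank two vector bundles on the projective line up to twist by line
  bundles. Every such bundle is a twist of \<open>O \<oplus> O(n)\<close> for exactly one
  \<open>n \<ge> 0\<close>; call \<open>n\<close> the type. An unramified form is therefore a
  sequence \<open>\<phi> 0, \<phi> 1, \<phi> 2, \<dots>\<close>
  (\<open>invariant_determined_by_type\<close>), where existence of \<open>n\<close> is the
  reduction theory of \<open>reduction\<close>, and uniqueness comes from the description of
  \<open>n\<close> as the largest value of \<open>2 deg L - deg E\<close> over the line subbundles
  \<open>L\<close> of the bundle \<open>E\<close> (\<open>has_type\<close>,
  \<open>has_type_diag\<close>).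

  The Hecke operator at a place of degree \<open>d\<close> sums over finitely many modifications
  of \<open>E\<close> at that place. A modification raises \<open>2 deg L - deg E\<close> by at
  most \<open>d\<close> (\<open>line_degree_step\<close>), so a neighbour of
  \<open>O \<oplus> O(n)\<close> has type at most \<open>n + d\<close>, and one of the neighbours
  has exactly this type (\<open>has_type_std_mat_step\<close>). The eigenvalue equation at
  \<open>n\<close> is thus a linear recursion that expresses \<open>\<phi> (n + d)\<close> by
  values of \<open>\<phi>\<close> at smaller arguments. The values
  \<open>\<phi> 0, \<dots>, \<phi> (d - 1)\<close> can be prescribed freely and determine the
  solution, so the dimension is \<open>d\<close>. Growth imposes no further condition: solutions
  of the recursion grow at most exponentially (\<open>recursive_solution_growth\<close>), while
  the type is at most a multiple of the logarithm of the height (\<open>type_le_height\<close>).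

  Since \<open>F\<close> is dense in its completions, every element of \<open>GL\<^sub>2\<close>
  of a completion is a product of a matrix over \<open>F\<close> and an integral invertible one
  (\<open>local_approximation\<close>). Adelic matrices modulo the maximal compact subgroup are
  therefore represented by families of matrices over \<open>F\<close> indexed by the places
  (\<open>GA_decomposition\<close>), and the geometry takes place in \<open>F\<close> alone. It
  rests on the classification of the places of \<open>F\<close> by the point at infinity and the
  monic prime polynomials, which gives the product formula, strong approximation and the
  triviality of the class group of the affine line. The place degree, defined by a dimension over
  the constants, is computed by counting the residue field (\<open>place_degree_eq\<close>). The
  Haar measure enters only through left invariance: all left cosets of the maximal compact
  subgroup have measure \<open>1\<close>, so the Hecke integral is a finite sum
  (\<open>hecke_action_eq_coset_sum\<close>).\<close>

hide_const (open) Polynomials.lead_coeff Divisibility.irreducible Divisibility.prime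

section \<open>Places of the rational function field\<close>

subsection \<open>Valuation calculus\<close>

lemma discrete_valuation_ord: "discrete_valuation (ord w)"
  using ord[of w] by simp

lemma ord_0 [simp]: "ord w 0 = 0"
  using discrete_valuation_ord[of w] by (simp add: discrete_valuation_def)

lemma ord_mult: "x \<noteq> 0 \<Longrightarrow> y \<noteq> 0 \<Longrightarrow> ord w (x * y) = ord w x + ord w y"
  using discrete_valuation_ord[of w] by (simp add: discrete_valuation_def)

lemma ord_add: "x \<noteq> 0 \<Longrightarrow> y \<noteq> 0 \<Longrightarrow> x + y \<noteq> 0 \<Longrightarrow> min (ord w x) (ord w y) \<le> ord w (x + y)"
  using discrete_valuation_ord[of w] by (simp add: discrete_valuation_def)

lemma ord_surj: "\<exists>x. x \<noteq> 0 \<and> ord w x = n"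
proof -
  have "n \<in> ord w ` (UNIV - {0})"
    using discrete_valuation_ord[of w] by (simp add: discrete_valuation_def)
  thus ?thesis by auto
qed

lemma ord_one [simp]: "ord w 1 = 0"
  using ord_mult[of 1 1 w] by simp

lemma ord_uminus [simp]: "ord w (- x) = ord w x"
proof -
  have "ord w (-1) = 0"
    using ord_mult[of "-1" "-1" w] by simp
  thus ?thesis
    using ord_mult[of "-1" x w] by (cases "x = 0") auto
qed

lemma ord_inverse: "ord w (inverse x) = - ord w x"
proof (cases "x = 0")
  case False
  have "ord w (x * inverse x) = ord w x + ord w (inverse x)"
    using False by (intro ord_mult) auto
  with False show ?thesis by simp
qed simp

lemma ord_divide: "x \<noteq> 0 \<Longrightarrow> y \<noteq> 0 \<Longrightarrow> ord w (x / y) = ord w x - ord w y"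
  by (simp add: divide_inverse ord_mult ord_inverse)

lemma ord_power: "x \<noteq> 0 \<Longrightarrow> ord w (x ^ n) = int n * ord w x"
  by (induction n) (auto simp: ord_mult algebra_simps)

lemma ord_powi: "x \<noteq> 0 \<Longrightarrow> ord w (x powi n) = n * ord w x"
  by (cases "n \<ge> 0") (auto simp: power_int_def ord_power ord_inverse)

lemma ord_ge_0 [simp]: "ord_ge w n 0"
  by (simp add: ord_ge_def)

lemma ord_ge_iff: "x \<noteq> 0 \<Longrightarrow> ord_ge w n x \<longleftrightarrow> n \<le> ord w x"
  by (simp add: ord_ge_def)

lemma ord_ge_1 [simp]: "ord_ge w n 1 \<longleftrightarrow> n \<le> 0"
  by (simp add: ord_ge_def)

lemma ord_ge_mono: "ord_ge w n x \<Longrightarrow> m \<le> n \<Longrightarrow> ord_ge w m x"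
  by (auto simp: ord_ge_def)

lemma ord_ge_add:
  assumes "ord_ge w n x" "ord_ge w n y"
  shows "ord_ge w n (x + y)"
  using assms ord_add[of x y w] unfolding ord_ge_def by fastforce

lemma ord_ge_uminus [simp]: "ord_ge w n (- x) = ord_ge w n x"
  by (simp add: ord_ge_def)

lemma ord_ge_diff: "ord_ge w n x \<Longrightarrow> ord_ge w n y \<Longrightarrow> ord_ge w n (x - y)"
  using ord_ge_add[of w n x "- y"] by simp

lemma ord_ge_mult: "ord_ge w n x \<Longrightarrow> ord_ge w m y \<Longrightarrow> ord_ge w (n + m) (x * y)"
  by (cases "x = 0"; cases "y = 0") (auto simp: ord_ge_def ord_mult)

lemma ord_ge_mult_0: "ord_ge w 0 x \<Longrightarrow> ord_ge w n y \<Longrightarrow> ord_ge w n (x * y)"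
  "ord_ge w n x \<Longrightarrow> ord_ge w 0 y \<Longrightarrow> ord_ge w n (x * y)"
  using ord_ge_mult[of w 0 x n y] ord_ge_mult[of w n x 0 y] by simp_all

lemma ord_ge_sum: "(\<And>i. i \<in> A \<Longrightarrow> ord_ge w n (f i)) \<Longrightarrow> ord_ge w n (sum f A)"
  by (induction A rule: infinite_finite_induct) (auto intro: ord_ge_add)

text \<open>An element that is close to \<open>x\<close> compared with the size of \<open>x\<close> has the
  same order as \<open>x\<close>. This is what makes orders eventually constant along Cauchy
  sequences.\<close>

lemma ord_eq_of_diff:
  assumes "x \<noteq> 0" "ord_ge w (ord w x + 1) (x - y)"
  shows "y \<noteq> 0 \<and> ord w y = ord w x"
proof -
  have "\<not> ord_ge w (ord w x + 1) x"
    using assms(1) by (simp add: ord_ge_iff)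
  hence ny: "\<not> ord_ge w (ord w x + 1) y"
    using assms(2) ord_ge_add[of w "ord w x + 1" "x - y" y] by auto
  hence y: "y \<noteq> 0" by auto
  have "ord_ge w (ord w x) (x - y)" using assms(2) by (rule ord_ge_mono) simp
  hence "ord_ge w (ord w x) y"
    using ord_ge_diff[of w "ord w x" x "x - y"] assms(1) by (simp add: ord_ge_iff)
  thus ?thesis using y ny by (auto simp: ord_ge_iff)
qed

text \<open>Constants are roots of unity, so every valuation is trivial on them.\<close>

lemma ord_const [simp]: "ord w (to_fract [:c:]) = 0"
proof (cases "c = 0")
  case False
  have "\<not> inj (\<lambda>n::nat. c ^ n)"
    using finite_imageD[of "\<lambda>n::nat. c ^ n" UNIV] infinite_UNIV_nat by auto
  then obtain m n where mn: "c ^ m = c ^ n" "m \<noteq> n"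
    by (auto simp: inj_def)
  define x where "x = to_fract [:c:]"
  have x: "x \<noteq> 0" using False by (simp add: x_def)
  have pw: "x ^ j = to_fract [:c ^ j:]" for j
    unfolding x_def by (induction j) (auto simp flip: to_fract_mult one_pCons)
  have "int m * ord w x = int n * ord w x"
    using x by (metis mn(1) pw ord_power)
  thus ?thesis using mn x_def by simp
qed simp

lemma ord_ge_const: "n \<le> 0 \<Longrightarrow> ord_ge w n (to_fract [:c:])"
  by (simp add: ord_ge_def)

lemma Fract_1_conv: "Fract a 1 = to_fract a"
  by (simp add: to_fract_def)

lemma ratfun_cases:
  obtains a b where "x = to_fract a / to_fract b" "b \<noteq> 0"
  by (cases x) (auto simp: Fract_conv_to_fract)

lemma place_eqI:
  assumes "\<And>a. a \<noteq> 0 \<Longrightarrow> ord w (to_fract a) = ord w' (to_fract a)"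
  shows "w = w'"
proof -
  have "ord w x = ord w' x" for x
  proof (cases "x = 0")
    case False
    obtain a b where "x = to_fract a / to_fract b" "b \<noteq> 0"
      by (rule ratfun_cases)
    with False assms show ?thesis by (auto simp: ord_divide)
  qed simp
  thus ?thesis by (metis ext ord_inject)
qed

text \<open>The difference \<open>m a - m b\<close> depends only on the fraction \<open>a / b\<close>,
  because \<open>m\<close> turns products into sums; common denominators reduce the ultrametric
  inequality to the one for polynomials. The element \<open>p\<close> makes the extension
  normalised.\<close>

lemma valuation_extension:
  fixes m :: "'k::{finite,field} poly \<Rightarrow> int"
  assumes mult: "\<And>a b. a \<noteq> 0 \<Longrightarrow> b \<noteq> 0 \<Longrightarrow> m (a * b) = m a + m b"
    and add: "\<And>a b. a \<noteq> 0 \<Longrightarrow> b \<noteq> 0 \<Longrightarrow> a + b \<noteq> 0 \<Longrightarrow> min (m a) (m b) \<le> m (a + b)"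
    and unif: "p \<noteq> 0" "m p = 1"
  shows "\<exists>w :: 'k place. \<forall>a. a \<noteq> 0 \<longrightarrow> ord w (to_fract a) = m a"
proof -
  (* The numerator and denominator are chosen arbitrarily; independence of the choice is the next
     claim. *)
  define v where "v x = (if x = 0 then 0 else
    (let ab = (SOME ab. fst ab \<noteq> 0 \<and> snd ab \<noteq> 0 \<and> x = Fract (fst ab) (snd ab)) in
     m (fst ab) - m (snd ab)))" for x
  have v: "v (Fract a b) = m a - m b" if ab: "a \<noteq> 0" "b \<noteq> 0" for a b
  proof -
    define ab where "ab = (SOME ab. fst ab \<noteq> 0 \<and> snd ab \<noteq> 0 \<and> Fract a b = Fract (fst ab) (snd ab))"
    have "fst (a, b) \<noteq> 0 \<and> snd (a, b) \<noteq> 0 \<and> Fract a b = Fract (fst (a, b)) (snd (a, b))"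
      using ab by simp
    hence *: "fst ab \<noteq> 0 \<and> snd ab \<noteq> 0 \<and> Fract a b = Fract (fst ab) (snd ab)"
      unfolding ab_def by (rule someI)
    hence "a * snd ab = fst ab * b" using ab by (metis eq_fract(1))
    hence "m a + m (snd ab) = m (fst ab) + m b"
      using * ab by (metis mult)
    moreover have "v (Fract a b) = m (fst ab) - m (snd ab)"
      using ab by (simp add: v_def Fract_eq_0_iff ab_def Let_def)
    ultimately show ?thesis by simp
  qed
  have rep: "\<exists>a b. a \<noteq> 0 \<and> b \<noteq> 0 \<and> x = Fract a b" if "x \<noteq> 0" for x :: "'k ratfun"
    using that by (cases x) (auto simp: Fract_eq_0_iff)
  have m1: "m 1 = 0" using mult[of 1 1] by simp
  have "discrete_valuation v"
    unfolding discrete_valuation_def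
  proof (intro conjI allI impI)
    show "v 0 = 0" by (simp add: v_def)
    have pw: "m (p ^ n) = int n" for n
      using unif by (induction n) (auto simp: m1 mult)
    have "n \<in> v ` (UNIV - {0})" for n
    proof (cases "n \<ge> 0")
      case True
      have "v (Fract (p ^ nat n) 1) = n" "Fract (p ^ nat n) 1 \<noteq> 0"
        using True unif by (simp_all add: v pw m1 Fract_eq_0_iff)
      thus ?thesis by (metis DiffI UNIV_I imageI singletonD)
    next
      case False
      have "v (Fract 1 (p ^ nat (- n))) = n" "Fract 1 (p ^ nat (- n)) \<noteq> 0"
        using False unif by (simp_all add: v pw m1 Fract_eq_0_iff)
      thus ?thesis by (metis DiffI UNIV_I imageI singletonD)
    qed
    thus "v ` (UNIV - {0}) = UNIV" by auto
  next
    fix x y :: "'k ratfun" assume "x \<noteq> 0" "y \<noteq> 0"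
    with rep obtain a b c d where "a \<noteq> 0" "b \<noteq> 0" "x = Fract a b" "c \<noteq> 0" "d \<noteq> 0" "y = Fract c d"
      by meson
    thus "v (x * y) = v x + v y" by (simp add: v mult)
  next
    fix x y :: "'k ratfun" assume "x \<noteq> 0" "y \<noteq> 0" and xy: "x + y \<noteq> 0"
    with rep obtain a b c d where *: "a \<noteq> 0" "b \<noteq> 0" "x = Fract a b" "c \<noteq> 0" "d \<noteq> 0" "y = Fract c d"
      by meson
    with xy have "a * d + c * b \<noteq> 0" by (auto simp: Fract_eq_0_iff)
    with add[of "a * d" "c * b"] * have "min (m a + m d) (m c + m b) \<le> m (a * d + c * b)"
      by (simp add: mult)
    thus "min (v x) (v y) \<le> v (x + y)" using * \<open>a * d + c * b \<noteq> 0\<close>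
      by (simp add: v mult)
  qed
  hence "ord (Abs_place v) = v" by (simp add: Abs_place_inverse)
  thus ?thesis by (intro exI[of _ "Abs_place v"]) (simp add: to_fract_def v m1)
qed

subsection \<open>Prime polynomials\<close>

lemma ex_monic_prime_dvd:
  fixes f :: "'k::field poly"
  assumes "degree f > 0"
  shows "\<exists>P. prime_elem P \<and> lead_coeff P = 1 \<and> P dvd f"
proof -
  have "\<exists>P. irreducible P \<and> P dvd f"
    using assms
  proof (induction "degree f" arbitrary: f rule: less_induct)
    case less
    show ?case
    proof (cases "irreducible f")
      case False
      have f: "f \<noteq> 0" using less.prems by auto
      moreover have "\<not> is_unit f" using less.prems f by (simp add: is_unit_iff_degree)
      ultimately obtain a b where ab: "f = a * b" "\<not> is_unit a" "\<not> is_unit b"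
        using False by (auto simp: Factorial_Ring.irreducible_def)
      with f have nz: "a \<noteq> 0" "b \<noteq> 0" by auto
      with ab have "degree a > 0" "degree b > 0" by (auto simp: is_unit_iff_degree)
      with less.hyps[of a] ab nz show ?thesis
        by (auto simp: degree_mult_eq)
    qed auto
  qed
  then obtain Q where Q: "irreducible Q" "Q dvd f" by blast
  define P where "P = [:inverse (lead_coeff Q):] * Q"
  have Q0: "Q \<noteq> 0" using Q by auto
  have u: "is_unit [:inverse (lead_coeff Q):]" using Q0 by (simp add: is_unit_const_poly_iff dvd_field_iff)
  have "irreducible P" unfolding P_def
    using Q u irreducible_mult_unit_left by blast
  moreover have "lead_coeff P = 1" using Q0 by (simp add: P_def)
  moreover have "P dvd f" unfolding P_def using Q u by (simp add: mult_unit_dvd_iff' del: mult_pCons_left)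
  ultimately show ?thesis using field_poly_irreducible_imp_prime by blast
qed

text \<open>An element of least degree in the ideal generated by \<open>P\<close> and \<open>e\<close>
  divides both of them. If it were not a unit, it would be an associate of the irreducible
  \<open>P\<close>, and \<open>P\<close> would divide \<open>e\<close>.\<close>

lemma bezout_prime:
  fixes P e :: "'k::field poly"
  assumes P: "prime_elem P" and e: "\<not> P dvd e"
  shows "\<exists>s r. s * e + r * P = 1"
proof -
  define I where "I = {s * e + r * P | s r. True}"
  have "e = 1 * e + 0 * P" by simp
  hence eI: "e \<in> I" unfolding I_def by blast
  have "P = 0 * e + 1 * P" by simp
  hence PI: "P \<in> I" unfolding I_def by blast
  have "\<exists>g. g \<in> I \<and> g \<noteq> 0" using eI e by auto
  then obtain g where g: "g \<in> I \<and> g \<noteq> 0"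
    and "\<And>h. h \<in> I \<and> h \<noteq> 0 \<Longrightarrow> degree g \<le> degree h"
    using ex_has_least_nat[of "\<lambda>g. g \<in> I \<and> g \<noteq> 0" _ degree] by metis
  hence min: "degree g \<le> degree h" if "h \<in> I" "h \<noteq> 0" for h
    using that by blast
  obtain s r where sr: "g = s * e + r * P" using g by (auto simp: I_def)
  have dvd: "g dvd h" if h: "h \<in> I" for h
  proof (rule ccontr)
    assume n: "\<not> g dvd h"
    obtain s' r' where h': "h = s' * e + r' * P" using h by (auto simp: I_def)
    have "h mod g = (s' - h div g * s) * e + (r' - h div g * r) * P"
      using sr h' by (simp add: algebra_simps minus_div_mult_eq_mod[symmetric])
    hence "h mod g \<in> I" unfolding I_def by blast
    moreover have "h mod g \<noteq> 0" using n by (simp add: dvd_eq_mod_eq_0)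
    ultimately have "degree g \<le> degree (h mod g)" by (rule min)
    thus False using degree_mod_less'[of g h] g \<open>h mod g \<noteq> 0\<close> by simp
  qed
  have "is_unit g"
  proof (rule ccontr)
    assume "\<not> is_unit g"
    obtain h where h: "P = g * h" using dvd[OF PI] by (auto elim: dvdE)
    have "irreducible P" using P by (rule prime_elem_imp_irreducible)
    hence "is_unit h" using h \<open>\<not> is_unit g\<close> by (auto simp: Factorial_Ring.irreducible_def)
    hence "P dvd g" unfolding h using unit_imp_dvd by (simp add: mult_unit_dvd_iff)
    with dvd[OF eI] e show False using dvd_trans by blast
  qed
  then obtain i where "1 = g * i" by (auto elim: dvdE)
  hence "1 = (i * s) * e + (i * r) * P" using sr by (simp add: algebra_simps)
  thus ?thesis by metis
qed

lemma bezout_prime_power: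
  fixes P e :: "'k::field poly"
  assumes P: "prime_elem P" and e: "\<not> P dvd e"
  shows "\<exists>s r. s * e + r * P ^ k = 1"
proof (induction k)
  case (Suc k)
  then obtain s r where 1: "s * e + r * P ^ k = 1" by blast
  obtain s0 r0 where 2: "s0 * e + r0 * P = 1" using bezout_prime[OF assms] by blast
  (* Expanding the product, the only term without a factor e is r * r0 * P ^ Suc k. *)
  have "(s * e + r * P ^ k) * (s0 * e + r0 * P) = 1" using 1 2 by simp
  hence "(s * e * s0 + s * r0 * P + r * P ^ k * s0) * e + (r * r0) * P ^ Suc k = 1"
    by (simp add: algebra_simps)
  thus ?case by blast
qed (auto intro: exI[of _ 0] exI[of _ 1])

lemma prime_poly_degree_pos: "prime_elem (P :: 'k::field poly) \<Longrightarrow> degree P > 0"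
  by (metis is_unit_iff_degree not_gr0 prime_elem_def)

lemma prime_power_decompose:
  fixes f :: "'k::field poly"
  assumes P: "prime_elem P" and "f \<noteq> 0"
  shows "\<exists>n g. f = P ^ n * g \<and> \<not> P dvd g"
  using assms(2)
proof (induction "degree f" arbitrary: f rule: less_induct)
  case less
  show ?case
  proof (cases "P dvd f")
    case True
    then obtain h where h: "f = P * h" by (auto elim: dvdE)
    with less.prems have "h \<noteq> 0" "P \<noteq> 0" by auto
    hence "degree h < degree f" using h prime_poly_degree_pos[OF P] by (simp add: degree_mult_eq)
    from less.hyps[OF this \<open>h \<noteq> 0\<close>] obtain n g where "h = P ^ n * g" "\<not> P dvd g" by blast
    hence "f = P ^ Suc n * g \<and> \<not> P dvd g" using h by simp
    thus ?thesis by blast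
  qed (auto intro: exI[of _ 0])
qed

lemma prime_power_decompose_unique:
  fixes P :: "'k::field poly"
  assumes P: "prime_elem P" and eq: "P ^ n * g = P ^ m * h" and nd: "\<not> P dvd g" "\<not> P dvd h"
  shows "n = m"
proof -
  have le: "n \<le> m" if "P ^ n * g = P ^ m * h" "\<not> P dvd h" for n m :: nat and g h
  proof (rule ccontr)
    assume "\<not> n \<le> m"
    then obtain k where "n = m + Suc k" using less_iff_Suc_add by (auto simp: not_le)
    with that(1) have "P ^ m * (P ^ Suc k * g) = P ^ m * h" by (simp add: power_add algebra_simps)
    hence "P ^ Suc k * g = h" using P by (subst (asm) mult_left_cancel) auto
    thus False using that(2) by (auto simp: mult.assoc)
  qed
  show ?thesis using le[OF eq nd(2)] le[OF eq[symmetric] nd(1)] by simp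
qed

subsection \<open>Classification of the places\<close>

definition infinite_place :: "'k::{finite,field} place" where
  "infinite_place = Abs_place ord_infinity"

lemma ord_infinite_place:
  "a \<noteq> 0 \<Longrightarrow> ord infinite_place (to_fract a) = - int (degree a)"
  unfolding infinite_place_def to_fract_def
  by (simp add: Abs_place_inverse discrete_valuation_ord_infinity ord_infinity_Fract)

text \<open>The \<open>P\<close>-adic valuation, characterised by its value at \<open>P\<close> and at the
  polynomials prime to \<open>P\<close>. Every nonzero polynomial is a power of \<open>P\<close>
  times a polynomial prime to \<open>P\<close>, so this determines the place.\<close>

definition at_prime :: "'k::{finite,field} place \<Rightarrow> 'k poly \<Rightarrow> bool" where
  "at_prime w P \<longleftrightarrow> prime_elem P \<and> lead_coeff P = 1 \<and> ord w (to_fract P) = 1 \<and>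
     (\<forall>f. \<not> P dvd f \<longrightarrow> ord w (to_fract f) = 0)"

lemma at_prime_ord:
  assumes "at_prime w P" "\<not> P dvd g"
  shows "ord w (to_fract (P ^ n * g)) = int n"
proof -
  have "g \<noteq> 0" "P \<noteq> 0" using assms by (auto simp: at_prime_def)
  thus ?thesis using assms
    by (induction n) (auto simp: at_prime_def ord_mult mult.assoc)
qed

lemma at_prime_nonneg: "at_prime w P \<Longrightarrow> ord_ge w 0 (to_fract f)"
  using prime_power_decompose[of P f] at_prime_ord[of w P]
  by (cases "f = 0") (auto simp: ord_ge_def at_prime_def simp del: to_fract_mult)

lemma at_prime_dvd_iff: "at_prime w P \<Longrightarrow> P dvd f \<longleftrightarrow> ord_ge w 1 (to_fract f)"
proof
  assume w: "at_prime w P" and "P dvd f"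
  then obtain g where "f = P * g" by (auto elim: dvdE)
  moreover have "ord_ge w (1 + 0) (to_fract P * to_fract g)"
    using w at_prime_nonneg by (intro ord_ge_mult) (auto simp: ord_ge_def at_prime_def)
  ultimately show "ord_ge w 1 (to_fract f)" by simp
next
  assume w: "at_prime w P" and "ord_ge w 1 (to_fract f)"
  thus "P dvd f" by (auto simp: ord_ge_def at_prime_def)
qed

lemma at_prime_place_unique: "at_prime w P \<Longrightarrow> at_prime w' P \<Longrightarrow> w = w'"
  by (rule place_eqI) (metis at_prime_def at_prime_ord prime_power_decompose)

lemma monic_dvd_antisym:
  fixes P Q :: "'k::field poly"
  assumes "P dvd Q" "Q dvd P" "lead_coeff P = 1" "lead_coeff Q = 1"
  shows "P = Q"
proof -
  obtain c where c: "P = Q * c" using assms(2) by (auto elim: dvdE)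
  have "degree P = degree Q"
    using assms by (metis dvd_imp_degree_le le_antisym leading_coeff_0_iff zero_neq_one)
  moreover have "Q \<noteq> 0" "c \<noteq> 0" using assms c by auto
  ultimately have "degree c = 0" using c by (simp add: degree_mult_eq)
  then obtain a where "c = [:a:]" by (rule degree_eq_zeroE)
  with c assms \<open>degree P = degree Q\<close> have "a = 1"
    by (metis add.right_neutral lead_coeff_pCons(2) lead_coeff_mult mult_1 pCons_0_0)
  with c \<open>c = [:a:]\<close> show ?thesis by simp
qed

lemma at_prime_prime_unique:
  assumes "at_prime w P" "at_prime w Q"
  shows "P = Q"
proof (rule monic_dvd_antisym)
  have "ord_ge w 1 (to_fract P)" "ord_ge w 1 (to_fract Q)"
    using assms by (auto simp: at_prime_def ord_ge_def)
  thus "P dvd Q" "Q dvd P" using assms by (simp_all add: at_prime_dvd_iff)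
qed (use assms in \<open>auto simp: at_prime_def\<close>)

text \<open>The multiplicity of \<open>P\<close> in a polynomial is additive on products because
  \<open>P\<close> is prime, and a power of \<open>P\<close> dividing two polynomials divides
  their sum.\<close>

lemma ex_at_prime:
  fixes P :: "'k::{finite,field} poly"
  assumes P: "prime_elem P" "lead_coeff P = 1"
  shows "\<exists>w. at_prime w P"
proof -
  define m where "m f = int (THE n. \<exists>g. f = P ^ n * g \<and> \<not> P dvd g)" for f
  have m: "m (P ^ n * g) = int n" if "\<not> P dvd g" for n g
    unfolding m_def using that prime_power_decompose_unique[OF P(1)]
    by (intro arg_cong[of _ _ int] the_equality) blast+
  have nz: "P \<noteq> 0" "P ^ n \<noteq> 0" for n using P by auto
  have "\<exists>w :: 'k place. \<forall>a. a \<noteq> 0 \<longrightarrow> ord w (to_fract a) = m a"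
  proof (rule valuation_extension[where p = P])
    fix a b :: "'k poly" assume "a \<noteq> 0" "b \<noteq> 0"
    then obtain n g n' h where *: "a = P ^ n * g" "\<not> P dvd g" "b = P ^ n' * h" "\<not> P dvd h"
      using prime_power_decompose[OF P(1)] by meson
    have "a * b = P ^ (n + n') * (g * h)" by (simp add: * power_add algebra_simps)
    moreover have "\<not> P dvd g * h" using * P(1) by (simp add: prime_elem_dvd_mult_iff)
    ultimately have "m (a * b) = int (n + n')" using m by simp
    thus "m (a * b) = m a + m b" using * m by simp
    assume ab: "a + b \<noteq> 0"
    then obtain n'' f where **: "a + b = P ^ n'' * f" "\<not> P dvd f"
      using prime_power_decompose[OF P(1)] by meson
    define l where "l = min n n'"
    have "P ^ l dvd a + b"
      unfolding * l_def by (intro dvd_add dvd_mult2 le_imp_power_dvd) auto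
    have "l \<le> n''"
    proof (rule ccontr)
      assume "\<not> l \<le> n''"
      then obtain k where "l = n'' + Suc k" using less_iff_Suc_add by (auto simp: not_le)
      hence "P ^ n'' * P ^ Suc k dvd P ^ n'' * f"
        using \<open>P ^ l dvd a + b\<close> ** by (simp add: power_add)
      hence "P ^ Suc k dvd f" using nz by (subst (asm) dvd_mult_cancel_left) auto
      thus False using ** dvd_mult_left by auto
    qed
    thus "min (m a) (m b) \<le> m (a + b)"
      using * ** m by (simp add: l_def)
  next
    show "m P = 1" using m[of 1 1] P by (auto simp: prime_elem_def)
  qed (use nz in auto)
  then obtain w :: "'k place" where w: "\<And>a. a \<noteq> 0 \<Longrightarrow> ord w (to_fract a) = m a" by blast
  have "m P = 1" using m[of 1 1] P by (auto simp: prime_elem_def)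
  moreover have "m f = 0" if "\<not> P dvd f" for f using m[of f 0] that by simp
  ultimately have "at_prime w P" unfolding at_prime_def
    using P w nz by (metis dvd_0_right)
  thus ?thesis ..
qed

lemma not_at_prime_infinite_place: "\<not> at_prime infinite_place P"
proof
  assume "at_prime infinite_place P"
  hence "ord infinite_place (to_fract P) = 1" "P \<noteq> 0" by (auto simp: at_prime_def)
  thus False by (simp add: ord_infinite_place)
qed

text \<open>If the valuation is nonnegative on all polynomials, the polynomials of positive value form a
  nonzero prime ideal, and its monic generator is the prime in question. Otherwise the variable
  has negative value, so the leading term dominates in every polynomial and the valuation is a
  positive multiple of minus the degree. Surjectivity onto the integers fixes the multiple in both
  cases.\<close>

lemma place_cases:
  fixes w :: "'k::{finite,field} place"
  obtains "w = infinite_place" | P where "at_prime w P"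
proof (cases "\<forall>f. ord_ge w 0 (to_fract f)")
  case True
  obtain x where x: "x \<noteq> 0" "ord w x = 1" using ord_surj by blast
  have ex: "\<exists>f. ord_ge w 1 (to_fract f) \<and> f \<noteq> 0"
  proof -
    obtain a b where ab: "x = to_fract a / to_fract b" "b \<noteq> 0" by (rule ratfun_cases)
    with x True[rule_format, of b] have "ord_ge w 1 (to_fract a) \<and> a \<noteq> 0"
      by (auto simp: ord_divide ord_ge_def)
    thus ?thesis by blast
  qed
  then obtain f0 where f0: "ord_ge w 1 (to_fract f0)" "f0 \<noteq> 0" by blast
  have "\<exists>P. prime_elem P \<and> lead_coeff P = 1 \<and> ord_ge w 1 (to_fract P)"
    using f0
  proof (induction "degree f0" arbitrary: f0 rule: less_induct)
    case (less f)
    have "degree f > 0"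
    proof (rule ccontr)
      assume "\<not> degree f > 0"
      then obtain c where "f = [:c:]" by (metis degree_eq_zeroE not_gr0)
      thus False using less.prems by (auto simp: ord_ge_def)
    qed
    then obtain P where P: "prime_elem P" "lead_coeff P = 1" "P dvd f"
      using ex_monic_prime_dvd by blast
    show ?case
    proof (cases "ord_ge w 1 (to_fract P)")
      case False
      obtain g where g: "f = P * g" using P by (auto elim: dvdE)
      with less.prems have nz: "g \<noteq> 0" "P \<noteq> 0" by auto
      have "ord w (to_fract P) = 0" using False True nz by (force simp: ord_ge_def)
      hence "ord_ge w 1 (to_fract g)" using less.prems g nz by (auto simp: ord_ge_def ord_mult)
      moreover have "degree g < degree f"
        using g nz prime_poly_degree_pos[OF P(1)] by (simp add: degree_mult_eq)
      ultimately show ?thesis using less.hyps nz by blast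
    qed (use P in auto)
  qed
  then obtain P where P: "prime_elem P" "lead_coeff P = 1" "ord_ge w 1 (to_fract P)" by blast
  have nd: "ord w (to_fract f) = 0" if nf: "\<not> P dvd f" for f
  proof (rule ccontr)
    assume "ord w (to_fract f) \<noteq> 0"
    hence f: "ord_ge w 1 (to_fract f)" using True[rule_format, of f] by (auto simp: ord_ge_def)
    obtain s r where "s * f + r * P = 1" using bezout_prime[OF P(1) nf] by blast
    hence "to_fract s * to_fract f + to_fract r * to_fract P = 1"
      by (metis to_fract_1 to_fract_add to_fract_mult)
    moreover have "ord_ge w 1 (to_fract s * to_fract f + to_fract r * to_fract P)"
      using True f P by (intro ord_ge_add ord_ge_mult_0) auto
    ultimately show False by simp
  qed
  have P0: "P \<noteq> 0" using P by auto
  obtain a b where ab: "x = to_fract a / to_fract b" "b \<noteq> 0" by (rule ratfun_cases)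
  with x have "a \<noteq> 0" by auto
  then obtain n g m h where "a = P ^ n * g" "\<not> P dvd g" "b = P ^ m * h" "\<not> P dvd h"
    using prime_power_decompose[OF P(1)] ab by meson
  moreover have pw: "ord w (to_fract (P ^ j * g)) = int j * ord w (to_fract P)" if "\<not> P dvd g" for j g
  proof -
    have "g \<noteq> 0" using that by auto
    thus ?thesis using nd[OF that] P0 by (induction j) (auto simp: ord_mult mult.assoc algebra_simps)
  qed
  (* By surjectivity some x has order 1, so the positive integer ord w P divides 1. *)
  ultimately have "1 = (int n - int m) * ord w (to_fract P)"
    using x ab \<open>a \<noteq> 0\<close> by (simp add: ord_divide algebra_simps del: to_fract_mult)
  hence "ord w (to_fract P) dvd 1" by (metis dvd_triv_right)
  hence "ord w (to_fract P) = 1" using P(3) P0 by (auto simp: ord_ge_def)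
  hence "at_prime w P" using P nd by (simp add: at_prime_def)
  thus thesis by (rule that(2))
next
  case False
  define tt where "tt = to_fract [:0, 1 :: 'k:]"
  have tt0: "tt \<noteq> 0" by (simp add: tt_def)
  have split: "to_fract (pCons a f) = to_fract [:a:] + tt * to_fract f" for a f
  proof -
    have "pCons a f = [:a:] + [:0, 1:] * f" by simp
    thus ?thesis unfolding tt_def by (metis to_fract_add to_fract_mult)
  qed
  have tneg: "ord w tt < 0"
  proof (rule ccontr)
    assume "\<not> ord w tt < 0"
    hence "ord_ge w 0 tt" by (simp add: ord_ge_def)
    have "ord_ge w 0 (to_fract f)" for f
    proof (induction f)
      case (pCons a f)
      show ?case unfolding split[of a f]
        using \<open>ord_ge w 0 tt\<close> pCons by (intro ord_ge_add ord_ge_mult_0 ord_ge_const) auto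
    qed simp
    with False show False by blast
  qed
  have deg: "ord w (to_fract f) = int (degree f) * ord w tt" if "f \<noteq> 0" for f
    using that
  proof (induction f)
    case (pCons a f)
    show ?case
    proof (cases "f = 0")
      case False
      have *: "to_fract (pCons a f) = tt * to_fract f + to_fract [:a:]"
        by (simp only: split[of a f] add.commute)
      have o: "ord w (tt * to_fract f) = int (degree (pCons a f)) * ord w tt"
        using False pCons tt0 by (simp add: ord_mult algebra_simps)
      have "int (degree (pCons a f)) * ord w tt < 0"
        using False tneg by (simp add: mult_less_0_iff)
      hence "ord_ge w (ord w (tt * to_fract f) + 1) (tt * to_fract f - to_fract (pCons a f))"
        by (subst *) (simp add: o ord_ge_def)
      from ord_eq_of_diff[OF _ this] show ?thesis using False tt0 o by simp
    qed auto
  qed simp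
  obtain x where x: "x \<noteq> 0" "ord w x = 1" using ord_surj by blast
  obtain a b where ab: "x = to_fract a / to_fract b" "b \<noteq> 0" by (rule ratfun_cases)
  (* As in the other case, ord w tt is a negative divisor of 1. *)
  have "1 = (int (degree a) - int (degree b)) * ord w tt"
    using x ab by (auto simp: ord_divide deg algebra_simps)
  hence "ord w tt dvd 1" by (metis dvd_triv_right)
  hence "ord w tt = -1" using tneg by auto
  hence "w = infinite_place"
    by (intro place_eqI) (simp add: deg ord_infinite_place)
  thus thesis by (rule that(1))
qed

lemma finite_place_at_prime: "w \<noteq> infinite_place \<Longrightarrow> \<exists>P. at_prime w P"
  using place_cases by blast

lemma finite_place_nonneg: "w \<noteq> infinite_place \<Longrightarrow> ord_ge w 0 (to_fract f)"
  using finite_place_at_prime at_prime_nonneg by blast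

text \<open>The degree of a point of the projective line read off from the classification of places; that it
  is the degree of the residue field over the constants is shown in
  \<open>place_degree_eq\<close>.\<close>

definition geom_degree :: "'k::{finite,field} place \<Rightarrow> nat" where
  "geom_degree w = (if w = infinite_place then 1 else degree (THE P. at_prime w P))"

lemma geom_degree_infinite [simp]: "geom_degree infinite_place = 1"
  by (simp add: geom_degree_def)

lemma geom_degree_at_prime: "at_prime w P \<Longrightarrow> geom_degree w = degree P"
  unfolding geom_degree_def using not_at_prime_infinite_place at_prime_prime_unique
  by (metis the_equality)

lemma geom_degree_pos: "geom_degree w > 0"
  using place_cases[of w] prime_poly_degree_pos
  by (metis at_prime_def geom_degree_at_prime geom_degree_infinite zero_less_one)

subsection \<open>The product formula\<close>

lemma ord_other_prime:
  assumes "at_prime w P" "w' \<noteq> w" "w' \<noteq> infinite_place"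
  shows "ord w' (to_fract P) = 0"
proof -
  obtain Q where Q: "at_prime w' Q" using finite_place_at_prime[OF assms(3)] by blast
  have "\<not> Q dvd P"
  proof
    assume "Q dvd P"
    then obtain c where c: "P = Q * c" by (auto elim: dvdE)
    have "irreducible P" "\<not> is_unit Q"
      using assms(1) Q by (auto simp: at_prime_def prime_elem_def prime_elem_imp_irreducible)
    hence "is_unit c" using c by (auto simp: Factorial_Ring.irreducible_def)
    hence "P dvd Q" unfolding c by (simp add: mult_unit_dvd_iff)
    hence "P = Q" using \<open>Q dvd P\<close> assms(1) Q
      by (intro monic_dvd_antisym) (auto simp: at_prime_def)
    thus False using assms Q at_prime_place_unique by blast
  qed
  thus ?thesis using Q by (auto simp: at_prime_def)
qed

definition principal_degree_zero :: "'k::{finite,field} ratfun \<Rightarrow> bool" where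
  "principal_degree_zero x \<longleftrightarrow> finite {w. ord w x \<noteq> 0} \<and>
     Sum_any (\<lambda>w. int (geom_degree w) * ord w x) = 0"

lemma principal_degree_zero_mult:
  assumes "principal_degree_zero x" "principal_degree_zero y" "x \<noteq> 0" "y \<noteq> 0"
  shows "principal_degree_zero (x * y)"
proof -
  have f: "finite {w. ord w x \<noteq> 0}" "finite {w. ord w y \<noteq> 0}"
    using assms by (auto simp: principal_degree_zero_def)
  have "finite {w. ord w (x * y) \<noteq> 0}"
    by (rule finite_subset[OF _ finite_UnI[OF f]]) (use assms in \<open>auto simp: ord_mult\<close>)
  moreover have "Sum_any (\<lambda>w. int (geom_degree w) * ord w (x * y)) =
      Sum_any (\<lambda>w. int (geom_degree w) * ord w x + int (geom_degree w) * ord w y)"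
    using assms by (simp add: ord_mult algebra_simps)
  moreover have "\<dots> = Sum_any (\<lambda>w. int (geom_degree w) * ord w x) + Sum_any (\<lambda>w. int (geom_degree w) * ord w y)"
    by (intro Sum_any.distrib) (use f in \<open>auto intro: finite_subset[rotated]\<close>)
  ultimately show ?thesis using assms by (simp add: principal_degree_zero_def)
qed

lemma principal_degree_zero_inverse:
  assumes "principal_degree_zero x"
  shows "principal_degree_zero (inverse x)"
  using assms unfolding principal_degree_zero_def
  by (simp add: ord_inverse Sum_any.expand_set sum_negf)

lemma principal_degree_zero_const: "principal_degree_zero (to_fract [:c:])"
  by (simp add: principal_degree_zero_def)

lemma principal_degree_zero_prime:
  assumes "at_prime w P"
  shows "principal_degree_zero (to_fract P)"
proof -
  have P0: "P \<noteq> 0" using assms by (auto simp: at_prime_def)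
  have ne: "w \<noteq> infinite_place" using assms not_at_prime_infinite_place by blast
  have sub: "{w'. ord w' (to_fract P) \<noteq> 0} \<subseteq> {w, infinite_place}"
    using ord_other_prime[OF assms] by blast
  have "Sum_any (\<lambda>w. int (geom_degree w) * ord w (to_fract P)) =
      (\<Sum>w\<in>{w, infinite_place}. int (geom_degree w) * ord w (to_fract P))"
    by (rule Sum_any.expand_superset) (use sub in auto)
  also have "\<dots> = 0" using ne assms P0
    by (simp add: geom_degree_at_prime[OF assms] ord_infinite_place at_prime_def)
  finally show ?thesis using sub finite_subset unfolding principal_degree_zero_def by fastforce
qed

lemma principal_degree_zero_poly: "f \<noteq> 0 \<Longrightarrow> principal_degree_zero (to_fract f)"
proof (induction "degree f" arbitrary: f rule: less_induct)
  case less
  show ?case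
  proof (cases "degree f = 0")
    case True
    thus ?thesis by (metis degree_eq_zeroE principal_degree_zero_const)
  next
    case False
    then obtain P where P: "prime_elem P" "lead_coeff P = 1" "P dvd f"
      using ex_monic_prime_dvd by blast
    then obtain w where w: "at_prime w P" using ex_at_prime by blast
    obtain g where g: "f = P * g" using P by (auto elim: dvdE)
    with less.prems have nz: "g \<noteq> 0" "P \<noteq> 0" by auto
    have "degree g < degree f"
      using g nz prime_poly_degree_pos[OF P(1)] by (simp add: degree_mult_eq)
    thus ?thesis using less.hyps nz g principal_degree_zero_prime[OF w]
      by (auto intro: principal_degree_zero_mult)
  qed
qed

text \<open>The claim is multiplicative in \<open>x\<close>, so it is enough to check constants and monic
  primes. A monic prime \<open>P\<close> has a simple zero at its own place, whose degree is
  \<open>degree P\<close>, a pole of order \<open>degree P\<close> at infinity, and no other zeros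
  or poles.\<close>

theorem product_formula:
  assumes "x \<noteq> 0"
  shows "finite {w. ord w x \<noteq> 0}" "Sum_any (\<lambda>w. int (geom_degree w) * ord w x) = 0"
proof -
  obtain a b where "x = to_fract a * inverse (to_fract b)" "b \<noteq> 0"
    by (rule ratfun_cases) (simp add: divide_inverse)
  with assms have "principal_degree_zero x"
    by (auto intro!: principal_degree_zero_mult principal_degree_zero_inverse principal_degree_zero_poly)
  thus "finite {w. ord w x \<noteq> 0}" "Sum_any (\<lambda>w. int (geom_degree w) * ord w x) = 0"
    by (simp_all add: principal_degree_zero_def)
qed

subsection \<open>Residue classes\<close>

text \<open>Representatives of the residue classes at a place of degree \<open>n\<close>. The condition on
  coefficients, rather than on the degree, treats the zero polynomial on the same footing as the
  others.\<close>

definition polys_below :: "nat \<Rightarrow> 'k::zero poly set" where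
  "polys_below n = {f. \<forall>i\<ge>n. poly.coeff f i = 0}"

lemma polys_below_Suc: "polys_below (Suc n) = (\<lambda>(c, f). pCons c f) ` (UNIV \<times> polys_below n)"
proof (intro equalityI subsetI)
  fix f :: "'a poly" assume f: "f \<in> polys_below (Suc n)"
  obtain c g where "f = pCons c g" by (cases f)
  with f have "g \<in> polys_below n" by (auto simp: polys_below_def dest: spec[of _ "Suc _"])
  with \<open>f = pCons c g\<close> show "f \<in> (\<lambda>(c, f). pCons c f) ` (UNIV \<times> polys_below n)" by force
next
  fix f :: "'a poly" assume "f \<in> (\<lambda>(c, f). pCons c f) ` (UNIV \<times> polys_below n)"
  thus "f \<in> polys_below (Suc n)"
    by (auto simp: polys_below_def coeff_pCons split: nat.splits)
qed

lemma card_polys_below: "card (polys_below n :: 'k::{finite,zero} poly set) = CARD('k) ^ n"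
proof (induction n)
  case 0
  have "(polys_below 0 :: 'k poly set) = {0}" by (auto simp: polys_below_def poly_eq_iff)
  thus ?case by simp
next
  case (Suc n)
  have "card (polys_below (Suc n) :: 'k poly set) = card ((UNIV :: 'k set) \<times> (polys_below n :: 'k poly set))"
    unfolding polys_below_Suc by (rule card_image) (auto simp: inj_on_def)
  thus ?case by (simp add: Suc card_cartesian_product)
qed

lemma polys_below_degree: "f \<in> polys_below n \<Longrightarrow> f \<noteq> 0 \<Longrightarrow> degree f < n"
  using leading_coeff_0_iff[of f] by (fastforce simp: polys_below_def not_less[symmetric])

lemma polys_belowI: "f = 0 \<or> degree f < n \<Longrightarrow> f \<in> polys_below n"
  by (auto simp: polys_below_def coeff_eq_0)

lemma polys_below_diff: "f \<in> polys_below n \<Longrightarrow> g \<in> polys_below n \<Longrightarrow> f - g \<in> polys_below n"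
  for f g :: "'a::ab_group_add poly"
  by (simp add: polys_below_def)

text \<open>Write \<open>x = a / b\<close> and divide with remainder:
  \<open>x - a div b = (a mod b) / b\<close> has a zero at infinity.\<close>

lemma infinite_place_poly_part: "\<exists>q. ord_ge infinite_place 1 (x - to_fract q)"
proof -
  obtain a b where ab: "x = to_fract a / to_fract b" "b \<noteq> 0" by (rule ratfun_cases)
  have "x - to_fract (a div b) = (to_fract a - to_fract (a div b) * to_fract b) / to_fract b"
    using ab by (simp add: field_simps)
  also have "to_fract a - to_fract (a div b) * to_fract b = to_fract (a mod b)"
    by (metis minus_div_mult_eq_mod to_fract_diff to_fract_mult)
  finally have *: "x - to_fract (a div b) = to_fract (a mod b) / to_fract b" .
  have "ord_ge infinite_place 1 (x - to_fract (a div b))"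
  proof (cases "a mod b = 0")
    case False
    with ab(2) have "degree (a mod b) < degree b" by (simp add: degree_mod_less')
    with False ab(2) show ?thesis unfolding * by (simp add: ord_ge_def ord_divide ord_infinite_place)
  qed (simp add: *)
  thus ?thesis ..
qed

text \<open>At infinity the polynomial part of an element without pole is a constant. At a prime
  \<open>P\<close> the denominator can be taken prime to \<open>P\<close>, hence is invertible
  modulo \<open>P\<close>, and the resulting polynomial is reduced modulo \<open>P\<close>.\<close>

lemma residue_rep_exists:
  assumes "ord_ge w 0 x"
  shows "\<exists>a \<in> polys_below (geom_degree w). ord_ge w 1 (x - to_fract a)"
proof (cases rule: place_cases[of w])
  case 1
  obtain q where q: "ord_ge infinite_place 1 (x - to_fract q)"
    using infinite_place_poly_part by blast
  have "ord_ge w 0 (x - to_fract q)" using q 1 ord_ge_mono[of w 1 _ 0] by simp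
  hence "ord_ge w 0 (to_fract q)" using ord_ge_diff[OF assms, of "x - to_fract q"] by simp
  hence "q = 0 \<or> degree q < 1" using 1 ord_infinite_place[of q] by (cases "q = 0") (simp_all add: ord_ge_def)
  hence "q \<in> polys_below (geom_degree w)" using 1 by (intro polys_belowI) simp
  thus ?thesis using q 1 by blast
next
  case (2 P)
  have P: "prime_elem P" using 2 by (simp add: at_prime_def)
  hence P0: "P \<noteq> 0" by auto
  have "\<exists>c e. x = to_fract c / to_fract e \<and> \<not> P dvd e"
  proof (cases "x = 0")
    case True
    thus ?thesis using P by (intro exI[of _ 0] exI[of _ 1]) (auto simp: prime_elem_def)
  next
    case False
    obtain a b where ab: "x = to_fract a / to_fract b" "b \<noteq> 0" by (rule ratfun_cases)
    with False have "a \<noteq> 0" by auto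
    then obtain n g m h where gh: "a = P ^ n * g" "\<not> P dvd g" "b = P ^ m * h" "\<not> P dvd h"
      using prime_power_decompose[OF P] ab by meson
    have "ord w x = int n - int m"
      using ab \<open>a \<noteq> 0\<close> at_prime_ord[OF 2 gh(2), of n] at_prime_ord[OF 2 gh(4), of m] gh(1,3)
      by (simp add: ord_divide del: to_fract_mult)
    with False assms have "m \<le> n" by (simp add: ord_ge_def)
    then obtain k where k: "n = m + k" using le_Suc_ex by blast
    have "x = to_fract (P ^ k * g) / to_fract h"
      using P0 ab gh(1,3) k by (simp add: power_add mult.assoc)
    thus ?thesis using gh by blast
  qed
  then obtain c e where ce: "x = to_fract c / to_fract e" "\<not> P dvd e" by blast
  then obtain s r where "s * e + r * P = 1" using bezout_prime[OF P] by blast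
  hence sr: "c * s * e + c * r * P = c" by (metis distrib_left mult.assoc mult.right_neutral)
  define a where "a = (c * s) mod P"
  have e0: "e \<noteq> 0" using ce by auto
  have "c - a * e = P * (c * r + (c * s div P) * e)"
    using sr unfolding a_def by (simp add: algebra_simps minus_div_mult_eq_mod[symmetric])
  hence "P dvd c - a * e" by simp
  hence *: "ord_ge w 1 (to_fract (c - a * e))" by (simp only: at_prime_dvd_iff[OF 2])
  have "x - to_fract a = inverse (to_fract e) * to_fract (c - a * e)"
    using ce e0 by (simp add: field_simps)
  moreover have "ord_ge w 0 (inverse (to_fract e))"
    using 2 ce(2) by (simp add: ord_ge_def ord_inverse at_prime_def)
  ultimately have "ord_ge w 1 (x - to_fract a)" using * ord_ge_mult_0(1) by metis
  moreover have "a \<in> polys_below (geom_degree w)"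
    unfolding a_def geom_degree_at_prime[OF 2]
    using degree_mod_less[OF P0, of "c * s"] by (intro polys_belowI) auto
  ultimately show ?thesis by blast
qed

lemma residue_rep_unique:
  assumes "a \<in> polys_below (geom_degree w)" "b \<in> polys_below (geom_degree w)"
    and "ord_ge w 1 (to_fract a - to_fract b)"
  shows "a = b"
proof (rule ccontr)
  assume "a \<noteq> b"
  hence nz: "a - b \<noteq> 0" by simp
  have deg: "degree (a - b) < geom_degree w"
    using polys_below_degree[OF polys_below_diff[OF assms(1,2)] nz] .
  have o: "ord_ge w 1 (to_fract (a - b))" using assms(3) by simp
  show False
  proof (cases rule: place_cases[of w])
    case 1
    with o nz show False by (simp add: ord_ge_def ord_infinite_place del: to_fract_diff)
  next
    case (2 P)
    have "P dvd a - b" using o by (simp only: at_prime_dvd_iff[OF 2])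
    hence "degree P \<le> degree (a - b)" using nz by (rule dvd_imp_degree_le)
    thus False using deg geom_degree_at_prime[OF 2] by simp
  qed
qed

subsection \<open>Strong approximation away from infinity\<close>

text \<open>The summand with denominator \<open>P ^ k\<close> in a partial fraction decomposition of
  \<open>x\<close> carries the whole pole of \<open>x\<close> at \<open>P\<close>, and it has no
  other finite poles.\<close>

lemma partial_fraction:
  assumes "w \<noteq> infinite_place"
  shows "\<exists>u. ord_ge w 0 (x - u) \<and> (\<forall>w'. w' \<noteq> w \<longrightarrow> w' \<noteq> infinite_place \<longrightarrow> ord_ge w' 0 u)"
proof -
  obtain P where P: "at_prime w P" using finite_place_at_prime assms by blast
  hence Pp: "prime_elem P" "P \<noteq> 0" by (auto simp: at_prime_def)
  obtain c e where ce: "x = to_fract c / to_fract e" "e \<noteq> 0" by (rule ratfun_cases)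
  obtain k e' where e': "e = P ^ k * e'" "\<not> P dvd e'"
    using prime_power_decompose[OF Pp(1) ce(2)] by blast
  obtain s r where sr: "s * e' + r * P ^ k = 1" using bezout_prime_power[OF Pp(1) e'(2)] by blast
  have e'0: "e' \<noteq> 0" using e' by auto
  define u where "u = to_fract (c * s) / to_fract (P ^ k)"
  have "c * s * e' + c * r * P ^ k = c" using sr by (metis distrib_left mult.assoc mult.right_neutral)
  hence "to_fract c = to_fract (c * s) * to_fract e' + to_fract (c * r) * to_fract (P ^ k)"
    by (metis to_fract_add to_fract_mult)
  hence "x - u = to_fract (c * r) / to_fract e'"
    unfolding ce u_def e' to_fract_mult[of "P ^ k"] using Pp(2) e'0
    by (simp add: divide_simps del: to_fract_mult)
  hence "x - u = to_fract (c * r) * inverse (to_fract e')" by (simp add: divide_inverse)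
  moreover have "ord_ge w 0 (inverse (to_fract e'))"
    using P e'(2) by (simp add: ord_ge_def ord_inverse at_prime_def)
  ultimately have 1: "ord_ge w 0 (x - u)"
    using at_prime_nonneg[OF P] ord_ge_mult_0(1) by metis
  have pw: "to_fract (P ^ k) = to_fract P ^ k" by (induction k) auto
  have "ord_ge w' 0 u" if w': "w' \<noteq> w" "w' \<noteq> infinite_place" for w'
  proof -
    have "ord w' (to_fract (P ^ k)) = 0"
      using ord_other_prime[OF P w'] Pp by (simp add: pw ord_power)
    hence "ord_ge w' 0 (inverse (to_fract (P ^ k)))" by (simp add: ord_ge_def ord_inverse)
    thus ?thesis unfolding u_def divide_inverse
      using finite_place_nonneg[OF w'(2)] ord_ge_mult_0(1) by blast
  qed
  with 1 show ?thesis by blast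
qed

text \<open>In cohomological terms this is the vanishing of the first cohomology of \<open>O(-1)\<close>:
  partial fractions remove the finitely many poles away from infinity, and a polynomial, which
  creates no new finite poles, corrects the component at infinity.\<close>

theorem strong_approximation:
  fixes b :: "'k::{finite,field} place \<Rightarrow> 'k ratfun"
  assumes "finite {w. \<not> ord_ge w 0 (b w)}"
  shows "\<exists>u. (\<forall>w. w \<noteq> infinite_place \<longrightarrow> ord_ge w 0 (b w - u)) \<and>
             ord_ge infinite_place 1 (b infinite_place - u)"
proof -
  define B where "B = {w. \<not> ord_ge w 0 (b w)} - {infinite_place}"
  have fB: "finite B" using assms by (simp add: B_def)
  have "\<forall>w\<in>B. \<exists>u. ord_ge w 0 (b w - u) \<and> (\<forall>w'. w' \<noteq> w \<longrightarrow> w' \<noteq> infinite_place \<longrightarrow> ord_ge w' 0 u)"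
    using partial_fraction by (auto simp: B_def)
  then obtain h where h: "\<And>w. w \<in> B \<Longrightarrow> ord_ge w 0 (b w - h w)"
    "\<And>w w'. w \<in> B \<Longrightarrow> w' \<noteq> w \<Longrightarrow> w' \<noteq> infinite_place \<Longrightarrow> ord_ge w' 0 (h w)"
    by metis
  define u0 where "u0 = sum h B"
  obtain q where q: "ord_ge infinite_place 1 (b infinite_place - u0 - to_fract q)"
    using infinite_place_poly_part by blast
  have "ord_ge w 0 (b w - (u0 + to_fract q))" if w: "w \<noteq> infinite_place" for w
  proof -
    have "ord_ge w 0 (b w - u0)"
    proof (cases "w \<in> B")
      case True
      hence "u0 = h w + sum h (B - {w})" unfolding u0_def using fB by (simp add: sum.remove)
      hence *: "b w - u0 = (b w - h w) - sum h (B - {w})" by simp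
      show ?thesis unfolding * 
        by (rule ord_ge_diff[OF h(1)[OF True] ord_ge_sum]) (use h(2) w in auto)
    next
      case False
      hence "ord_ge w 0 (b w)" using w by (auto simp: B_def)
      moreover have "ord_ge w 0 (h i)" if "i \<in> B" for i by (rule h(2)) (use False w that in auto)
      ultimately show ?thesis unfolding u0_def by (intro ord_ge_diff ord_ge_sum)
    qed
    hence "ord_ge w 0 (b w - u0 - to_fract q)" using finite_place_nonneg[OF w] by (rule ord_ge_diff)
    thus ?thesis by (simp add: diff_diff_eq)
  qed
  with q show ?thesis by (intro exI[of _ "u0 + to_fract q"]) (simp add: diff_diff_eq)
qed

text \<open>The product of the corresponding powers of monic primes has the prescribed orders.\<close>

theorem class_number_one:
  fixes n :: "'k::{finite,field} place \<Rightarrow> int"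
  assumes "finite {w. n w \<noteq> 0}"
  shows "\<exists>u. u \<noteq> 0 \<and> (\<forall>w. w \<noteq> infinite_place \<longrightarrow> ord w u = n w)"
proof -
  define A where "A = {w. n w \<noteq> 0} - {infinite_place}"
  have fA: "finite A" using assms by (simp add: A_def)
  have "\<forall>w\<in>A. \<exists>P. at_prime w P" using finite_place_at_prime by (auto simp: A_def)
  then obtain P where P: "\<And>w. w \<in> A \<Longrightarrow> at_prime w (P w)" by metis
  have "\<exists>u. u \<noteq> 0 \<and> (\<forall>w. w \<noteq> infinite_place \<longrightarrow> ord w u = (if w \<in> B then n w else 0))"
    if "finite B" "B \<subseteq> A" for B
    using that
  proof (induction B rule: finite_induct)
    case empty
    show ?case by (intro exI[of _ 1]) simp
  next
    case (insert v B)
    then obtain u where u: "u \<noteq> 0" "\<And>w. w \<noteq> infinite_place \<Longrightarrow> ord w u = (if w \<in> B then n w else 0)"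
      by auto
    have v: "at_prime v (P v)" using P insert by blast
    hence nz: "to_fract (P v) \<noteq> 0" by (auto simp: at_prime_def)
    have "ord w (u * to_fract (P v) powi n v) = (if w \<in> insert v B then n w else 0)"
      if "w \<noteq> infinite_place" for w
      using that u nz insert.hyps v ord_other_prime[OF v, of w]
      by (auto simp: ord_mult ord_powi at_prime_def)
    thus ?case using u nz by (intro exI[of _ "u * to_fract (P v) powi n v"]) auto
  qed
  from this[OF fA] show ?thesis by (auto simp: A_def)
qed

section \<open>The completions\<close>

subsection \<open>The completion as a commutative ring\<close>

lemma Cauchy_seqs_iff:
  "s \<in> Cauchy_seqs w \<longleftrightarrow> (\<forall>N. \<exists>M. \<forall>m\<ge>M. \<forall>n\<ge>M. ord_ge w N (s m - s n))"
  by (simp add: Cauchy_seqs_def)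

lemma null_seqs_iff: "s \<in> null_seqs w \<longleftrightarrow> (\<forall>N. \<forall>\<^sub>F n in sequentially. ord_ge w N (s n))"
  by (simp add: null_seqs_def eventually_sequentially)

lemma ord_ge_ex: "\<exists>N. ord_ge w N x"
  by (auto simp: ord_ge_def)

lemma Cauchy_bounded:
  assumes "s \<in> Cauchy_seqs w"
  shows "\<exists>B. \<forall>\<^sub>F n in sequentially. ord_ge w B (s n)"
proof -
  obtain M where M: "\<And>m n. m \<ge> M \<Longrightarrow> n \<ge> M \<Longrightarrow> ord_ge w 0 (s m - s n)"
    using assms unfolding Cauchy_seqs_iff by metis
  obtain B where B: "ord_ge w B (s M)" using ord_ge_ex by blast
  have "ord_ge w (min 0 B) (s n)" if "n \<ge> M" for n
  proof -
    have "ord_ge w (min 0 B) ((s n - s M) + s M)"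
      using M[OF that order_refl] B by (intro ord_ge_add) (auto intro: ord_ge_mono)
    thus ?thesis by simp
  qed
  thus ?thesis by (auto simp: eventually_sequentially)
qed

lemma Cauchy_const: "(\<lambda>n. a) \<in> Cauchy_seqs w"
  by (simp add: Cauchy_seqs_iff)

lemma Cauchy_uminus: "s \<in> Cauchy_seqs w \<Longrightarrow> (\<lambda>n. - s n) \<in> Cauchy_seqs w"
  unfolding Cauchy_seqs_iff by (metis minus_diff_minus ord_ge_uminus)

lemma Cauchy_add:
  assumes "s \<in> Cauchy_seqs w" "t \<in> Cauchy_seqs w"
  shows "(\<lambda>n. s n + t n) \<in> Cauchy_seqs w"
  unfolding Cauchy_seqs_iff
proof
  fix N
  obtain M M' where *: "\<And>m n. m \<ge> M \<Longrightarrow> n \<ge> M \<Longrightarrow> ord_ge w N (s m - s n)"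
    "\<And>m n. m \<ge> M' \<Longrightarrow> n \<ge> M' \<Longrightarrow> ord_ge w N (t m - t n)"
    using assms unfolding Cauchy_seqs_iff by metis
  have "ord_ge w N ((s m + t m) - (s n + t n))" if "m \<ge> max M M'" "n \<ge> max M M'" for m n
  proof -
    have "ord_ge w N ((s m - s n) + (t m - t n))" using * that by (intro ord_ge_add) auto
    thus ?thesis by (simp add: algebra_simps)
  qed
  thus "\<exists>M. \<forall>m\<ge>M. \<forall>n\<ge>M. ord_ge w N ((s m + t m) - (s n + t n))" by blast
qed

lemma Cauchy_mult:
  assumes "s \<in> Cauchy_seqs w" "t \<in> Cauchy_seqs w"
  shows "(\<lambda>n. s n * t n) \<in> Cauchy_seqs w"
  unfolding Cauchy_seqs_iff
proof
  fix N
  obtain B K where B: "\<And>n. n \<ge> K \<Longrightarrow> ord_ge w B (s n)"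
    using Cauchy_bounded[OF assms(1)] by (auto simp: eventually_sequentially)
  obtain B' K' where B': "\<And>n. n \<ge> K' \<Longrightarrow> ord_ge w B' (t n)"
    using Cauchy_bounded[OF assms(2)] by (auto simp: eventually_sequentially)
  obtain M M' where *: "\<And>m n. m \<ge> M \<Longrightarrow> n \<ge> M \<Longrightarrow> ord_ge w (N - B') (s m - s n)"
    "\<And>m n. m \<ge> M' \<Longrightarrow> n \<ge> M' \<Longrightarrow> ord_ge w (N - B) (t m - t n)"
    using assms unfolding Cauchy_seqs_iff by metis
  define L where "L = max (max K K') (max M M')"
  have "ord_ge w N (s m * t m - s n * t n)" if "m \<ge> L" "n \<ge> L" for m n
  proof -
    have "ord_ge w (B + (N - B)) (s m * (t m - t n))" "ord_ge w ((N - B') + B') ((s m - s n) * t n)"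
      by (rule ord_ge_mult; use * B B' that in \<open>simp add: L_def\<close>)+
    hence "ord_ge w N (s m * (t m - t n) + (s m - s n) * t n)" by (intro ord_ge_add) simp_all
    thus ?thesis by (simp add: algebra_simps)
  qed
  thus "\<exists>M. \<forall>m\<ge>M. \<forall>n\<ge>M. ord_ge w N (s m * t m - s n * t n)" by blast
qed

lemma null_imp_Cauchy: "s \<in> null_seqs w \<Longrightarrow> s \<in> Cauchy_seqs w"
  unfolding null_seqs_def Cauchy_seqs_def by (auto intro: ord_ge_diff) (meson ord_ge_diff)

lemma null_add: "s \<in> null_seqs w \<Longrightarrow> t \<in> null_seqs w \<Longrightarrow> (\<lambda>n. s n + t n) \<in> null_seqs w"
  unfolding null_seqs_iff
proof
  fix N assume "\<forall>N. \<forall>\<^sub>F n in sequentially. ord_ge w N (s n)" "\<forall>N. \<forall>\<^sub>F n in sequentially. ord_ge w N (t n)"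
  hence "\<forall>\<^sub>F n in sequentially. ord_ge w N (s n)" "\<forall>\<^sub>F n in sequentially. ord_ge w N (t n)" by blast+
  thus "\<forall>\<^sub>F n in sequentially. ord_ge w N (s n + t n)" by eventually_elim (rule ord_ge_add)
qed

lemma null_uminus: "s \<in> null_seqs w \<Longrightarrow> (\<lambda>n. - s n) \<in> null_seqs w"
  unfolding null_seqs_iff by simp

lemma null_mult:
  assumes "s \<in> null_seqs w" "t \<in> Cauchy_seqs w"
  shows "(\<lambda>n. s n * t n) \<in> null_seqs w"
  unfolding null_seqs_iff
proof
  fix N
  obtain B where "\<forall>\<^sub>F n in sequentially. ord_ge w B (t n)" using Cauchy_bounded[OF assms(2)] by blast
  moreover have "\<forall>\<^sub>F n in sequentially. ord_ge w (N - B) (s n)"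
    using assms(1) by (simp add: null_seqs_iff)
  ultimately show "\<forall>\<^sub>F n in sequentially. ord_ge w N (s n * t n)"
  proof eventually_elim
    case (elim n)
    from ord_ge_mult[OF elim(2,1)] show ?case by simp
  qed
qed

lemma Cauchy_ring_simps [simp]:
  "carrier (Cauchy_ring w) = Cauchy_seqs w"
  "mult (Cauchy_ring w) = (\<lambda>s t n. s n * t n)"
  "one (Cauchy_ring w) = (\<lambda>n. 1)"
  "zero (Cauchy_ring w) = (\<lambda>n. 0)"
  "add (Cauchy_ring w) = (\<lambda>s t n. s n + t n)"
  by (simp_all add: Cauchy_ring_def)

lemma cring_Cauchy_ring: "cring (Cauchy_ring w)"
proof (rule cringI)
  show "abelian_group (Cauchy_ring w)"
  proof (rule abelian_groupI)
    fix s assume "s \<in> carrier (Cauchy_ring w)"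
    thus "\<exists>t\<in>carrier (Cauchy_ring w). t \<oplus>\<^bsub>Cauchy_ring w\<^esub> s = \<zero>\<^bsub>Cauchy_ring w\<^esub>"
      by (intro bexI[of _ "\<lambda>n. - s n"]) (auto intro: Cauchy_uminus)
  qed (auto intro: Cauchy_add Cauchy_const simp: algebra_simps)
  show "comm_monoid (Cauchy_ring w)"
    by (rule comm_monoidI) (auto intro: Cauchy_mult Cauchy_const simp: algebra_simps)
qed (auto simp: algebra_simps)

lemma a_inv_Cauchy_ring: "s \<in> Cauchy_seqs w \<Longrightarrow> \<ominus>\<^bsub>Cauchy_ring w\<^esub> s = (\<lambda>n. - s n)"
proof -
  assume s: "s \<in> Cauchy_seqs w"
  interpret cring "Cauchy_ring w" by (rule cring_Cauchy_ring)
  show ?thesis by (rule minus_equality) (use s Cauchy_uminus in auto)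
qed

lemma ideal_null_seqs: "ideal (null_seqs w) (Cauchy_ring w)"
proof (rule idealI)
  interpret cring "Cauchy_ring w" by (rule cring_Cauchy_ring)
  show "ring (Cauchy_ring w)" by (rule ring_axioms)
  show "subgroup (null_seqs w) (add_monoid (Cauchy_ring w))"
  proof (rule add.subgroupI)
    show "null_seqs w \<subseteq> carrier (Cauchy_ring w)" using null_imp_Cauchy by auto
    have "(\<lambda>n. 0) \<in> null_seqs w" by (simp add: null_seqs_def)
    thus "null_seqs w \<noteq> {}" by blast
    show "\<ominus>\<^bsub>Cauchy_ring w\<^esub> s \<in> null_seqs w" if "s \<in> null_seqs w" for s
      using that by (simp add: a_inv_Cauchy_ring null_imp_Cauchy null_uminus)
  qed (auto intro: null_add)
qed (auto simp: null_mult mult.commute)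

definition cls :: "'k::{finite,field} place \<Rightarrow> (nat \<Rightarrow> 'k ratfun) \<Rightarrow> 'k local_elt" where
  "cls w s = null_seqs w +>\<^bsub>Cauchy_ring w\<^esub> s"

lemma cring_completion: "cring (completion w)"
proof -
  interpret cring "Cauchy_ring w" by (rule cring_Cauchy_ring)
  show ?thesis unfolding completion_def
    by (rule ideal.quotient_is_cring[OF ideal_null_seqs is_cring])
qed

lemma cls_hom: "ring_hom_ring (Cauchy_ring w) (completion w) (cls w)"
  unfolding cls_def[abs_def] completion_def by (rule ideal.rcos_ring_hom_ring[OF ideal_null_seqs])

lemma carrier_completion: "carrier (completion w) = cls w ` Cauchy_seqs w"
  by (auto simp: completion_def FactRing_def A_RCOSETS_def' cls_def)

lemma cls_in_carrier [simp, intro]: "s \<in> Cauchy_seqs w \<Longrightarrow> cls w s \<in> carrier (completion w)"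
  by (simp add: carrier_completion)

lemma completion_cases:
  assumes "x \<in> carrier (completion w)"
  obtains s where "s \<in> Cauchy_seqs w" "x = cls w s"
  using assms by (auto simp: carrier_completion)

lemma mem_cls_iff: "t \<in> cls w s \<longleftrightarrow> (\<lambda>n. t n - s n) \<in> null_seqs w"
proof
  assume "t \<in> cls w s"
  then obtain z where "z \<in> null_seqs w" "t = (\<lambda>n. z n + s n)"
    by (auto simp: cls_def a_r_coset_def')
  thus "(\<lambda>n. t n - s n) \<in> null_seqs w" by simp
next
  assume "(\<lambda>n. t n - s n) \<in> null_seqs w"
  thus "t \<in> cls w s"
    by (auto simp: cls_def a_r_coset_def' intro!: bexI[of _ "\<lambda>n. t n - s n"])
qed

lemma cls_self: "s \<in> cls w s"
  by (simp add: mem_cls_iff null_seqs_def)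

lemma cls_eq_iff: "cls w s = cls w t \<longleftrightarrow> (\<lambda>n. s n - t n) \<in> null_seqs w"
proof
  assume "cls w s = cls w t"
  thus "(\<lambda>n. s n - t n) \<in> null_seqs w" using cls_self[of s w] by (simp add: mem_cls_iff)
next
  assume *: "(\<lambda>n. s n - t n) \<in> null_seqs w"
  have "(\<lambda>n. u n - s n) \<in> null_seqs w \<longleftrightarrow> (\<lambda>n. u n - t n) \<in> null_seqs w" for u
    using null_add[OF *, of "\<lambda>n. u n - s n"] null_add[OF null_uminus[OF *], of "\<lambda>n. u n - t n"]
    by (auto simp: algebra_simps)
  thus "cls w s = cls w t" by (auto simp: mem_cls_iff)
qed

lemma cls_ops:
  "\<one>\<^bsub>completion w\<^esub> = cls w (\<lambda>n. 1)"
  "\<zero>\<^bsub>completion w\<^esub> = cls w (\<lambda>n. 0)"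
  "s \<in> Cauchy_seqs w \<Longrightarrow> t \<in> Cauchy_seqs w \<Longrightarrow> cls w s \<oplus>\<^bsub>completion w\<^esub> cls w t = cls w (\<lambda>n. s n + t n)"
  "s \<in> Cauchy_seqs w \<Longrightarrow> t \<in> Cauchy_seqs w \<Longrightarrow> cls w s \<otimes>\<^bsub>completion w\<^esub> cls w t = cls w (\<lambda>n. s n * t n)"
  "s \<in> Cauchy_seqs w \<Longrightarrow> \<ominus>\<^bsub>completion w\<^esub> cls w s = cls w (\<lambda>n. - s n)"
proof -
  interpret ring_hom_ring "Cauchy_ring w" "completion w" "cls w" by (rule cls_hom)
  show "\<one>\<^bsub>completion w\<^esub> = cls w (\<lambda>n. 1)" using hom_one by simp
  show "\<zero>\<^bsub>completion w\<^esub> = cls w (\<lambda>n. 0)" using hom_zero by simp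
  show "cls w s \<oplus>\<^bsub>completion w\<^esub> cls w t = cls w (\<lambda>n. s n + t n)"
    "cls w s \<otimes>\<^bsub>completion w\<^esub> cls w t = cls w (\<lambda>n. s n * t n)"
    if "s \<in> Cauchy_seqs w" "t \<in> Cauchy_seqs w"
    using that hom_add[of s t] hom_mult[of s t] by simp_all
  show "\<ominus>\<^bsub>completion w\<^esub> cls w s = cls w (\<lambda>n. - s n)" if "s \<in> Cauchy_seqs w"
    using that hom_a_inv[of s] by (simp add: a_inv_Cauchy_ring)
qed

lemma to_completion_conv_cls: "to_completion w a = cls w (\<lambda>n. a)"
  by (simp add: to_completion_def cls_def)

lemma to_completion_in_carrier [simp, intro]: "to_completion w a \<in> carrier (completion w)"
  by (simp add: to_completion_conv_cls Cauchy_const)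

lemma to_completion_ops:
  "to_completion w 1 = \<one>\<^bsub>completion w\<^esub>"
  "to_completion w 0 = \<zero>\<^bsub>completion w\<^esub>"
  "to_completion w (a + b) = to_completion w a \<oplus>\<^bsub>completion w\<^esub> to_completion w b"
  "to_completion w (a * b) = to_completion w a \<otimes>\<^bsub>completion w\<^esub> to_completion w b"
  "to_completion w (- a) = \<ominus>\<^bsub>completion w\<^esub> to_completion w a"
  "to_completion w (a - b) = to_completion w a \<ominus>\<^bsub>completion w\<^esub> to_completion w b"
  by (simp_all add: to_completion_conv_cls cls_ops Cauchy_const Cauchy_uminus a_minus_def)

subsection \<open>The valuation filtration on a completion\<close>

text \<open>The filtration of the completion by powers of the maximal ideal, extending
  \<^const>\<open>ord_ge\<close>. Unlike \<^const>\<open>local_ord\<close> it also behaves at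
  \<open>0\<close>, and it is compatible with sums and products without side conditions.\<close>

definition cge :: "'k::{finite,field} place \<Rightarrow> int \<Rightarrow> 'k local_elt \<Rightarrow> bool" where
  "cge w N x \<longleftrightarrow> (\<exists>s\<in>Cauchy_seqs w. x = cls w s \<and> (\<forall>\<^sub>F n in sequentially. ord_ge w N (s n)))"

lemma cge_carrier: "cge w N x \<Longrightarrow> x \<in> carrier (completion w)"
  by (auto simp: cge_def)

text \<open>The condition can be tested on any representative, since two representatives differ by a null
  sequence.\<close>

lemma cge_cls:
  assumes "s \<in> Cauchy_seqs w"
  shows "cge w N (cls w s) \<longleftrightarrow> (\<forall>\<^sub>F n in sequentially. ord_ge w N (s n))"
proof
  assume "cge w N (cls w s)"
  then obtain t where t: "cls w s = cls w t" "\<forall>\<^sub>F n in sequentially. ord_ge w N (t n)"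
    by (auto simp: cge_def)
  have "\<forall>\<^sub>F n in sequentially. ord_ge w N (s n - t n)"
    using t(1) by (simp add: cls_eq_iff null_seqs_iff)
  with t(2) show "\<forall>\<^sub>F n in sequentially. ord_ge w N (s n)"
  proof eventually_elim
    case (elim n)
    from ord_ge_add[OF elim(2,1)] show ?case by simp
  qed
qed (use assms in \<open>auto simp: cge_def\<close>)

lemma cge_to_completion [simp]: "cge w N (to_completion w a) \<longleftrightarrow> ord_ge w N a"
  by (simp add: to_completion_conv_cls cge_cls Cauchy_const)

lemma cge_zero [simp]: "cge w N \<zero>\<^bsub>completion w\<^esub>"
  by (simp flip: to_completion_ops(2))

lemma cge_one [simp]: "cge w N \<one>\<^bsub>completion w\<^esub> \<longleftrightarrow> N \<le> 0"
  by (simp flip: to_completion_ops(1))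

lemma cge_mono: "cge w N x \<Longrightarrow> M \<le> N \<Longrightarrow> cge w M x"
  unfolding cge_def by (auto elim!: eventually_mono intro: ord_ge_mono)

lemma cge_add:
  assumes "cge w N x" "cge w N z"
  shows "cge w N (x \<oplus>\<^bsub>completion w\<^esub> z)"
proof -
  obtain s t where st: "s \<in> Cauchy_seqs w" "x = cls w s" "t \<in> Cauchy_seqs w" "z = cls w t"
    using assms[THEN cge_carrier] by (metis completion_cases)
  from assms have "\<forall>\<^sub>F n in sequentially. ord_ge w N (s n)" "\<forall>\<^sub>F n in sequentially. ord_ge w N (t n)"
    by (simp_all add: st cge_cls)
  hence "\<forall>\<^sub>F n in sequentially. ord_ge w N (s n + t n)" by eventually_elim (rule ord_ge_add)
  thus ?thesis by (simp add: st cls_ops cge_cls Cauchy_add)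
qed

lemma cge_a_inv:
  assumes "cge w N x"
  shows "cge w N (\<ominus>\<^bsub>completion w\<^esub> x)"
proof -
  obtain s where s: "s \<in> Cauchy_seqs w" "x = cls w s"
    using cge_carrier[OF assms] by (rule completion_cases)
  with assms show ?thesis by (simp add: cls_ops cge_cls Cauchy_uminus)
qed

lemma cge_diff: "cge w N x \<Longrightarrow> cge w N z \<Longrightarrow> cge w N (x \<ominus>\<^bsub>completion w\<^esub> z)"
  unfolding a_minus_def by (intro cge_add cge_a_inv)

lemma cge_mult:
  assumes "cge w N x" "cge w M z"
  shows "cge w (N + M) (x \<otimes>\<^bsub>completion w\<^esub> z)"
proof -
  obtain s t where st: "s \<in> Cauchy_seqs w" "x = cls w s" "t \<in> Cauchy_seqs w" "z = cls w t"
    using assms[THEN cge_carrier] by (metis completion_cases)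
  from assms have "\<forall>\<^sub>F n in sequentially. ord_ge w N (s n)" "\<forall>\<^sub>F n in sequentially. ord_ge w M (t n)"
    by (simp_all add: st cge_cls)
  hence "\<forall>\<^sub>F n in sequentially. ord_ge w (N + M) (s n * t n)" by eventually_elim (rule ord_ge_mult)
  thus ?thesis by (simp add: st cls_ops cge_cls Cauchy_mult)
qed

lemma cge_mult_0: "cge w 0 x \<Longrightarrow> cge w N z \<Longrightarrow> cge w N (x \<otimes>\<^bsub>completion w\<^esub> z)"
  "cge w N x \<Longrightarrow> cge w 0 z \<Longrightarrow> cge w N (x \<otimes>\<^bsub>completion w\<^esub> z)"
  using cge_mult[of w 0 x N z] cge_mult[of w N x 0 z] by simp_all

lemma cge_ex: "x \<in> carrier (completion w) \<Longrightarrow> \<exists>N. cge w N x"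
  by (elim completion_cases) (auto simp: cge_cls dest: Cauchy_bounded)

lemma cge_all_imp_zero:
  assumes "x \<in> carrier (completion w)" "\<And>N. cge w N x"
  shows "x = \<zero>\<^bsub>completion w\<^esub>"
proof -
  obtain s where s: "s \<in> Cauchy_seqs w" "x = cls w s" using assms(1) by (rule completion_cases)
  with assms(2) have "s \<in> null_seqs w" by (simp add: cge_cls null_seqs_iff)
  thus ?thesis by (simp add: s cls_ops cls_eq_iff)
qed

text \<open>A far enough term of a representing sequence approximates the element: the function field is
  dense.\<close>

lemma completion_approx:
  assumes "x \<in> carrier (completion w)"
  shows "\<exists>a. cge w N (x \<ominus>\<^bsub>completion w\<^esub> to_completion w a)"
proof -
  obtain s where s: "s \<in> Cauchy_seqs w" "x = cls w s" using assms(1) by (rule completion_cases)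
  then obtain M where M: "\<And>m n. m \<ge> M \<Longrightarrow> n \<ge> M \<Longrightarrow> ord_ge w N (s m - s n)"
    unfolding Cauchy_seqs_iff by metis
  have C: "(\<lambda>n. s n + - s M) \<in> Cauchy_seqs w" by (intro Cauchy_add s Cauchy_const)
  have "x \<ominus>\<^bsub>completion w\<^esub> to_completion w (s M) = cls w (\<lambda>n. s n + - s M)"
    using s by (simp add: a_minus_def to_completion_conv_cls cls_ops Cauchy_const)
  moreover have "cge w N \<dots>" using C M by (auto simp: cge_cls eventually_sequentially)
  ultimately show ?thesis by metis
qed

text \<open>A Cauchy sequence that is not a null sequence has terms whose order stays below some bound while
  their differences get smaller, so by \<open>ord_eq_of_diff\<close> their order is eventually
  constant, and the same constant is found for every other representative. This is what makes the
  description operator in the definition of \<^const>\<open>local_ord\<close> meaningful.\<close>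

lemma local_ord_cge:
  assumes x: "x \<in> carrier (completion w)" "x \<noteq> \<zero>\<^bsub>completion w\<^esub>"
  shows "cge w N x \<longleftrightarrow> N \<le> local_ord w x"
proof -
  obtain s where s: "s \<in> Cauchy_seqs w" "x = cls w s" using x(1) by (rule completion_cases)
  obtain N0 where N0: "\<not> cge w N0 x" using cge_all_imp_zero x by blast
  obtain M where M: "\<And>m n. m \<ge> M \<Longrightarrow> n \<ge> M \<Longrightarrow> ord_ge w N0 (s m - s n)"
    using s unfolding Cauchy_seqs_iff by metis
  obtain m where m: "m \<ge> M" "\<not> ord_ge w N0 (s m)"
    using N0 s by (auto simp: cge_cls eventually_sequentially)
  define k where "k = ord w (s m)"
  have k: "s m \<noteq> 0" "k < N0" using m by (auto simp: ord_ge_def k_def)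
  have ev: "\<forall>\<^sub>F n in sequentially. t n \<noteq> 0 \<and> ord w (t n) = k" if "t \<in> x" for t
  proof -
    have "\<forall>\<^sub>F n in sequentially. ord_ge w N0 (t n - s n)"
      using that s by (simp add: mem_cls_iff null_seqs_iff)
    moreover have "\<forall>\<^sub>F n in sequentially. n \<ge> M" by (rule eventually_ge_at_top)
    ultimately show ?thesis
    proof eventually_elim
      case (elim n)
      have "ord_ge w N0 ((s m - s n) - (t n - s n))" using M[OF m(1) elim(2)] elim(1) by (rule ord_ge_diff)
      hence "ord_ge w N0 (s m - t n)" by simp
      hence "ord_ge w (ord w (s m) + 1) (s m - t n)" using k(2) by (auto simp: k_def intro: ord_ge_mono)
      from ord_eq_of_diff[OF k(1) this] show ?case by (simp add: k_def)
    qed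
  qed
  have sx: "s \<in> x" using s cls_self by blast
  have "local_ord w x = k" unfolding local_ord_def
  proof (rule the_equality)
    show "\<forall>s\<in>x. \<forall>\<^sub>F n in sequentially. ord w (s n) = k"
      using ev by (blast intro: eventually_mono)
    fix k' assume "\<forall>s\<in>x. \<forall>\<^sub>F n in sequentially. ord w (s n) = k'"
    with sx have "\<forall>\<^sub>F n in sequentially. ord w (s n) = k'" by blast
    with ev[OF sx] have "\<forall>\<^sub>F n in sequentially. k' = k" by eventually_elim auto
    thus "k' = k" by simp
  qed
  moreover have "cge w N x \<longleftrightarrow> N \<le> k"
  proof
    assume "cge w N x"
    with s have "\<forall>\<^sub>F n in sequentially. ord_ge w N (s n)" by (simp add: cge_cls)
    with ev[OF sx] have "\<forall>\<^sub>F n in sequentially. N \<le> k" by eventually_elim (auto simp: ord_ge_def)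
    thus "N \<le> k" by simp
  next
    assume "N \<le> k"
    with ev[OF sx] have "\<forall>\<^sub>F n in sequentially. ord_ge w N (s n)"
      by (auto simp: ord_ge_def elim: eventually_mono)
    thus "cge w N x" using s by (simp add: cge_cls)
  qed
  ultimately show ?thesis by simp
qed

lemma local_integers_iff: "x \<in> local_integers w \<longleftrightarrow> cge w 0 x"
  using local_ord_cge[of x w 0] cge_carrier[of w 0 x] unfolding local_integers_def
  by (cases "x = \<zero>\<^bsub>completion w\<^esub>") auto

subsection \<open>The residue field and the degree of a place\<close>

lemma subring_local_integers: "subring (local_integers w) (completion w)"
proof -
  interpret cring "completion w" by (rule cring_completion)
  show ?thesis
    by (rule subringI) (auto simp: local_integers_iff intro: cge_carrier cge_a_inv cge_add cge_mult_0)
qed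

lemma cring_local_integer_ring: "cring (local_integer_ring w)"
  unfolding local_integer_ring_def
proof -
  interpret cring "completion w" by (rule cring_completion)
  have "subcring (local_integers w) (completion w)"
    by (rule subcringI'[OF subring_local_integers])
  moreover have "local_integers w \<subseteq> carrier (completion w)"
    by (rule subringE(1)[OF subring_local_integers])
  ultimately show "cring (completion w\<lparr>carrier := local_integers w\<rparr>)"
    using subcring_iff by blast
qed

lemma local_integer_ring_simps [simp]:
  "carrier (local_integer_ring w) = local_integers w"
  "mult (local_integer_ring w) = mult (completion w)"
  "add (local_integer_ring w) = add (completion w)"
  "one (local_integer_ring w) = one (completion w)"
  "zero (local_integer_ring w) = zero (completion w)"
  by (simp_all add: local_integer_ring_def)

lemma ex_uniformizer: "\<exists>p. uniformizer w p"
  using ord_surj[of w 1] by (auto simp: uniformizer_def)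

lemma uniformizer_nonzero: "uniformizer w p \<Longrightarrow> p \<noteq> 0"
  by (auto simp: uniformizer_def)

text \<open>Dividing by a uniformizer lowers the filtration by one step.\<close>

lemma max_ideal_eq: "max_ideal w = {x. cge w 1 x}"
proof -
  interpret cring "completion w" by (rule cring_completion)
  define p where "p = (SOME p. uniformizer w p)"
  have p: "uniformizer w p" unfolding p_def using ex_uniformizer by (rule someI_ex)
  have p0: "p \<noteq> 0" using p by (rule uniformizer_nonzero)
  have o: "ord_ge w 1 p" "ord_ge w (-1) (inverse p)"
    using p by (auto simp: uniformizer_def ord_ge_def ord_inverse)
  have "max_ideal w = {x \<otimes>\<^bsub>completion w\<^esub> to_completion w p | x. x \<in> local_integers w}"
    unfolding max_ideal_def cgenideal_def p_def[symmetric] by simp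
  also have "\<dots> = {x. cge w 1 x}"
  proof (intro equalityI subsetI)
    fix x assume "x \<in> {x \<otimes>\<^bsub>completion w\<^esub> to_completion w p | x. x \<in> local_integers w}"
    thus "x \<in> {x. cge w 1 x}" using o by (auto simp: local_integers_iff intro: cge_mult_0)
  next
    fix x assume "x \<in> {x. cge w 1 x}"
    hence x: "cge w 1 x" by simp
    have xc: "x \<in> carrier (completion w)" using x by (rule cge_carrier)
    have "cge w (1 + (-1)) (x \<otimes>\<^bsub>completion w\<^esub> to_completion w (inverse p))"
      using x o by (intro cge_mult) auto
    hence "x \<otimes>\<^bsub>completion w\<^esub> to_completion w (inverse p) \<in> local_integers w"
      by (simp add: local_integers_iff)
    moreover have "x = (x \<otimes>\<^bsub>completion w\<^esub> to_completion w (inverse p)) \<otimes>\<^bsub>completion w\<^esub> to_completion w p"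
      using xc p0 by (simp add: m_assoc flip: to_completion_ops(1,4))
                     (simp add: to_completion_ops(1))
    ultimately show "x \<in> {x \<otimes>\<^bsub>completion w\<^esub> to_completion w p | x. x \<in> local_integers w}" by blast
  qed
  finally show ?thesis .
qed

text \<open>Each step of a dimension count adjoins a line, which multiplies the number of elements by that
  of the field of scalars. Counting thus determines a dimension without a basis.\<close>

lemma (in ring) card_dimension:
  assumes "subfield K R" "finite K" "dimension n K E"
  shows "finite E \<and> card E = card K ^ n"
  using assms(3)
proof (induction n arbitrary: E)
  case 0
  hence "E = {\<zero>}" by (rule dimension_zero[OF assms(1)])
  thus ?case by simp
next
  case (Suc n)
  then obtain v E' where v: "v \<in> carrier R" "v \<notin> E'" "dimension n K E'" "E = line_extension K v E'"
    by (auto elim: dimension.cases)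
  note IH = Suc.IH[OF v(3)]
  note sub = space_subgroup_props[OF assms(1) v(3)]
  note K = subfieldE[OF assms(1)] subring_props[OF assms(1)]
  have E: "E = (\<lambda>(k, e). k \<otimes> v \<oplus> e) ` (K \<times> E')"
    unfolding v(4) by (auto simp: line_extension_mem_iff image_iff) blast+
  have "inj_on (\<lambda>(k, e). k \<otimes> v \<oplus> e) (K \<times> E')"
  proof (rule inj_onI, clarify)
    fix k e k' e' assume *: "k \<in> K" "e \<in> E'" "k' \<in> K" "e' \<in> E'" "k \<otimes> v \<oplus> e = k' \<otimes> v \<oplus> e'"
    have c: "k \<in> carrier R" "k' \<in> carrier R" "e \<in> carrier R" "e' \<in> carrier R"
      using * K(3) sub(1) by auto
    have eq: "(k \<ominus> k') \<otimes> v = e' \<ominus> e"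
    proof -
      have "(k \<ominus> k') \<otimes> v = (k \<otimes> v \<oplus> e) \<ominus> (k' \<otimes> v \<oplus> e)"
        using c v(1) by (simp add: a_minus_def l_distr l_minus minus_add a_ac r_neg r_neg1 r_neg2)
      also have "\<dots> = e' \<ominus> e" unfolding *(5)
        using c v(1) by (simp add: a_minus_def l_distr l_minus minus_add a_ac r_neg r_neg1 r_neg2)
      finally show ?thesis .
    qed
    have "k \<ominus> k' = \<zero>"
    proof (rule ccontr)
      assume n: "k \<ominus> k' \<noteq> \<zero>"
      have kk: "k \<ominus> k' \<in> K" using *(1,3) K by (simp add: a_minus_def)
      (* Otherwise the scalar k - k' is invertible and v would already lie in the smaller space. *)
      have "(k \<ominus> k') \<otimes> v \<in> E'" unfolding eq using sub *(2,4) by (simp add: a_minus_def)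
      hence "v \<in> E'" using sub(6)[of "k \<ominus> k'" v] kk n v(1) by simp
      thus False using v(2) by simp
    qed
    hence "k = k'" using c r_right_minus_eq by simp
    moreover have "e = e'" using *(5) c v(1) unfolding \<open>k = k'\<close> by (metis add.l_cancel m_closed)
    ultimately show "k = k' \<and> e = e'" by simp
  qed
  hence "card E = card (K \<times> E')" unfolding E by (rule card_image)
  thus ?case using IH assms(2) E by (simp add: card_cartesian_product)
qed

lemma local_integer_ring_minus:
  assumes "x \<in> local_integers w" "z \<in> local_integers w"
  shows "x \<ominus>\<^bsub>local_integer_ring w\<^esub> z = x \<ominus>\<^bsub>completion w\<^esub> z"
proof -
  interpret C: cring "completion w" by (rule cring_completion)
  interpret L: cring "local_integer_ring w" by (rule cring_local_integer_ring)
  have "\<ominus>\<^bsub>local_integer_ring w\<^esub> z = \<ominus>\<^bsub>completion w\<^esub> z"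
    by (rule L.minus_equality)
       (use assms in \<open>auto simp: local_integers_iff cge_carrier cge_a_inv C.l_neg\<close>)
  thus ?thesis by (simp add: a_minus_def)
qed

lemma ideal_max_ideal: "ideal (max_ideal w) (local_integer_ring w)"
proof -
  interpret L: cring "local_integer_ring w" by (rule cring_local_integer_ring)
  have "uniformizer w (SOME p. uniformizer w p)" using ex_uniformizer by (rule someI_ex)
  hence "to_completion w (SOME p. uniformizer w p) \<in> local_integers w"
    by (simp add: local_integers_iff ord_ge_def uniformizer_def)
  thus ?thesis unfolding max_ideal_def by (intro L.cgenideal_ideal) simp
qed

lemma ring_residue_field: "ring (residue_field w)"
  unfolding residue_field_def by (rule ideal.quotient_is_ring[OF ideal_max_ideal])

definition residue :: "'k::{finite,field} place \<Rightarrow> 'k ratfun \<Rightarrow> 'k local_elt set" where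
  "residue w a = max_ideal w +>\<^bsub>local_integer_ring w\<^esub> to_completion w a"

lemma residue_eq_iff:
  assumes "ord_ge w 0 a" "ord_ge w 0 b"
  shows "residue w a = residue w b \<longleftrightarrow> ord_ge w 1 (a - b)"
proof -
  interpret L: cring "local_integer_ring w" by (rule cring_local_integer_ring)
  have ab: "to_completion w a \<in> local_integers w" "to_completion w b \<in> local_integers w"
    using assms by (simp_all add: local_integers_iff)
  show ?thesis
    using L.quotient_eq_iff_same_a_r_cos[OF ideal_max_ideal, of "to_completion w a" "to_completion w b"] ab
    by (simp add: residue_def local_integer_ring_minus max_ideal_eq flip: to_completion_ops)
qed

text \<open>By density every residue class contains an element of the function field.\<close>

lemma residue_field_carrier: "carrier (residue_field w) = residue w ` {a. ord_ge w 0 a}"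
proof (intro equalityI subsetI)
  fix S assume "S \<in> carrier (residue_field w)"
  then obtain x where x: "x \<in> local_integers w" "S = max_ideal w +>\<^bsub>local_integer_ring w\<^esub> x"
    by (auto simp: residue_field_def FactRing_def A_RCOSETS_def')
  interpret L: cring "local_integer_ring w" by (rule cring_local_integer_ring)
  have xc: "x \<in> carrier (completion w)" using x cge_carrier by (auto simp: local_integers_iff)
  interpret C: cring "completion w" by (rule cring_completion)
  obtain a where a: "cge w 1 (x \<ominus>\<^bsub>completion w\<^esub> to_completion w a)"
    using completion_approx[OF xc] by blast
  have "cge w 0 (x \<ominus>\<^bsub>completion w\<^esub> (x \<ominus>\<^bsub>completion w\<^esub> to_completion w a))"
    using x a by (intro cge_diff[OF _ cge_mono[OF a]]) (simp_all add: local_integers_iff)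
  also have "x \<ominus>\<^bsub>completion w\<^esub> (x \<ominus>\<^bsub>completion w\<^esub> to_completion w a) = to_completion w a"
    using xc by (simp add: a_minus_def C.minus_add C.r_neg1 C.r_neg2)
  finally have a0: "to_completion w a \<in> local_integers w" by (simp only: local_integers_iff)
  have "S = residue w a" unfolding x(2) residue_def
    using L.quotient_eq_iff_same_a_r_cos[OF ideal_max_ideal, of x "to_completion w a"] x(1) a0 a
    by (simp add: local_integer_ring_minus max_ideal_eq)
  thus "S \<in> residue w ` {a. ord_ge w 0 a}" using a0 by (auto simp: local_integers_iff)
next
  fix S assume "S \<in> residue w ` {a. ord_ge w 0 a}"
  thus "S \<in> carrier (residue_field w)"
    by (auto simp: residue_field_def FactRing_def A_RCOSETS_def' residue_def local_integers_iff)
qed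

lemma card_residue_field:
  "finite (carrier (residue_field w)) \<and>
   card (carrier (residue_field (w :: 'k::{finite,field} place))) = CARD('k) ^ geom_degree w"
proof -
  define A :: "'k poly set" where "A = polys_below (geom_degree w)"
  have nn: "ord_ge w 0 (to_fract a)" if "a \<in> A" for a
  proof (cases "w = infinite_place")
    case True
    with that have "a = 0 \<or> degree a = 0" using polys_below_degree[of a 1] by (cases "a = 0") (auto simp: A_def)
    then obtain c where "a = [:c:]" by (metis degree_0 degree_eq_zeroE)
    thus ?thesis by (simp add: ord_ge_const)
  qed (simp add: finite_place_nonneg)
  have "bij_betw (\<lambda>a. residue w (to_fract a)) A (carrier (residue_field w))"
    unfolding bij_betw_def
  proof
    show "inj_on (\<lambda>a. residue w (to_fract a)) A"
      by (rule inj_onI) (metis A_def nn residue_eq_iff residue_rep_unique)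
    show "(\<lambda>a. residue w (to_fract a)) ` A = carrier (residue_field w)"
      unfolding residue_field_carrier
    proof (intro equalityI subsetI)
      fix S assume "S \<in> residue w ` {a. ord_ge w 0 a}"
      then obtain x where x: "ord_ge w 0 x" "S = residue w x" by blast
      then obtain a where "a \<in> A" "ord_ge w 1 (x - to_fract a)"
        using residue_rep_exists unfolding A_def by blast
      thus "S \<in> (\<lambda>a. residue w (to_fract a)) ` A" using x nn residue_eq_iff by blast
    qed (use nn in auto)
  qed
  moreover have "card A = CARD('k) ^ geom_degree w" unfolding A_def by (rule card_polys_below)
  moreover have "finite A" using calculation(2) by (intro card_ge_0_finite) simp
  ultimately show ?thesis by (metis bij_betw_finite bij_betw_same_card)
qed

text \<open>The residues of the constants are the image of the field \<open>'k\<close> under a ring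
  homomorphism, which is injective because nonzero constants have order \<open>0\<close>.\<close>

lemma constants_subfield: 
  "subfield (constants_in_residue_field w) (residue_field w)"
  "card (constants_in_residue_field (w :: 'k::{finite,field} place)) = CARD('k)"
proof -
  define h where "h = (\<lambda>c :: 'k. residue w (to_fract [:c:]))"
  have C: "constants_in_residue_field w = range h"
    by (simp add: constants_in_residue_field_def h_def residue_def Fract_1_conv)
  let ?K = "ring_of_type_algebra :: 'k ring"
  have Kc: "carrier ?K = UNIV" "mult ?K = (*)" "one ?K = 1" "add ?K = (+)"
    by (simp_all add: ring_of_type_algebra_def fun_eq_iff)
  have ne: "residue w 0 \<noteq> residue w 1" by (subst residue_eq_iff) auto
  have inj: "inj h"
  proof (rule injI)
    fix b c assume "h b = h c"
    hence "ord_ge w 1 (to_fract [:b:] - to_fract [:c:])"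
      unfolding h_def by (subst (asm) residue_eq_iff) (auto intro: ord_ge_const)
    hence "ord_ge w 1 (to_fract [:b - c:])" by (simp flip: to_fract_diff)
    hence "to_fract [:b - c:] = 0" by (simp add: ord_ge_def)
    thus "b = c" by simp
  qed
  show "card (constants_in_residue_field w) = CARD('k)" unfolding C by (rule card_image[OF inj])
  interpret q: ring_hom_ring "local_integer_ring w" "residue_field w"
      "(+>\<^bsub>local_integer_ring w\<^esub>) (max_ideal w)"
    unfolding residue_field_def by (rule ideal.rcos_ring_hom_ring[OF ideal_max_ideal])
  have li: "to_completion w (to_fract [:c:]) \<in> local_integers w" for c
    by (simp add: local_integers_iff ord_ge_const)
  have hom: "h \<in> ring_hom ?K (residue_field w)"
  proof (rule ring_hom_memI)
    fix b c :: 'k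
    have "to_fract [:b * c:] = to_fract [:b:] * to_fract [:c:]" "to_fract [:b + c:] = to_fract [:b:] + to_fract [:c:]"
      by (simp_all flip: to_fract_mult to_fract_add)
    thus "h (b \<otimes>\<^bsub>?K\<^esub> c) = h b \<otimes>\<^bsub>residue_field w\<^esub> h c"
         "h (b \<oplus>\<^bsub>?K\<^esub> c) = h b \<oplus>\<^bsub>residue_field w\<^esub> h c"
      using q.hom_mult[of "to_completion w (to_fract [:b:])" "to_completion w (to_fract [:c:])"]
        q.hom_add[of "to_completion w (to_fract [:b:])" "to_completion w (to_fract [:c:])"] li
      by (simp_all add: h_def residue_def Kc to_completion_ops)
    show "h b \<in> carrier (residue_field w)" by (auto simp: h_def residue_field_carrier ord_ge_const)
    show "h \<one>\<^bsub>?K\<^esub> = \<one>\<^bsub>residue_field w\<^esub>"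
      using q.hom_one by (simp add: h_def residue_def Kc to_completion_ops flip: one_pCons)
  qed
  interpret K: field ?K by (rule field_from_type_algebra)
  interpret h: ring_hom_ring ?K "residue_field w" h
    by (rule ring_hom_ringI2[OF K.ring_axioms ring_residue_field hom])
  have "subfield (h ` carrier ?K) (residue_field w)"
  proof (rule h.img_is_subfield(2))
    show "subfield (carrier ?K) ?K" by (rule K.carrier_is_subfield)
    have "\<one>\<^bsub>residue_field w\<^esub> = residue w 1"
      using q.hom_one by (simp add: residue_def to_completion_ops)
    moreover have "\<zero>\<^bsub>residue_field w\<^esub> = residue w 0"
      using q.hom_zero by (simp add: residue_def to_completion_ops)
    ultimately show "\<one>\<^bsub>residue_field w\<^esub> \<noteq> \<zero>\<^bsub>residue_field w\<^esub>" using ne by simp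
  qed
  thus "subfield (constants_in_residue_field w) (residue_field w)" by (simp add: C Kc)
qed

text \<open>Both sides are the exponent of \<open>q\<close> in the number of elements of the residue field.\<close>

theorem place_degree_eq: "place_degree (w :: 'k::{finite,field} place) = geom_degree w"
proof -
  interpret R: ring "residue_field w" by (rule ring_residue_field)
  let ?K = "constants_in_residue_field w" and ?E = "carrier (residue_field w)"
  note K = constants_subfield[of w]
  note E = card_residue_field[of w]
  obtain Us where Us: "set Us = ?E" using E finite_list by blast
  have "R.Span ?K Us = ?E"
    using R.Span_in_carrier[OF subfieldE(3)[OF K(1)]] R.Span_base_incl[OF K(1)] Us by blast
  hence "R.finite_dimension ?K ?E"
    using R.Span_finite_dimension[OF K(1), of Us] Us by simp
  hence "R.dimension (place_degree w) ?K ?E"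
    using R.finite_dimensionE[OF K(1)] by (simp add: place_degree_def over_def)
  moreover have "finite ?K" using K(2) by (intro card_ge_0_finite) simp
  ultimately have "CARD('k) ^ geom_degree w = CARD('k) ^ place_degree w"
    using R.card_dimension[OF K(1)] E K(2) by metis
  moreover have "CARD('k) > 1"
    using card_mono[of UNIV "{0, 1 :: 'k}"] by simp
  ultimately show ?thesis by (metis power_inject_exp)
qed

section \<open>Two by two matrices over the function field\<close>

definition mk :: "'a \<Rightarrow> 'a \<Rightarrow> 'a \<Rightarrow> 'a \<Rightarrow> 'a mat2" where
  "mk a b c d = (\<lambda>i j. if i = 1 then (if j = 1 then a else b) else (if j = 1 then c else d))"

lemma mk_simps [simp]: "mk a b c d 1 1 = a" "mk a b c d 1 2 = b" "mk a b c d 2 1 = c" "mk a b c d 2 2 = d"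
  by (simp_all add: mk_def)

lemma mat2_eq_iff: "(A :: 'a mat2) = B \<longleftrightarrow> A 1 1 = B 1 1 \<and> A 1 2 = B 1 2 \<and> A 2 1 = B 2 1 \<and> A 2 2 = B 2 2"
  by (auto simp: fun_eq_iff forall_2)

definition mmul :: "'a::comm_ring_1 mat2 \<Rightarrow> 'a mat2 \<Rightarrow> 'a mat2" where
  "mmul A B = (\<lambda>i j. A i 1 * B 1 j + A i 2 * B 2 j)"

definition mone :: "'a::comm_ring_1 mat2" where
  "mone = mk 1 0 0 1"

definition mdet :: "'a::comm_ring_1 mat2 \<Rightarrow> 'a" where
  "mdet A = A 1 1 * A 2 2 - A 1 2 * A 2 1"

definition madj :: "'a::comm_ring_1 mat2 \<Rightarrow> 'a mat2" where
  "madj A = mk (A 2 2) (- A 1 2) (- A 2 1) (A 1 1)"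

definition mscale :: "'a::comm_ring_1 \<Rightarrow> 'a mat2 \<Rightarrow> 'a mat2" where
  "mscale x A = (\<lambda>i j. x * A i j)"

definition minv :: "'a::field mat2 \<Rightarrow> 'a mat2" where
  "minv A = mscale (inverse (mdet A)) (madj A)"

definition mapply :: "'a::comm_ring_1 mat2 \<Rightarrow> (2 \<Rightarrow> 'a) \<Rightarrow> 2 \<Rightarrow> 'a" where
  "mapply A v = (\<lambda>i. A i 1 * v 1 + A i 2 * v 2)"

lemmas mat_defs = mmul_def mone_def mdet_def madj_def mscale_def mapply_def

lemma mmul_assoc: "mmul (mmul A B) C = mmul A (mmul B C)"
  by (simp add: mmul_def algebra_simps)

lemma mmul_mone [simp]: "mmul mone A = A" "mmul A mone = A"
  by (simp_all add: mat2_eq_iff mat_defs)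

lemma mdet_mmul: "mdet (mmul A B) = mdet A * mdet B"
  by (simp add: mat_defs algebra_simps)

lemma mdet_mone [simp]: "mdet mone = 1"
  by (simp add: mat_defs)

lemma mdet_mk [simp]: "mdet (mk a b c d) = a * d - b * c"
  by (simp add: mat_defs)

lemma mdet_mscale: "mdet (mscale x A) = x * x * mdet A"
  by (simp add: mat_defs algebra_simps)

lemma mmul_mk: "mmul (mk a b c d) (mk a' b' c' d') = mk (a * a' + b * c') (a * b' + b * d') (c * a' + d * c') (c * b' + d * d')"
  by (simp add: mat2_eq_iff mat_defs)

lemma mscale_mk: "mscale x (mk a b c d) = mk (x * a) (x * b) (x * c) (x * d)"
  by (simp add: mat2_eq_iff mat_defs)

lemma mscale_mmul: "mmul (mscale x A) B = mscale x (mmul A B)" "mmul A (mscale x B) = mscale x (mmul A B)"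
  by (simp_all add: mat_defs algebra_simps)

lemma mscale_mscale: "mscale x (mscale z A) = mscale (x * z) A"
  by (simp add: mat_defs algebra_simps)

lemma mscale_1 [simp]: "mscale 1 A = A"
  by (simp add: mat_defs)

lemma madj_mmul: "madj (mmul A B) = mmul (madj B) (madj A)"
  by (simp add: mat2_eq_iff mat_defs algebra_simps)

lemma mmul_madj: "mmul A (madj A) = mscale (mdet A) mone" "mmul (madj A) A = mscale (mdet A) mone"
  by (simp_all add: mat2_eq_iff mat_defs algebra_simps)

lemma madj_mscale: "madj (mscale x A) = mscale x (madj A)"
  by (simp add: mat2_eq_iff mat_defs)

lemma mdet_madj [simp]: "mdet (madj A) = mdet A"
  by (simp add: mat_defs)

lemma mmul_minv: "mdet A \<noteq> 0 \<Longrightarrow> mmul A (minv A) = mone" "mdet A \<noteq> 0 \<Longrightarrow> mmul (minv A) A = mone"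
  by (simp_all add: minv_def mscale_mmul mmul_madj mscale_mscale)

lemma mdet_minv: "mdet (minv A) = inverse (mdet A)"
  by (simp add: minv_def mdet_mscale field_simps)

lemma mapply_mmul: "mapply (mmul A B) v = mapply A (mapply B v)"
  by (simp add: fun_eq_iff mat_defs algebra_simps)

lemma mapply_mscale: "mapply (mscale x A) v = (\<lambda>i. x * mapply A v i)"
  by (simp add: fun_eq_iff mat_defs algebra_simps)

lemma mapply_mone [simp]: "mapply mone v = v"
  by (auto simp: fun_eq_iff forall_2 mat_defs)

lemma mapply_nonzero:
  fixes A :: "'a::field mat2"
  assumes "mdet A \<noteq> 0" "v \<noteq> (\<lambda>i. 0)"
  shows "mapply A v \<noteq> (\<lambda>i. 0)"
proof
  assume "mapply A v = (\<lambda>i. 0)"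
  hence "mapply (minv A) (mapply A v) = (\<lambda>i. 0)" by (simp add: mapply_def)
  thus False using assms by (simp add: mmul_minv flip: mapply_mmul)
qed

subsection \<open>Integral matrices at a place\<close>

definition mat_integral :: "'k::{finite,field} place \<Rightarrow> 'k ratfun mat2 \<Rightarrow> bool" where
  "mat_integral w A \<longleftrightarrow> (\<forall>i j. ord_ge w 0 (A i j))"

definition GL2O :: "'k::{finite,field} place \<Rightarrow> 'k ratfun mat2 \<Rightarrow> bool" where
  "GL2O w A \<longleftrightarrow> mat_integral w A \<and> mdet A \<noteq> 0 \<and> ord w (mdet A) = 0"

lemma mat_integral_mk: "mat_integral w (mk a b c d) \<longleftrightarrow> ord_ge w 0 a \<and> ord_ge w 0 b \<and> ord_ge w 0 c \<and> ord_ge w 0 d"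
  by (simp add: mat_integral_def forall_2)

lemma mat_integral_mmul: "mat_integral w A \<Longrightarrow> mat_integral w B \<Longrightarrow> mat_integral w (mmul A B)"
  by (auto simp: mat_integral_def mmul_def intro!: ord_ge_add ord_ge_mult_0(1))

lemma mat_integral_madj: "mat_integral w A \<Longrightarrow> mat_integral w (madj A)"
  by (simp add: mat_integral_def madj_def forall_2)

lemma mat_integral_mscale: "ord_ge w 0 x \<Longrightarrow> mat_integral w A \<Longrightarrow> mat_integral w (mscale x A)"
  by (auto simp: mat_integral_def mscale_def intro!: ord_ge_mult_0(1))

lemma mat_integral_det: "mat_integral w A \<Longrightarrow> ord_ge w 0 (mdet A)"
  by (auto simp: mat_integral_def mdet_def intro!: ord_ge_diff ord_ge_mult_0(1))

lemma GL2O_mone [simp]: "GL2O w mone"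
  by (simp add: GL2O_def mone_def mat_integral_mk)

lemma GL2O_mmul: "GL2O w A \<Longrightarrow> GL2O w B \<Longrightarrow> GL2O w (mmul A B)"
  by (auto simp: GL2O_def mdet_mmul ord_mult intro: mat_integral_mmul)

lemma GL2O_minv: "GL2O w A \<Longrightarrow> GL2O w (minv A)"
proof -
  assume A: "GL2O w A"
  hence "mat_integral w (minv A)" unfolding minv_def GL2O_def
    by (auto simp: ord_inverse ord_ge_def intro!: mat_integral_mscale mat_integral_madj)
  thus ?thesis using A by (simp add: GL2O_def mdet_minv ord_inverse)
qed

lemma GL2O_madj: "GL2O w A \<Longrightarrow> GL2O w (madj A)"
  by (simp add: GL2O_def mat_integral_madj)

lemma GL2O_mk: "GL2O w (mk a b c d) \<longleftrightarrow>
    ord_ge w 0 a \<and> ord_ge w 0 b \<and> ord_ge w 0 c \<and> ord_ge w 0 d \<and> a * d - b * c \<noteq> 0 \<and> ord w (a * d - b * c) = 0"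
  by (simp add: GL2O_def mat_integral_mk)

text \<open>The determinants are integral with product \<open>1\<close>, hence units.\<close>

lemma GL2O_of_integral_inverse:
  assumes "mat_integral w A" "mat_integral w B" "mmul A B = mone"
  shows "GL2O w A"
proof -
  have d: "mdet A * mdet B = 1" using assms(3) by (metis mdet_mmul mdet_mone)
  hence nz: "mdet A \<noteq> 0" "mdet B \<noteq> 0" by auto
  hence "ord w (mdet A) + ord w (mdet B) = 0" using d by (metis ord_mult ord_one)
  thus ?thesis using assms(1,2)[THEN mat_integral_det] assms(1) nz by (auto simp: GL2O_def ord_ge_def)
qed

text \<open>The least order of the coordinates. The case distinction is necessary because
  \<open>ord w 0 = 0\<close> by convention, where the true order of \<open>0\<close> is infinite.\<close>

definition vec_ord :: "'k::{finite,field} place \<Rightarrow> (2 \<Rightarrow> 'k ratfun) \<Rightarrow> int" where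
  "vec_ord w v = (if v 1 = 0 then ord w (v 2) else if v 2 = 0 then ord w (v 1)
     else min (ord w (v 1)) (ord w (v 2)))"

lemma vec_nonzero_iff: "v \<noteq> (\<lambda>i::2. 0) \<longleftrightarrow> v 1 \<noteq> 0 \<or> v 2 \<noteq> 0"
  by (auto simp: fun_eq_iff forall_2)

lemma vec_ord_ge_iff: "v \<noteq> (\<lambda>i. 0) \<Longrightarrow> N \<le> vec_ord w v \<longleftrightarrow> (\<forall>i. ord_ge w N (v i))"
  by (auto simp: vec_nonzero_iff vec_ord_def ord_ge_def forall_2)

lemma vec_ord_mapply:
  assumes "mat_integral w A" "mdet A \<noteq> 0" "v \<noteq> (\<lambda>i. 0)"
  shows "vec_ord w v \<le> vec_ord w (mapply A v)"
proof -
  have "\<forall>i. ord_ge w (vec_ord w v) (v i)" using vec_ord_ge_iff[OF assms(3)] by blast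
  hence "\<forall>i. ord_ge w (vec_ord w v) (mapply A v i)" using assms(1)
    by (auto simp: mapply_def mat_integral_def intro!: ord_ge_add ord_ge_mult_0(1))
  thus ?thesis using vec_ord_ge_iff[OF mapply_nonzero[OF assms(2,3)]] by blast
qed

lemma vec_ord_GL2O:
  assumes "GL2O w A" "v \<noteq> (\<lambda>i. 0)"
  shows "vec_ord w (mapply A v) = vec_ord w v"
proof (rule antisym)
  have A: "mdet A \<noteq> 0" "mat_integral w A" using assms by (auto simp: GL2O_def)
  show "vec_ord w v \<le> vec_ord w (mapply A v)" by (rule vec_ord_mapply[OF A(2,1) assms(2)])
  have "vec_ord w (mapply A v) \<le> vec_ord w (mapply (minv A) (mapply A v))"
    using GL2O_minv[OF assms(1)] A mapply_nonzero[OF A(1) assms(2)]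
    by (intro vec_ord_mapply) (auto simp: GL2O_def)
  thus "vec_ord w (mapply A v) \<le> vec_ord w v" using A by (simp add: mmul_minv flip: mapply_mmul)
qed

lemma vec_ord_scale:
  assumes "x \<noteq> 0" "v \<noteq> (\<lambda>i. 0)"
  shows "vec_ord w (\<lambda>i. x * v i) = ord w x + vec_ord w v"
  using assms by (auto simp: vec_ord_def ord_mult vec_nonzero_iff)

section \<open>The restricted product and the degree of a line\<close>

type_synonym 'k mats = "'k place \<Rightarrow> 'k ratfun mat2"

text \<open>The restricted product of the groups \<open>GL\<^sub>2(F)\<close> with respect to the matrices
  that are integral and invertible at the given place. A member \<open>M\<close> stands for the
  rank two bundle whose generic fibre is \<open>F\<^sup>2\<close> and whose stalk at
  \<open>w\<close> is spanned by the columns of \<open>M w\<close>.\<close>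

definition RP :: "'k::{finite,field} mats set" where
  "RP = {M. (\<forall>w. mdet (M w) \<noteq> 0) \<and> finite {w. \<not> GL2O w (M w)}}"

lemma RP_det: "M \<in> RP \<Longrightarrow> mdet (M w) \<noteq> 0"
  by (simp add: RP_def)

lemma RP_mmul: "M \<in> RP \<Longrightarrow> N \<in> RP \<Longrightarrow> (\<lambda>w. mmul (M w) (N w)) \<in> RP"
proof -
  assume *: "M \<in> RP" "N \<in> RP"
  have "{w. \<not> GL2O w (mmul (M w) (N w))} \<subseteq> {w. \<not> GL2O w (M w)} \<union> {w. \<not> GL2O w (N w)}"
    using GL2O_mmul by blast
  thus ?thesis using * by (auto simp: RP_def mdet_mmul intro: finite_subset)
qed

lemma RP_minv: "M \<in> RP \<Longrightarrow> (\<lambda>w. minv (M w)) \<in> RP"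
proof -
  assume *: "M \<in> RP"
  have "{w. \<not> GL2O w (minv (M w))} \<subseteq> {w. \<not> GL2O w (M w)}" using GL2O_minv by blast
  thus ?thesis using * by (auto simp: RP_def mdet_minv intro: finite_subset)
qed

lemma RP_integral: "(\<And>w. GL2O w (k w)) \<Longrightarrow> k \<in> RP"
  by (auto simp: RP_def) (simp add: GL2O_def)

lemma finite_ord_nonneg: "finite {w. \<not> ord_ge w 0 x}"
proof (cases "x = 0")
  case False
  show ?thesis by (rule finite_subset[OF _ product_formula(1)[OF False]]) (auto simp: ord_ge_def)
qed simp

lemma RP_const:
  assumes "mdet A \<noteq> 0"
  shows "(\<lambda>w. A) \<in> RP"
proof -
  have "{w. \<not> GL2O w A} \<subseteq> (\<Union>i. \<Union>j. {w. \<not> ord_ge w 0 (A i j)}) \<union> {w. ord w (mdet A) \<noteq> 0}"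
    using assms by (auto simp: GL2O_def mat_integral_def)
  moreover have "finite ((\<Union>i. \<Union>j. {w. \<not> ord_ge w 0 (A i j)}) \<union> {w. ord w (mdet A) \<noteq> 0})"
    using product_formula(1)[OF assms] by (simp add: finite_ord_nonneg)
  ultimately have "finite {w. \<not> GL2O w A}" by (rule finite_subset)
  thus ?thesis using assms by (simp add: RP_def)
qed

lemma RP_scalar:
  assumes "\<And>w. x w \<noteq> 0" "finite {w. ord w (x w) \<noteq> 0}"
  shows "(\<lambda>w. mscale (x w) mone) \<in> RP"
proof -
  have "{w. \<not> GL2O w (mscale (x w) mone)} \<subseteq> {w. ord w (x w) \<noteq> 0}"
    using assms(1) by (auto simp: mone_def mscale_mk GL2O_mk ord_mult ord_ge_def)
  thus ?thesis using assms by (auto simp: RP_def mdet_mscale intro: finite_subset)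
qed

lemma finite_weighted: "finite {w. f w \<noteq> 0} \<Longrightarrow> finite {w. int (geom_degree w) * f w \<noteq> 0}"
  by (rule finite_subset[rotated]) auto

lemma Sum_any_mono_int:
  fixes f g :: "'a \<Rightarrow> int"
  assumes "finite {w. f w \<noteq> 0}" "finite {w. g w \<noteq> 0}" "\<And>w. f w \<le> g w"
  shows "Sum_any f \<le> Sum_any g"
proof -
  let ?S = "{w. f w \<noteq> 0} \<union> {w. g w \<noteq> 0}"
  have "Sum_any f = sum f ?S" "Sum_any g = sum g ?S"
    by (rule Sum_any.expand_superset; use assms in auto)+
  thus ?thesis using assms(3) by (simp add: sum_mono)
qed

text \<open>The degree of a divisor.\<close>

definition weighted_sum :: "('k::{finite,field} place \<Rightarrow> int) \<Rightarrow> int" where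
  "weighted_sum f = Sum_any (\<lambda>w. int (geom_degree w) * f w)"

lemma weighted_sum_add:
  "finite {w. f w \<noteq> 0} \<Longrightarrow> finite {w. g w \<noteq> 0} \<Longrightarrow> weighted_sum (\<lambda>w. f w + g w) = weighted_sum f + weighted_sum g"
  unfolding weighted_sum_def distrib_left by (intro Sum_any.distrib finite_weighted)

lemma weighted_sum_uminus: "weighted_sum (\<lambda>w. - f w) = - weighted_sum f"
  by (simp add: weighted_sum_def Sum_any.expand_set sum_negf)

lemma weighted_sum_diff:
  assumes "finite {w. f w \<noteq> 0}" "finite {w. g w \<noteq> 0}"
  shows "weighted_sum (\<lambda>w. f w - g w) = weighted_sum f - weighted_sum g"
  using weighted_sum_add[OF assms(1), of "\<lambda>w. - g w"] assms(2) by (simp add: weighted_sum_uminus)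

lemma weighted_sum_mult: "weighted_sum (\<lambda>w. c * f w) = c * weighted_sum f"
proof (cases "c = 0")
  case False
  thus ?thesis by (simp add: weighted_sum_def Sum_any.expand_set sum_distrib_left mult.left_commute)
qed (simp add: weighted_sum_def)

lemma weighted_sum_mono:
  assumes "finite {w. f w \<noteq> 0}" "finite {w. g w \<noteq> 0}" "\<And>w. f w \<le> g w"
  shows "weighted_sum f \<le> weighted_sum g"
  unfolding weighted_sum_def
  by (intro Sum_any_mono_int finite_weighted assms mult_left_mono) auto

lemma weighted_sum_single: "weighted_sum (\<lambda>w. if w = z then c else 0) = int (geom_degree z) * c"
  unfolding weighted_sum_def by (subst Sum_any.expand_superset[of "{z}"]) auto

lemma weighted_sum_ord: "x \<noteq> 0 \<Longrightarrow> weighted_sum (\<lambda>w. ord w x) = 0"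
  by (simp add: weighted_sum_def product_formula)

text \<open>Let \<open>E\<close> be the bundle given by a family of matrices and \<open>L\<close> its
  saturated line subbundle through the vector \<open>v\<close>. The coordinates of
  \<open>v\<close> in the local basis \<open>A\<close> are those of
  \<open>A\<^sup>-\<^sup>1 v\<close>, so \<open>L\<close> has local degree
  \<open>vec_ord (A\<^sup>-\<^sup>1 v)\<close>, while \<open>E\<close> has local degree
  \<open>- ord (det A)\<close>. The contribution to \<open>2 deg L - deg E\<close> is
  \<open>2 vec_ord (A\<^sup>-\<^sup>1 v) + ord (det A)\<close>, which is the formula below after
  multiplying \<open>A\<^sup>-\<^sup>1\<close> by the determinant. This combination of degrees is
  unchanged when \<open>E\<close> is twisted by a line bundle.\<close>

definition local_degree :: "'k::{finite,field} place \<Rightarrow> 'k ratfun mat2 \<Rightarrow> (2 \<Rightarrow> 'k ratfun) \<Rightarrow> int" where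
  "local_degree w A v = 2 * vec_ord w (mapply (madj A) v) - ord w (mdet A)"

definition line_degree :: "'k::{finite,field} mats \<Rightarrow> (2 \<Rightarrow> 'k ratfun) \<Rightarrow> int" where
  "line_degree M v = weighted_sum (\<lambda>w. local_degree w (M w) v)"

lemma finite_vec_ord:
  assumes "v \<noteq> (\<lambda>i. 0)"
  shows "finite {w. vec_ord w v \<noteq> 0}"
proof -
  have "{w. vec_ord w v \<noteq> 0} \<subseteq> (\<Union>i\<in>{i. v i \<noteq> 0}. {w. ord w (v i) \<noteq> 0})"
    using assms by (auto simp: vec_ord_def vec_nonzero_iff min_def split: if_splits)
  thus ?thesis by (rule finite_subset) (auto intro: product_formula)
qed

lemma local_degree_GL2O: "GL2O w A \<Longrightarrow> v \<noteq> (\<lambda>i. 0) \<Longrightarrow> local_degree w A v = 2 * vec_ord w v"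
  by (auto simp: local_degree_def vec_ord_GL2O GL2O_madj) (simp add: GL2O_def)

lemma finite_local_degree:
  assumes "M \<in> RP" "v \<noteq> (\<lambda>i. 0)"
  shows "finite {w. local_degree w (M w) v \<noteq> 0}"
proof -
  have "{w. local_degree w (M w) v \<noteq> 0} \<subseteq> {w. \<not> GL2O w (M w)} \<union> {w. vec_ord w v \<noteq> 0}"
    using local_degree_GL2O assms(2) by fastforce
  thus ?thesis using assms finite_vec_ord by (auto simp: RP_def intro: finite_subset)
qed

text \<open>A change of basis of the generic fibre changes the local degrees by the orders of a fixed
  element of the function field; these cancel by the product formula.\<close>

lemma line_degree_left:
  assumes "M \<in> RP" "mdet A \<noteq> 0" "v \<noteq> (\<lambda>i. 0)"
  shows "line_degree (\<lambda>w. mmul A (M w)) (mapply A v) = line_degree M v"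
proof -
  have "local_degree w (mmul A (M w)) (mapply A v) = local_degree w (M w) v + ord w (mdet A)" for w
  proof -
    have M: "mdet (M w) \<noteq> 0" using assms(1) by (rule RP_det)
    have "mapply (madj (mmul A (M w))) (mapply A v) = (\<lambda>i. mdet A * mapply (madj (M w)) v i)"
      by (simp add: madj_mmul mmul_assoc mmul_madj mscale_mmul mapply_mscale flip: mapply_mmul)
    thus ?thesis using assms M mapply_nonzero[of "madj (M w)" v]
      by (simp add: local_degree_def vec_ord_scale mdet_mmul ord_mult)
  qed
  thus ?thesis unfolding line_degree_def
    using weighted_sum_add[OF finite_local_degree[OF assms(1,3)] product_formula(1)[OF assms(2)]]
    by (simp add: weighted_sum_ord assms(2))
qed

lemma local_degree_right:
  assumes "GL2O w k" "mdet A \<noteq> 0" "v \<noteq> (\<lambda>i. 0)"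
  shows "local_degree w (mmul A k) v = local_degree w A v"
  using assms mapply_nonzero[of "madj A" v]
  by (simp add: local_degree_def madj_mmul mapply_mmul vec_ord_GL2O GL2O_madj mdet_mmul ord_mult)
     (auto simp: GL2O_def ord_mult)

lemma local_degree_mscale:
  assumes "x \<noteq> 0" "mdet A \<noteq> 0" "v \<noteq> (\<lambda>i. 0)"
  shows "local_degree w (mscale x A) v = local_degree w A v"
  using assms mapply_nonzero[of "madj A" v]
  by (simp add: local_degree_def madj_mscale mapply_mscale vec_ord_scale mdet_mscale ord_mult)

text \<open>Since \<open>h\<close> times its adjugate is multiplication by \<open>det h\<close>, of order
  \<open>1\<close>, and \<open>h\<close> is integral, the adjugate raises the order of a vector by
  at most \<open>1\<close>.\<close>

lemma local_degree_step:
  assumes "mat_integral w h" "mdet h \<noteq> 0" "ord w (mdet h) = 1" "mdet A \<noteq> 0" "v \<noteq> (\<lambda>i. 0)"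
  shows "local_degree w (mmul A h) v \<le> local_degree w A v + 1"
proof -
  define u where "u = mapply (madj A) v"
  have u: "u \<noteq> (\<lambda>i. 0)" using assms by (simp add: u_def mapply_nonzero)
  have "vec_ord w (mapply (madj h) u) \<le> vec_ord w (mapply h (mapply (madj h) u))"
    by (intro vec_ord_mapply mapply_nonzero) (use assms u in auto)
  also have "\<dots> = vec_ord w u + 1"
    using assms u by (simp add: mmul_madj mapply_mscale vec_ord_scale flip: mapply_mmul)
  finally show ?thesis using assms
    by (simp add: local_degree_def madj_mmul mapply_mmul mdet_mmul ord_mult u_def)
qed

lemma line_degree_step:
  assumes "M \<in> RP" "h \<in> RP" "\<And>w. w \<noteq> z \<Longrightarrow> GL2O w (h w)" "mat_integral z (h z)" "ord z (mdet (h z)) = 1"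
    and v: "v \<noteq> (\<lambda>i. 0)"
  shows "line_degree (\<lambda>w. mmul (M w) (h w)) v \<le> line_degree M v + int (geom_degree z)"
proof -
  have fin: "finite {w. (if w = z then 1 else 0 :: int) \<noteq> 0}" by simp
  have "weighted_sum (\<lambda>w. local_degree w (mmul (M w) (h w)) v) \<le>
        weighted_sum (\<lambda>w. local_degree w (M w) v + (if w = z then 1 else 0))"
  proof (rule weighted_sum_mono)
    show "finite {w. local_degree w (mmul (M w) (h w)) v \<noteq> 0}"
      by (rule finite_local_degree[OF RP_mmul v]) fact+
    show "finite {w. local_degree w (M w) v + (if w = z then 1 else 0) \<noteq> 0}"
      by (rule finite_subset[OF _ finite_UnI[OF finite_local_degree[OF assms(1) v] fin]]) auto
    show "local_degree w (mmul (M w) (h w)) v \<le> local_degree w (M w) v + (if w = z then 1 else 0)" for w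
      using assms local_degree_step[of w "h w" "M w" v] local_degree_right[of w "h w" "M w" v]
      by (cases "w = z") (auto simp: RP_det)
  qed
  thus ?thesis unfolding line_degree_def
    using weighted_sum_add[OF finite_local_degree[OF assms(1) v] fin] by (simp add: weighted_sum_single)
qed

subsection \<open>The type of a matrix\<close>

text \<open>For \<open>O \<oplus> O(n)\<close> the maximum of \<open>2 deg L - deg E\<close> is attained at
  the summand \<open>O(n)\<close> and equals \<open>n\<close>. That the maximum exists for every
  family of matrices follows from the reduction theory.\<close>

definition has_type :: "'k::{finite,field} mats \<Rightarrow> int \<Rightarrow> bool" where
  "has_type M n \<longleftrightarrow> (\<exists>v. v \<noteq> (\<lambda>i. 0) \<and> line_degree M v = n) \<and> (\<forall>v. v \<noteq> (\<lambda>i. 0) \<longrightarrow> line_degree M v \<le> n)"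

lemma has_type_unique: "has_type M n \<Longrightarrow> has_type M m \<Longrightarrow> n = m"
  unfolding has_type_def by (meson antisym)

lemma has_type_cong:
  assumes "\<And>v. v \<noteq> (\<lambda>i. 0) \<Longrightarrow> line_degree M v = line_degree N v"
  shows "has_type M n \<longleftrightarrow> has_type N n"
  unfolding has_type_def using assms by metis

text \<open>The vectors are permuted by the base change, so both maxima run over the same values.\<close>

lemma has_type_left:
  assumes "M \<in> RP" "mdet A \<noteq> 0"
  shows "has_type (\<lambda>w. mmul A (M w)) n \<longleftrightarrow> has_type M n"
proof -
  have 1: "\<exists>u. u \<noteq> (\<lambda>i. 0) \<and> v = mapply A u" if "v \<noteq> (\<lambda>i. 0)" for v
    using that assms(2) mapply_nonzero[of "minv A" v]
    by (intro exI[of _ "mapply (minv A) v"]) (simp add: mdet_minv mmul_minv flip: mapply_mmul)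
  have 2: "(\<forall>v. v \<noteq> (\<lambda>i. 0) \<longrightarrow> Q (line_degree (\<lambda>w. mmul A (M w)) v)) \<longleftrightarrow>
      (\<forall>v. v \<noteq> (\<lambda>i. 0) \<longrightarrow> Q (line_degree M v))" (is "?l \<longleftrightarrow> ?r") for Q
  proof
    assume l: ?l
    show ?r
    proof (intro allI impI)
      fix v :: "2 \<Rightarrow> 'a ratfun" assume v: "v \<noteq> (\<lambda>i. 0)"
      with l mapply_nonzero[OF assms(2) v] have "Q (line_degree (\<lambda>w. mmul A (M w)) (mapply A v))" by blast
      thus "Q (line_degree M v)" by (simp only: line_degree_left[OF assms v])
    qed
  next
    assume r: ?r
    show ?l
    proof (intro allI impI)
      fix v :: "2 \<Rightarrow> 'a ratfun" assume "v \<noteq> (\<lambda>i. 0)"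
      then obtain u where u: "u \<noteq> (\<lambda>i. 0)" "v = mapply A u" using 1 by blast
      show "Q (line_degree (\<lambda>w. mmul A (M w)) v)"
        unfolding u(2) line_degree_left[OF assms u(1)] using r u(1) by blast
    qed
  qed
  show ?thesis
    unfolding has_type_def using 2[of "\<lambda>m. m \<noteq> n"] 2[of "\<lambda>m. m \<le> n"] by blast
qed

lemma has_type_right:
  assumes "M \<in> RP" "\<And>w. GL2O w (k w)"
  shows "has_type (\<lambda>w. mmul (M w) (k w)) n \<longleftrightarrow> has_type M n"
  by (rule has_type_cong) (simp add: line_degree_def local_degree_right assms RP_det)

lemma has_type_mscale:
  assumes "M \<in> RP" "\<And>w. x w \<noteq> 0"
  shows "has_type (\<lambda>w. mscale (x w) (M w)) n \<longleftrightarrow> has_type M n"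
  by (rule has_type_cong) (simp add: line_degree_def local_degree_mscale assms RP_det)

text \<open>Let \<open>D\<close> be the degree of the divisor of \<open>a\<close>. The two coordinate lines
  give the values \<open>- D\<close> and \<open>D\<close>. A vector with nonzero first coordinate
  \<open>x\<close> has local degrees at most those of the first coordinate vector plus twice the
  orders of \<open>x\<close>, which sum to zero; the remaining vectors lie on the second line.\<close>

lemma has_type_diag:
  assumes a: "\<And>w. a w \<noteq> 0" "finite {w. ord w (a w) \<noteq> 0}"
  shows "has_type (\<lambda>w. mk (a w) 0 0 1) \<bar>weighted_sum (\<lambda>w. ord w (a w))\<bar>"
proof -
  let ?M = "\<lambda>w. mk (a w) 0 0 1"
  define D where "D = weighted_sum (\<lambda>w. ord w (a w))"
  have "{w. \<not> GL2O w (mk (a w) 0 0 1)} \<subseteq> {w. ord w (a w) \<noteq> 0}"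
    using a(1) by (auto simp: GL2O_mk ord_ge_def)
  hence RP: "?M \<in> RP" using a by (auto simp: RP_def intro: finite_subset)
  have ap: "mapply (madj (mk (a w) 0 0 1)) v = (\<lambda>i. if i = 1 then v 1 else a w * v 2)" for w v
    by (auto simp: fun_eq_iff forall_2 mapply_def madj_def)
  have e1: "line_degree ?M (\<lambda>i. if i = 1 then 1 else 0) = - D"
    using a(1) by (simp add: line_degree_def local_degree_def ap vec_ord_def weighted_sum_uminus D_def)
  have e2: "line_degree ?M (\<lambda>i. if i = 1 then 0 else 1) = D"
    using a(1) by (simp add: line_degree_def local_degree_def ap vec_ord_def ord_mult D_def)
  have "line_degree ?M v \<le> \<bar>D\<bar>" if v: "v \<noteq> (\<lambda>i. 0)" for v
  proof (cases "v 1 = 0")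
    case True
    hence "v 2 \<noteq> 0" using v by (simp add: vec_nonzero_iff)
    hence "line_degree ?M v = weighted_sum (\<lambda>w. 2 * ord w (v 2) + ord w (a w))"
      using a(1) True by (simp add: line_degree_def local_degree_def ap vec_ord_def ord_mult algebra_simps)
    also have "\<dots> = D" using \<open>v 2 \<noteq> 0\<close> a
      by (subst weighted_sum_add) (auto simp: weighted_sum_mult weighted_sum_ord product_formula D_def)
    finally show ?thesis by simp
  next
    case False
    have "weighted_sum (\<lambda>w. local_degree w (mk (a w) 0 0 1) v) \<le> weighted_sum (\<lambda>w. 2 * ord w (v 1) - ord w (a w))"
    proof (rule weighted_sum_mono)
      show "finite {w. local_degree w (mk (a w) 0 0 1) v \<noteq> 0}"
        using finite_local_degree[OF RP v] .
      show "finite {w. 2 * ord w (v 1) - ord w (a w) \<noteq> 0}"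
        by (rule finite_subset[OF _ finite_UnI[OF product_formula(1)[OF False] a(2)]]) auto
      show "local_degree w (mk (a w) 0 0 1) v \<le> 2 * ord w (v 1) - ord w (a w)" for w
        using False a(1) by (auto simp: local_degree_def ap vec_ord_def)
    qed
    also have "\<dots> = - D" using False a
      by (subst weighted_sum_diff) (auto simp: weighted_sum_mult weighted_sum_ord product_formula D_def)
    finally show ?thesis by (simp add: line_degree_def)
  qed
  moreover have "\<exists>v. v \<noteq> (\<lambda>i. 0) \<and> line_degree ?M v = \<bar>D\<bar>"
  proof (cases "D \<ge> 0")
    case True
    thus ?thesis using e2 by (intro exI[of _ "\<lambda>i. if i = 1 then 0 else 1"]) (auto simp: vec_nonzero_iff)
  next
    case False
    thus ?thesis using e1 by (intro exI[of _ "\<lambda>i. if i = 1 then 1 else 0"]) (auto simp: vec_nonzero_iff)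
  qed
  ultimately show ?thesis by (auto simp: has_type_def D_def)
qed

section \<open>Reduction theory\<close>

text \<open>Two families are identified if they differ by a base change of the generic fibre on the left,
  local integral base changes on the right, and a twist by the line bundle of an idele: these are
  the double cosets modulo the centre.\<close>

definition equivalent :: "'k::{finite,field} mats \<Rightarrow> 'k mats \<Rightarrow> bool" where
  "equivalent M N \<longleftrightarrow> (\<exists>A x k. mdet A \<noteq> 0 \<and> (\<forall>w. x w \<noteq> 0) \<and> finite {w. ord w (x w) \<noteq> 0} \<and>
     (\<forall>w. GL2O w (k w)) \<and> (\<forall>w. N w = mscale (x w) (mmul A (mmul (M w) (k w)))))"

lemma equivalentI:
  assumes "mdet A \<noteq> 0" "\<And>w. x w \<noteq> 0" "finite {w. ord w (x w) \<noteq> 0}" "\<And>w. GL2O w (k w)"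
    "\<And>w. N w = mscale (x w) (mmul A (mmul (M w) (k w)))"
  shows "equivalent M N"
  using assms unfolding equivalent_def by blast

lemma equivalent_trans:
  assumes "equivalent M N" "equivalent N P"
  shows "equivalent M P"
proof -
  obtain A x k where 1: "mdet A \<noteq> 0" "\<And>w. x w \<noteq> 0" "finite {w. ord w (x w) \<noteq> 0}" "\<And>w. GL2O w (k w)"
    "\<And>w. N w = mscale (x w) (mmul A (mmul (M w) (k w)))"
    using assms(1) unfolding equivalent_def by blast
  obtain B z l where 2: "mdet B \<noteq> 0" "\<And>w. z w \<noteq> 0" "finite {w. ord w (z w) \<noteq> 0}" "\<And>w. GL2O w (l w)"
    "\<And>w. P w = mscale (z w) (mmul B (mmul (N w) (l w)))"
    using assms(2) unfolding equivalent_def by blast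
  show ?thesis
  proof (rule equivalentI)
    show "mdet (mmul B A) \<noteq> 0" using 1 2 by (simp add: mdet_mmul)
    show "z w * x w \<noteq> 0" for w using 1 2 by simp
    show "finite {w. ord w (z w * x w) \<noteq> 0}"
      by (rule finite_subset[OF _ finite_UnI[OF 1(3) 2(3)]]) (use 1 2 in \<open>auto simp: ord_mult\<close>)
    show "GL2O w (mmul (k w) (l w))" for w using 1 2 by (simp add: GL2O_mmul)
    show "P w = mscale (z w * x w) (mmul (mmul B A) (mmul (M w) (mmul (k w) (l w))))" for w
      unfolding 1(5) 2(5) by (simp add: mscale_mmul mscale_mscale mmul_assoc)
  qed
qed

lemma has_type_equivalent:
  assumes "equivalent M N" "M \<in> RP"
  shows "has_type N n \<longleftrightarrow> has_type M n"
proof -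
  obtain A x k where 1: "mdet A \<noteq> 0" "\<And>w. x w \<noteq> 0" "finite {w. ord w (x w) \<noteq> 0}" "\<And>w. GL2O w (k w)"
    "\<And>w. N w = mscale (x w) (mmul A (mmul (M w) (k w)))"
    using assms(1) unfolding equivalent_def by blast
  have "N = (\<lambda>w. mscale (x w) (mmul (mmul A (M w)) (k w)))" by (rule ext) (simp only: 1(5) mmul_assoc)
  moreover have AM: "(\<lambda>w. mmul A (M w)) \<in> RP" by (intro RP_mmul RP_const 1(1) assms(2))
  moreover have "(\<lambda>w. mmul (mmul A (M w)) (k w)) \<in> RP"
    using RP_mmul[OF AM RP_integral[of k]] 1(4) by simp
  ultimately show ?thesis
    by (simp add: has_type_mscale has_type_right has_type_left 1 assms(2))
qed

definition std_unif :: "'k::{finite,field} ratfun" where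
  "std_unif = (SOME p. uniformizer infinite_place p)"

lemma std_unif: "std_unif \<noteq> 0" "ord infinite_place std_unif = 1"
proof -
  have "uniformizer infinite_place std_unif" unfolding std_unif_def using ex_uniformizer by (rule someI_ex)
  thus "std_unif \<noteq> 0" "ord infinite_place std_unif = 1"
    using uniformizer_nonzero by (auto simp: uniformizer_def)
qed

definition at_inf :: "'k::{finite,field} ratfun mat2 \<Rightarrow> 'k mats" where
  "at_inf B = (\<lambda>w. if w = infinite_place then B else mone)"

text \<open>The bundle \<open>O \<oplus> O(n)\<close> up to a twist.\<close>

definition std_mat :: "nat \<Rightarrow> 'k::{finite,field} mats" where
  "std_mat n = at_inf (mk (std_unif ^ n) 0 0 1)"

text \<open>Of the two entries in the bottom row the one of smaller order divides the other; a column
  operation clears the latter, and a swap of columns moves the former to the right if necessary.\<close>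

lemma local_iwasawa:
  assumes "mdet A \<noteq> 0"
  shows "\<exists>x a b k. x \<noteq> 0 \<and> a \<noteq> 0 \<and> GL2O w k \<and> mmul A k = mscale x (mk a b 0 1)"
proof -
  define c d where "c = A 2 1" and "d = A 2 2"
  have A: "A = mk (A 1 1) (A 1 2) c d" by (simp add: mat2_eq_iff c_def d_def)
  have det: "A 1 1 * d - A 1 2 * c \<noteq> 0" using assms by (simp add: mdet_def c_def d_def)
  show ?thesis
  proof (cases "d \<noteq> 0 \<and> ord_ge w (ord w d) c")
    case True
    hence "ord_ge w 0 (c / d)" by (cases "c = 0") (auto simp: ord_ge_def ord_divide)
    hence "GL2O w (mk 1 0 (- c / d) 1)" by (simp add: GL2O_mk)
    moreover have "mmul A (mk 1 0 (- c / d) 1) = mscale d (mk ((A 1 1 * d - A 1 2 * c) / (d * d)) (A 1 2 / d) 0 1)"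
      by (subst A) (use True in \<open>simp add: mmul_mk mscale_mk mat2_eq_iff divide_simps\<close>)
    ultimately show ?thesis using True det
      by (intro exI[of _ d] exI[of _ "(A 1 1 * d - A 1 2 * c) / (d * d)"] exI[of _ "A 1 2 / d"]
          exI[of _ "mk 1 0 (- c / d) 1"]) simp
  next
    case False
    hence c: "c \<noteq> 0" using det by auto
    have "ord_ge w 0 (d / c)"
      using False c by (cases "d = 0") (auto simp: ord_ge_def ord_divide)
    hence "GL2O w (mk (- d / c) 1 1 0)" by (simp add: GL2O_mk)
    moreover have "mmul A (mk (- d / c) 1 1 0) = mscale c (mk ((A 1 2 * c - A 1 1 * d) / (c * c)) (A 1 1 / c) 0 1)"
      by (subst A) (use c in \<open>simp add: mmul_mk mscale_mk mat2_eq_iff divide_simps\<close>)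
    ultimately show ?thesis using c det
      by (intro exI[of _ c] exI[of _ "(A 1 2 * c - A 1 1 * d) / (c * c)"] exI[of _ "A 1 1 / c"]
          exI[of _ "mk (- d / c) 1 1 0"]) (auto simp: algebra_simps)
  qed
qed

text \<open>Where the component is already integral and invertible it is reduced to the identity, so that
  the scalar and the upper triangular family stay in the restricted products.\<close>

lemma iwasawa:
  assumes "M \<in> RP"
  shows "\<exists>a b. (\<forall>w. a w \<noteq> 0) \<and> finite {w. ord w (a w) \<noteq> 0} \<and> finite {w. \<not> ord_ge w 0 (b w)} \<and>
           equivalent M (\<lambda>w. mk (a w) (b w) 0 1)"
proof -
  have "\<exists>x a b k. x \<noteq> 0 \<and> a \<noteq> 0 \<and> GL2O w k \<and> mmul (M w) k = mscale x (mk a b 0 1) \<and>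
      (GL2O w (M w) \<longrightarrow> x = 1 \<and> a = 1 \<and> b = 0)" for w
  proof (cases "GL2O w (M w)")
    case True
    thus ?thesis using RP_det[OF assms, of w]
      by (intro exI[of _ 1] exI[of _ 0] exI[of _ "minv (M w)"])
         (auto simp: mmul_minv GL2O_minv mone_def)
  next
    case False
    thus ?thesis using local_iwasawa[OF RP_det[OF assms, of w], of w] by auto
  qed
  then obtain x a b k where *: "\<And>w. x w \<noteq> 0" "\<And>w. a w \<noteq> 0" "\<And>w. GL2O w (k w)"
    "\<And>w. mmul (M w) (k w) = mscale (x w) (mk (a w) (b w) 0 1)"
    "\<And>w. GL2O w (M w) \<Longrightarrow> x w = 1 \<and> a w = 1 \<and> b w = 0" by metis
  have fin: "finite {w. \<not> GL2O w (M w)}" using assms by (simp add: RP_def)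
  have "finite {w. ord w (x w) \<noteq> 0}" "finite {w. ord w (a w) \<noteq> 0}" "finite {w. \<not> ord_ge w 0 (b w)}"
    by (rule finite_subset[OF _ fin]; use *(5) in force)+
  moreover have "equivalent M (\<lambda>w. mk (a w) (b w) 0 1)"
  proof (rule equivalentI[where A = mone and k = k and x = "\<lambda>w. inverse (x w)"])
    show "finite {w. ord w (inverse (x w)) \<noteq> 0}"
      using \<open>finite {w. ord w (x w) \<noteq> 0}\<close> by (simp add: ord_inverse)
    show "mk (a w) (b w) 0 1 = mscale (inverse (x w)) (mmul mone (mmul (M w) (k w)))" for w
      using *(1)[of w] by (simp add: *(4) mscale_mscale)
  qed (use * in auto)
  ultimately show ?thesis using *(2) by blast
qed

text \<open>A rational diagonal matrix makes the diagonal a unit away from infinity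
  (\<open>class_number_one\<close>), then a rational unipotent matrix makes the upper right entry
  integral there (\<open>strong_approximation\<close>). What remains away from infinity is
  integral and invertible.\<close>

lemma concentrate_at_infinity:
  assumes a: "\<And>w. a w \<noteq> 0" "finite {w. ord w (a w) \<noteq> 0}" and b: "finite {w. \<not> ord_ge w 0 (b w)}"
  shows "\<exists>\<alpha> \<beta>. \<alpha> \<noteq> 0 \<and> ord_ge infinite_place 1 \<beta> \<and>
    equivalent (\<lambda>w. mk (a w) (b w) 0 1) (at_inf (mk \<alpha> \<beta> 0 1))"
proof -
  obtain u where u: "u \<noteq> 0" "\<And>w. w \<noteq> infinite_place \<Longrightarrow> ord w u = ord w (a w)"
    using class_number_one[OF a(2)] by blast
  have "{w. \<not> ord_ge w 0 (b w / u)} \<subseteq> {w. \<not> ord_ge w 0 (b w)} \<union> {w. ord w u \<noteq> 0}"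
    using u(1) by (auto simp: ord_ge_def ord_divide)
  hence "finite {w. \<not> ord_ge w 0 (b w / u)}"
    using b product_formula(1)[OF u(1)] by (auto intro: finite_subset)
  from strong_approximation[OF this] obtain s where
    s: "\<And>w. w \<noteq> infinite_place \<Longrightarrow> ord_ge w 0 (b w / u - s)"
       "ord_ge infinite_place 1 (b infinite_place / u - s)" by blast
  define c where "c w = b w / u - s" for w
  define k where "k w = (if w = infinite_place then mone else mk (u / a w) (- c w * (u / a w)) 0 1)" for w
  have "GL2O w (k w)" for w
  proof (cases "w = infinite_place")
    case False
    have o: "ord w (u / a w) = 0" using u a(1) False by (simp add: ord_divide)
    have "ord_ge w 0 (- c w)" using s(1)[OF False] by (simp only: c_def ord_ge_uminus)
    hence "ord_ge w 0 (- c w * (u / a w))"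
      by (rule ord_ge_mult_0(1)) (simp add: ord_ge_def o)
    thus ?thesis using False u a(1) o by (simp add: k_def GL2O_mk ord_ge_def)
  qed (simp add: k_def)
  moreover have "at_inf (mk (a infinite_place / u) (c infinite_place) 0 1) w =
      mscale 1 (mmul (mk (1 / u) (- s) 0 1) (mmul (mk (a w) (b w) 0 1) (k w)))" for w
    using u a(1)[of w] by (auto simp: at_inf_def k_def mone_def mmul_mk mat2_eq_iff c_def divide_simps)
  ultimately have "equivalent (\<lambda>w. mk (a w) (b w) 0 1) (at_inf (mk (a infinite_place / u) (c infinite_place) 0 1))"
    using u by (intro equivalentI[where A = "mk (1 / u) (- s) 0 1" and x = "\<lambda>w. 1" and k = k]) auto
  moreover have "a infinite_place / u \<noteq> 0" using a(1) u(1) by simp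
  ultimately show ?thesis using s(2) unfolding c_def by blast
qed

text \<open>Translation by a polynomial is integral at all finite places, so it only affects infinity.\<close>

lemma at_inf_translate:
  fixes \<alpha> :: "'k::{finite,field} ratfun"
  assumes "\<alpha> \<noteq> 0"
  shows "\<exists>\<beta>'. ord_ge infinite_place 1 \<beta>' \<and> equivalent (at_inf (mk \<alpha> \<beta> 0 1)) (at_inf (mk \<alpha> \<beta>' 0 1))"
proof -
  obtain q where q: "ord_ge infinite_place 1 (\<beta> - to_fract q)"
    using infinite_place_poly_part by blast
  define k :: "'k mats" where "k w = (if w = infinite_place then mone else mk 1 (to_fract q) 0 1)" for w
  have "equivalent (at_inf (mk \<alpha> \<beta> 0 1)) (at_inf (mk \<alpha> (\<beta> - to_fract q) 0 1))"
  proof (rule equivalentI[where A = "mk 1 (- to_fract q) 0 1" and x = "\<lambda>w. 1" and k = k])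
    show "GL2O w (k w)" for w using finite_place_nonneg[of w q] by (simp add: k_def GL2O_mk)
    show "at_inf (mk \<alpha> (\<beta> - to_fract q) 0 1) w =
        mscale 1 (mmul (mk 1 (- to_fract q) 0 1) (mmul (at_inf (mk \<alpha> \<beta> 0 1) w) (k w)))" for w
      by (auto simp: at_inf_def k_def mone_def mmul_mk mat2_eq_iff)
  qed auto
  with q show ?thesis by blast
qed

text \<open>The diagonal entry is a power of the uniformizer up to a unit. If the exponent is negative, a
  swap of the basis vectors and a twist replace it by its negative.\<close>

lemma at_inf_diag:
  fixes \<alpha> :: "'k::{finite,field} ratfun"
  assumes "\<alpha> \<noteq> 0"
  shows "\<exists>n. equivalent (at_inf (mk \<alpha> 0 0 1)) (std_mat n)"
proof -
  define m where "m = ord infinite_place \<alpha>"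
  have pw: "ord infinite_place (std_unif ^ n :: 'k ratfun) = int n" for n
    by (simp add: ord_power std_unif)
  show ?thesis
  proof (cases "m \<ge> 0")
    case True
    define u where "u = std_unif ^ nat m / \<alpha>"
    have u: "u \<noteq> 0" "ord infinite_place u = 0"
      using assms True pw[of "nat m"] by (simp_all add: std_unif(1) u_def ord_divide m_def)
    have "equivalent (at_inf (mk \<alpha> 0 0 1)) (std_mat (nat m))"
    proof (rule equivalentI[where A = mone and x = "\<lambda>w. 1" and
          k = "\<lambda>w. if w = infinite_place then mk u 0 0 1 else mone"])
      show "GL2O w (if w = infinite_place then mk u 0 0 1 else mone)" for w
        using u by (simp add: GL2O_mk ord_ge_def)
      show "std_mat (nat m) w = mscale 1 (mmul mone (mmul (at_inf (mk \<alpha> 0 0 1) w)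
          (if w = infinite_place then mk u 0 0 1 else mone)))" for w
        using assms by (simp add: std_mat_def at_inf_def mmul_mk u_def)
    qed auto
    thus ?thesis ..
  next
    case False
    define n where "n = nat (- m)"
    define u where "u = std_unif ^ n * \<alpha>"
    have u: "u \<noteq> 0" "ord infinite_place u = 0"
      using assms False pw[of n] by (simp_all add: std_unif(1) u_def ord_mult m_def n_def)
    have "equivalent (at_inf (mk \<alpha> 0 0 1)) (std_mat n)"
    proof (rule equivalentI[where A = "mk 0 1 1 0" and x = "\<lambda>w. if w = infinite_place then 1 / \<alpha> else 1" and
          k = "\<lambda>w. if w = infinite_place then mk 0 1 u 0 else mk 0 1 1 0"])
      show "GL2O w (if w = infinite_place then mk 0 1 u 0 else mk 0 1 1 0)" for w
        using u by (simp add: GL2O_mk ord_ge_def)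
      show "std_mat n w = mscale (if w = infinite_place then 1 / \<alpha> else 1) (mmul (mk 0 1 1 0)
          (mmul (at_inf (mk \<alpha> 0 0 1) w) (if w = infinite_place then mk 0 1 u 0 else mk 0 1 1 0)))" for w
        using assms by (simp add: std_mat_def at_inf_def mmul_mk mscale_mk u_def mone_def)
      show "finite {w. ord w (if w = infinite_place then 1 / \<alpha> else 1) \<noteq> 0}"
        by (rule finite_subset[of _ "{infinite_place}"]) auto
    qed (use assms in auto)
    thus ?thesis ..
  qed
qed

text \<open>If the upper right entry is divisible by \<open>\<alpha>\<close>, a column operation clears it.
  Otherwise its order \<open>k\<close> satisfies \<open>1 \<le> k < n\<close>, where
  \<open>n\<close> is the order of \<open>\<alpha>\<close>. Swapping the basis vectors and
  clearing with this entry as the pivot gives a matrix of the same shape in which \<open>n\<close>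
  has dropped to \<open>n - 2 k\<close>; the new upper right entry is made small again by a
  translation. This is the descent of the continued fraction algorithm.\<close>

lemma at_inf_reduce:
  fixes \<alpha> :: "'k::{finite,field} ratfun"
  assumes "\<alpha> \<noteq> 0" "ord_ge infinite_place 1 \<beta>"
  shows "\<exists>n. equivalent (at_inf (mk \<alpha> \<beta> 0 1)) (std_mat n)"
  using assms
proof (induction "nat (ord infinite_place \<alpha>)" arbitrary: \<alpha> \<beta> rule: less_induct)
  case less
  show ?case
  proof (cases "ord_ge infinite_place (ord infinite_place \<alpha>) \<beta>")
    case True
    hence "ord_ge infinite_place 0 (\<beta> / \<alpha>)"
      using less.prems(1) by (cases "\<beta> = 0") (auto simp: ord_ge_def ord_divide)
    have "equivalent (at_inf (mk \<alpha> \<beta> 0 1)) (at_inf (mk \<alpha> 0 0 1))"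
    proof (rule equivalentI[where A = mone and x = "\<lambda>w. 1" and
          k = "\<lambda>w. if w = infinite_place then mk 1 (- \<beta> / \<alpha>) 0 1 else mone"])
      show "GL2O w (if w = infinite_place then mk 1 (- \<beta> / \<alpha>) 0 1 else mone)" for w
        using \<open>ord_ge infinite_place 0 (\<beta> / \<alpha>)\<close> by (simp add: GL2O_mk)
      show "at_inf (mk \<alpha> 0 0 1) w = mscale 1 (mmul mone (mmul (at_inf (mk \<alpha> \<beta> 0 1) w)
          (if w = infinite_place then mk 1 (- \<beta> / \<alpha>) 0 1 else mone)))" for w
        using less.prems(1) by (simp add: at_inf_def mmul_mk)
    qed auto
    thus ?thesis using at_inf_diag[OF less.prems(1)] equivalent_trans by blast
  next
    case False
    hence \<beta>: "\<beta> \<noteq> 0" "ord infinite_place \<beta> < ord infinite_place \<alpha>" by (auto simp: ord_ge_def)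
    have \<beta>1: "ord infinite_place \<beta> \<ge> 1" using less.prems(2) \<beta> by (simp add: ord_ge_def)
    define \<alpha>' where "\<alpha>' = - \<alpha> / (\<beta> * \<beta>)"
    have \<alpha>': "\<alpha>' \<noteq> 0" "ord infinite_place \<alpha>' = ord infinite_place \<alpha> - 2 * ord infinite_place \<beta>"
      using less.prems(1) \<beta> by (simp_all add: \<alpha>'_def ord_divide ord_mult)
    have "ord_ge infinite_place 0 (\<alpha> / \<beta>)"
      using less.prems(1) \<beta> by (auto simp: ord_ge_def ord_divide)
    (* The scalar 1 / beta at infinity restores the lower right entry 1. *)
    have 1: "equivalent (at_inf (mk \<alpha> \<beta> 0 1)) (at_inf (mk \<alpha>' (1 / \<beta>) 0 1))"
    proof (rule equivalentI[where A = "mk 0 1 1 0" and x = "\<lambda>w. if w = infinite_place then 1 / \<beta> else 1" and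
          k = "\<lambda>w. if w = infinite_place then mk 1 0 (- \<alpha> / \<beta>) 1 else mk 0 1 1 0"])
      show "GL2O w (if w = infinite_place then mk 1 0 (- \<alpha> / \<beta>) 1 else mk 0 1 1 0)" for w
        using \<open>ord_ge infinite_place 0 (\<alpha> / \<beta>)\<close> by (simp add: GL2O_mk)
      show "at_inf (mk \<alpha>' (1 / \<beta>) 0 1) w = mscale (if w = infinite_place then 1 / \<beta> else 1) (mmul (mk 0 1 1 0)
          (mmul (at_inf (mk \<alpha> \<beta> 0 1) w) (if w = infinite_place then mk 1 0 (- \<alpha> / \<beta>) 1 else mk 0 1 1 0)))" for w
        using less.prems(1) \<beta> by (simp add: at_inf_def mmul_mk mscale_mk \<alpha>'_def mone_def)
      show "finite {w. ord w (if w = infinite_place then 1 / \<beta> else 1) \<noteq> 0}"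
        by (rule finite_subset[of _ "{infinite_place}"]) auto
    qed (use \<beta> in auto)
    obtain \<beta>' where 2: "ord_ge infinite_place 1 \<beta>'"
      "equivalent (at_inf (mk \<alpha>' (1 / \<beta>) 0 1)) (at_inf (mk \<alpha>' \<beta>' 0 1))"
      using at_inf_translate[OF \<alpha>'(1)] by blast
    have "nat (ord infinite_place \<alpha>') < nat (ord infinite_place \<alpha>)"
      using \<alpha>'(2) \<beta>1 \<beta>(2) by simp
    from less.hyps[OF this \<alpha>'(1) 2(1)] show ?thesis
      using 1 2(2) equivalent_trans by blast
  qed
qed

theorem reduction:
  assumes "M \<in> RP"
  shows "\<exists>n. equivalent M (std_mat n)"
proof -
  obtain a b where 1: "\<And>w. a w \<noteq> 0" "finite {w. ord w (a w) \<noteq> 0}" "finite {w. \<not> ord_ge w 0 (b w)}"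
    "equivalent M (\<lambda>w. mk (a w) (b w) 0 1)" using iwasawa[OF assms] by blast
  obtain \<alpha> \<beta> where 2: "\<alpha> \<noteq> 0" "ord_ge infinite_place 1 \<beta>"
    "equivalent (\<lambda>w. mk (a w) (b w) 0 1) (at_inf (mk \<alpha> \<beta> 0 1))"
    using concentrate_at_infinity[OF 1(1-3)] by blast
  obtain n where "equivalent (at_inf (mk \<alpha> \<beta> 0 1)) (std_mat n)" using at_inf_reduce[OF 2(1,2)] by blast
  thus ?thesis using 1(4) 2(3) equivalent_trans by blast
qed

lemma std_mat_RP: "std_mat n \<in> RP"
proof -
  have "{w. \<not> GL2O w (std_mat n w)} \<subseteq> {infinite_place}" by (auto simp: std_mat_def at_inf_def)
  thus ?thesis using std_unif(1) by (auto simp: RP_def std_mat_def at_inf_def intro: finite_subset)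
qed

lemma has_type_std_mat: "has_type (std_mat n :: 'k::{finite,field} mats) (int n)"
proof -
  define a :: "'k place \<Rightarrow> 'k ratfun" where "a w = (if w = infinite_place then std_unif ^ n else 1)" for w
  have o: "(\<lambda>w. ord w (a w)) = (\<lambda>w. if w = infinite_place then int n else 0)"
    by (intro ext) (auto simp: a_def ord_power std_unif)
  have "has_type (\<lambda>w. mk (a w) 0 0 1) \<bar>weighted_sum (\<lambda>w. ord w (a w))\<bar>"
    by (rule has_type_diag) (auto simp: a_def ord_power std_unif intro: finite_subset[of _ "{infinite_place}"])
  moreover have "(\<lambda>w. mk (a w) 0 0 1) = std_mat n"
    by (auto simp: a_def std_mat_def at_inf_def mone_def)
  ultimately show ?thesis unfolding o by (simp add: weighted_sum_single)
qed

text \<open>The divisor of the diagonal entry has degree \<open>n\<close> from infinity plus the degree of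
  \<open>z\<close>.\<close>

lemma has_type_std_mat_step:
  fixes z :: "'k::{finite,field} place"
  assumes "uniformizer z p"
  shows "has_type (\<lambda>w. mmul (std_mat n w) (if w = z then mk p 0 0 1 else mone)) (int (n + geom_degree z))"
proof -
  have p: "p \<noteq> 0" "ord z p = 1" using assms uniformizer_nonzero by (auto simp: uniformizer_def)
  define a :: "'k place \<Rightarrow> 'k ratfun" where "a w = (if w = infinite_place then std_unif ^ n else 1)" for w
  define b where "b w = (if w = z then p else 1)" for w
  have nz: "a w \<noteq> 0" "b w \<noteq> 0" for w using p by (auto simp: a_def b_def std_unif)
  have o: "(\<lambda>w. ord w (a w * b w)) = (\<lambda>w. (if w = infinite_place then int n else 0) + (if w = z then 1 else 0))"
    using p by (intro ext) (auto simp: a_def b_def ord_mult ord_power std_unif)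
  have "has_type (\<lambda>w. mk (a w * b w) 0 0 1) \<bar>weighted_sum (\<lambda>w. ord w (a w * b w))\<bar>"
    by (rule has_type_diag) (use nz in \<open>auto simp: a_def b_def intro: finite_subset[of _ "{infinite_place, z}"]\<close>)
  moreover have "weighted_sum (\<lambda>w. (if w = infinite_place then int n else 0) + (if w = z then 1 else 0))
      = int n + int (geom_degree z)"
    by (subst weighted_sum_add) (auto simp: weighted_sum_single)
  moreover have "(\<lambda>w. mk (a w * b w) 0 0 1) = (\<lambda>w. mmul (std_mat n w) (if w = z then mk p 0 0 1 else mone))"
    by (auto simp: a_def b_def std_mat_def at_inf_def mone_def mmul_mk)
  ultimately show ?thesis unfolding o by simp
qed

section \<open>Matrices over commutative rings\<close>

lemma mat2_simps:
  "carrier (mat2_monoid R) = {A. \<forall>i j. A i j \<in> carrier R}"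
  "mult (mat2_monoid R) = (\<lambda>A B i j. A i 1 \<otimes>\<^bsub>R\<^esub> B 1 j \<oplus>\<^bsub>R\<^esub> A i 2 \<otimes>\<^bsub>R\<^esub> B 2 j)"
  "one (mat2_monoid R) = (\<lambda>i j. if i = j then \<one>\<^bsub>R\<^esub> else \<zero>\<^bsub>R\<^esub>)"
  by (simp_all add: mat2_monoid_def)

context
  fixes R :: "'a ring" (structure)
  assumes cring: "cring R"
begin

interpretation cring R by (rule cring)

lemma monoid_mat2: "monoid (mat2_monoid R)"
proof (rule monoidI)
  fix A B C assume *: "A \<in> carrier (mat2_monoid R)" "B \<in> carrier (mat2_monoid R)" "C \<in> carrier (mat2_monoid R)"
  show "A \<otimes>\<^bsub>mat2_monoid R\<^esub> B \<otimes>\<^bsub>mat2_monoid R\<^esub> C = A \<otimes>\<^bsub>mat2_monoid R\<^esub> (B \<otimes>\<^bsub>mat2_monoid R\<^esub> C)"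
    using * by (intro ext) (simp add: mat2_simps l_distr r_distr m_assoc a_ac)
next
  fix A assume "A \<in> carrier (mat2_monoid R)"
  thus "\<one>\<^bsub>mat2_monoid R\<^esub> \<otimes>\<^bsub>mat2_monoid R\<^esub> A = A" "A \<otimes>\<^bsub>mat2_monoid R\<^esub> \<one>\<^bsub>mat2_monoid R\<^esub> = A"
    by (simp_all add: mat2_simps fun_eq_iff forall_2)
qed (auto simp: mat2_simps)

lemma det2_closed: "A \<in> carrier (mat2_monoid R) \<Longrightarrow> det2 R A \<in> carrier R"
  by (simp add: det2_def mat2_simps)

lemma det2_mult:
  assumes "A \<in> carrier (mat2_monoid R)" "B \<in> carrier (mat2_monoid R)"
  shows "det2 R (A \<otimes>\<^bsub>mat2_monoid R\<^esub> B) = det2 R A \<otimes> det2 R B"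
proof -
  have "(a \<otimes> a' \<oplus> b \<otimes> c') \<otimes> (c \<otimes> b' \<oplus> d \<otimes> d') \<ominus> (a \<otimes> b' \<oplus> b \<otimes> d') \<otimes> (c \<otimes> a' \<oplus> d \<otimes> c')
      = (a \<otimes> d \<ominus> b \<otimes> c) \<otimes> (a' \<otimes> d' \<ominus> b' \<otimes> c')"
    if "a \<in> carrier R" "b \<in> carrier R" "c \<in> carrier R" "d \<in> carrier R"
      "a' \<in> carrier R" "b' \<in> carrier R" "c' \<in> carrier R" "d' \<in> carrier R" for a b c d a' b' c' d'
    using that by algebra
  thus ?thesis using assms by (simp add: det2_def mat2_simps)
qed

lemma det2_one: "det2 R \<one>\<^bsub>mat2_monoid R\<^esub> = \<one>"
  by (simp add: det2_def a_minus_def mat2_simps)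

end

lemma carrier_GL2: "g \<in> carrier (GL2 R) \<longleftrightarrow> g \<in> carrier (mat2_monoid R) \<and>
   (\<exists>h\<in>carrier (mat2_monoid R). h \<otimes>\<^bsub>mat2_monoid R\<^esub> g = \<one>\<^bsub>mat2_monoid R\<^esub> \<and> g \<otimes>\<^bsub>mat2_monoid R\<^esub> h = \<one>\<^bsub>mat2_monoid R\<^esub>)"
  by (simp add: GL2_def units_of_def Units_def)

lemma GL2_simps: "mult (GL2 R) = mult (mat2_monoid R)" "one (GL2 R) = one (mat2_monoid R)"
  by (simp_all add: GL2_def units_of_def)

section \<open>Matrices over a completion\<close>

abbreviation MC :: "'k::{finite,field} place \<Rightarrow> 'k local_elt mat2 monoid" where
  "MC w \<equiv> mat2_monoid (completion w)"

definition cm :: "'k::{finite,field} place \<Rightarrow> 'k ratfun mat2 \<Rightarrow> 'k local_elt mat2" where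
  "cm w A = (\<lambda>i j. to_completion w (A i j))"

definition lint :: "'k::{finite,field} place \<Rightarrow> 'k local_elt mat2 \<Rightarrow> bool" where
  "lint w A \<longleftrightarrow> (\<forall>i j. cge w 0 (A i j))"

text \<open>Membership in \<open>GL\<^sub>2\<close> of the ring of local integers. The inverse is required
  to be integral instead of the determinant to be a unit, which matches \<^const>\<open>KA\<close>
  place by place.\<close>

definition LK :: "'k::{finite,field} place \<Rightarrow> 'k local_elt mat2 \<Rightarrow> bool" where
  "LK w A \<longleftrightarrow> lint w A \<and> (\<exists>B. lint w B \<and> A \<otimes>\<^bsub>MC w\<^esub> B = \<one>\<^bsub>MC w\<^esub> \<and> B \<otimes>\<^bsub>MC w\<^esub> A = \<one>\<^bsub>MC w\<^esub>)"

lemma monoid_MC: "monoid (MC w)"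
  by (rule monoid_mat2[OF cring_completion])

lemma cm_carrier: "cm w A \<in> carrier (MC w)"
  by (simp add: cm_def mat2_simps)

lemma cm_mmul: "cm w (mmul A B) = cm w A \<otimes>\<^bsub>MC w\<^esub> cm w B"
  by (simp add: cm_def mmul_def to_completion_ops mat2_simps)

lemma cm_mone: "cm w mone = \<one>\<^bsub>MC w\<^esub>"
  by (auto simp: cm_def mone_def to_completion_ops fun_eq_iff forall_2 mat2_simps)

lemma lint_cm [simp]: "lint w (cm w A) \<longleftrightarrow> mat_integral w A"
  by (simp add: lint_def cm_def mat_integral_def)

lemma lint_carrier: "lint w A \<Longrightarrow> A \<in> carrier (MC w)"
  unfolding lint_def mat2_simps using cge_carrier by blast

lemma lint_mult: "lint w A \<Longrightarrow> lint w B \<Longrightarrow> lint w (A \<otimes>\<^bsub>MC w\<^esub> B)"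
  by (auto simp: lint_def mat2_simps intro!: cge_add cge_mult_0(1))

lemma LK_lint: "LK w A \<Longrightarrow> lint w A"
  by (simp add: LK_def)

lemma LK_inverse:
  assumes "LK w A"
  obtains B where "LK w B" "A \<otimes>\<^bsub>MC w\<^esub> B = \<one>\<^bsub>MC w\<^esub>" "B \<otimes>\<^bsub>MC w\<^esub> A = \<one>\<^bsub>MC w\<^esub>"
  using assms unfolding LK_def by blast

lemma LK_mult:
  assumes "LK w A" "LK w B"
  shows "LK w (A \<otimes>\<^bsub>MC w\<^esub> B)"
proof -
  interpret monoid "MC w" by (rule monoid_MC)
  obtain A' where A': "LK w A'" "A \<otimes>\<^bsub>MC w\<^esub> A' = \<one>\<^bsub>MC w\<^esub>" "A' \<otimes>\<^bsub>MC w\<^esub> A = \<one>\<^bsub>MC w\<^esub>"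
    using assms(1) by (rule LK_inverse)
  obtain B' where B': "LK w B'" "B \<otimes>\<^bsub>MC w\<^esub> B' = \<one>\<^bsub>MC w\<^esub>" "B' \<otimes>\<^bsub>MC w\<^esub> B = \<one>\<^bsub>MC w\<^esub>"
    using assms(2) by (rule LK_inverse)
  have c: "A \<in> carrier (MC w)" "A' \<in> carrier (MC w)" "B \<in> carrier (MC w)" "B' \<in> carrier (MC w)"
    using assms A'(1) B'(1) LK_lint lint_carrier by blast+
  have "(A \<otimes>\<^bsub>MC w\<^esub> B) \<otimes>\<^bsub>MC w\<^esub> (B' \<otimes>\<^bsub>MC w\<^esub> A') = A \<otimes>\<^bsub>MC w\<^esub> (B \<otimes>\<^bsub>MC w\<^esub> B') \<otimes>\<^bsub>MC w\<^esub> A'"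
    using c by (simp add: m_assoc)
  also have "\<dots> = \<one>\<^bsub>MC w\<^esub>" using c A' B' by (simp)
  finally have 1: "(A \<otimes>\<^bsub>MC w\<^esub> B) \<otimes>\<^bsub>MC w\<^esub> (B' \<otimes>\<^bsub>MC w\<^esub> A') = \<one>\<^bsub>MC w\<^esub>" .
  have "(B' \<otimes>\<^bsub>MC w\<^esub> A') \<otimes>\<^bsub>MC w\<^esub> (A \<otimes>\<^bsub>MC w\<^esub> B) = B' \<otimes>\<^bsub>MC w\<^esub> (A' \<otimes>\<^bsub>MC w\<^esub> A) \<otimes>\<^bsub>MC w\<^esub> B"
    using c by (simp add: m_assoc)
  also have "\<dots> = \<one>\<^bsub>MC w\<^esub>" using c A' B' by (simp)
  finally have 2: "(B' \<otimes>\<^bsub>MC w\<^esub> A') \<otimes>\<^bsub>MC w\<^esub> (A \<otimes>\<^bsub>MC w\<^esub> B) = \<one>\<^bsub>MC w\<^esub>" .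
  show ?thesis unfolding LK_def
    using 1 2 lint_mult assms[THEN LK_lint] A'(1)[THEN LK_lint] B'(1)[THEN LK_lint] by blast
qed

text \<open>The inverse over the completion is the image of the inverse over \<open>F\<close>.\<close>

lemma LK_cm_iff:
  assumes "mdet A \<noteq> 0"
  shows "LK w (cm w A) \<longleftrightarrow> GL2O w A"
proof
  interpret monoid "MC w" by (rule monoid_MC)
  have i: "cm w A \<otimes>\<^bsub>MC w\<^esub> cm w (minv A) = \<one>\<^bsub>MC w\<^esub>" "cm w (minv A) \<otimes>\<^bsub>MC w\<^esub> cm w A = \<one>\<^bsub>MC w\<^esub>"
    using assms by (simp_all add: mmul_minv cm_mone flip: cm_mmul)
  {
    assume "LK w (cm w A)"
    then obtain B where B: "LK w B" "cm w A \<otimes>\<^bsub>MC w\<^esub> B = \<one>\<^bsub>MC w\<^esub>" by (rule LK_inverse)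
    have Bc: "B \<in> carrier (MC w)" using B(1) LK_lint lint_carrier by blast
    have "B = (cm w (minv A) \<otimes>\<^bsub>MC w\<^esub> cm w A) \<otimes>\<^bsub>MC w\<^esub> B"
      using Bc by (simp only: i l_one)
    also have "\<dots> = cm w (minv A) \<otimes>\<^bsub>MC w\<^esub> (cm w A \<otimes>\<^bsub>MC w\<^esub> B)"
      using Bc cm_carrier by (intro m_assoc)
    also have "\<dots> = cm w (minv A)" unfolding B(2) by (rule r_one[OF cm_carrier])
    finally have "B = cm w (minv A)" .
    hence "mat_integral w (minv A)" using B(1) LK_lint by fastforce
    moreover have "mat_integral w A" using \<open>LK w (cm w A)\<close> LK_lint by fastforce
    ultimately show "GL2O w A"
      using GL2O_of_integral_inverse[of w A "minv A"] mmul_minv(1)[OF assms] by blast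
  }
  assume "GL2O w A"
  moreover have "GL2O w (minv A)" using calculation by (rule GL2O_minv)
  ultimately show "LK w (cm w A)" unfolding LK_def GL2O_def using i by (metis lint_cm)
qed

lemma det2_cm: "det2 (completion w) (cm w A) = to_completion w (mdet A)"
  by (simp add: det2_def cm_def mdet_def to_completion_ops)

lemma det2_cge:
  assumes "\<And>i j. cge w N (A i j)"
  shows "cge w (N + N) (det2 (completion w) A)"
  unfolding det2_def by (intro cge_diff cge_mult assms)

text \<open>The bound is taken nonnegative so that bounds for several matrices can be added.\<close>

lemma common_bound:
  assumes "A \<in> carrier (MC w)"
  shows "\<exists>n\<ge>0. \<forall>i j. cge w (- n) (A i j)"
proof -
  have "\<forall>i j. \<exists>N. cge w N (A i j)" using assms cge_ex unfolding mat2_simps by blast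
  then obtain N where N: "\<And>i j. cge w (N i j) (A i j)" by metis
  define n where "n = \<bar>N 1 1\<bar> + \<bar>N 1 2\<bar> + \<bar>N 2 1\<bar> + \<bar>N 2 2\<bar>"
  have "- n \<le> N i j" for i j
    using exhaust_2[of i] exhaust_2[of j] by (auto simp: n_def)
  hence "\<forall>i j. cge w (- n) (A i j)" using N cge_mono by blast
  thus ?thesis by (intro exI[of _ n]) (auto simp: n_def)
qed

text \<open>Let \<open>M\<close> approximate \<open>A\<close> closely, with error \<open>E\<close>. Then
  \<open>A\<^sup>-\<^sup>1 M = 1 - A\<^sup>-\<^sup>1 E\<close> is close to the identity; in
  particular its determinant is not small, which bounds the order of \<open>det M\<close> and
  hence the denominators of \<open>M\<^sup>-\<^sup>1\<close> in terms of \<open>A\<close> alone.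
  So \<open>M\<^sup>-\<^sup>1 A = 1 + M\<^sup>-\<^sup>1 E\<close> is integral as well, and so is
  its inverse.\<close>

lemma local_approximation:
  assumes A: "A \<in> carrier (MC w)" and B: "B \<in> carrier (MC w)"
    and AB: "B \<otimes>\<^bsub>MC w\<^esub> A = \<one>\<^bsub>MC w\<^esub>" "A \<otimes>\<^bsub>MC w\<^esub> B = \<one>\<^bsub>MC w\<^esub>"
  shows "\<exists>M. mdet M \<noteq> 0 \<and> LK w (cm w (minv M) \<otimes>\<^bsub>MC w\<^esub> A)"
proof -
  interpret C: cring "completion w" by (rule cring_completion)
  interpret monoid "MC w" by (rule monoid_MC)
  obtain a b where ab: "a \<ge> 0" "\<And>i j. cge w (- a) (A i j)" "b \<ge> 0" "\<And>i j. cge w (- b) (B i j)"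
    using common_bound[OF A] common_bound[OF B] by auto
  define n where "n = a + b"
  have n: "n \<ge> 0" "\<And>i j. cge w (- n) (A i j)" "\<And>i j. cge w (- n) (B i j)"
    by (use ab(1,3) in \<open>simp add: n_def\<close>) (rule cge_mono[OF ab(2)] cge_mono[OF ab(4)]; use ab(1,3) in \<open>simp add: n_def\<close>)+
  (* The entries of A and its inverse have order at least -n. The determinant of M will have order at
     most 2n, so its inverse has entries of order at least -3n, and an error of order 3n is harmless
     there; the extra 1 puts the difference of B M and the identity into the maximal ideal also when
     n = 0. *)
  define N where "N = 3 * n + 1"
  have "\<forall>i j. \<exists>m. cge w N (A i j \<ominus>\<^bsub>completion w\<^esub> to_completion w m)"
    using A completion_approx unfolding mat2_simps by blast
  then obtain M where M: "\<And>i j. cge w N (A i j \<ominus>\<^bsub>completion w\<^esub> to_completion w (M i j))" by metis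
  define E where "E i j = A i j \<ominus>\<^bsub>completion w\<^esub> to_completion w (M i j)" for i j
  have Ac: "A i j \<in> carrier (completion w)" and Bc: "B i j \<in> carrier (completion w)"
    and Ec: "E i j \<in> carrier (completion w)" for i j
    using A B cge_carrier[OF M] by (simp_all add: E_def mat2_simps)
  have A_eq: "A i j = to_completion w (M i j) \<oplus>\<^bsub>completion w\<^esub> E i j" for i j
    using Ac by (simp add: E_def a_minus_def C.a_ac C.r_neg1 C.r_neg2 C.r_neg)
  have M_eq: "to_completion w (M i j) = A i j \<ominus>\<^bsub>completion w\<^esub> E i j" for i j
    unfolding A_eq using Ec by (simp add: a_minus_def C.a_assoc C.r_neg)
  have Mn: "ord_ge w (- n) (M i j)" for i j
  proof -
    have "cge w (- n) (to_completion w (M i j))" unfolding M_eq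
      by (intro cge_diff n(2) cge_mono[OF M[folded E_def]]) (use n(1) in \<open>simp add: N_def\<close>)
    thus ?thesis by simp
  qed
  have BM: "B \<otimes>\<^bsub>MC w\<^esub> cm w M = (\<lambda>i j. \<one>\<^bsub>MC w\<^esub> i j \<ominus>\<^bsub>completion w\<^esub> (B i 1 \<otimes>\<^bsub>completion w\<^esub> E 1 j \<oplus>\<^bsub>completion w\<^esub> B i 2 \<otimes>\<^bsub>completion w\<^esub> E 2 j))"
  proof (intro ext)
    fix i j
    have "\<one>\<^bsub>MC w\<^esub> i j = B i 1 \<otimes>\<^bsub>completion w\<^esub> A 1 j \<oplus>\<^bsub>completion w\<^esub> B i 2 \<otimes>\<^bsub>completion w\<^esub> A 2 j"
      using AB(1) by (simp add: fun_eq_iff mat2_simps)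
    moreover have "B i 1 \<otimes>\<^bsub>completion w\<^esub> to_completion w (M 1 j) \<oplus>\<^bsub>completion w\<^esub> B i 2 \<otimes>\<^bsub>completion w\<^esub> to_completion w (M 2 j)
       = (B i 1 \<otimes>\<^bsub>completion w\<^esub> A 1 j \<oplus>\<^bsub>completion w\<^esub> B i 2 \<otimes>\<^bsub>completion w\<^esub> A 2 j) \<ominus>\<^bsub>completion w\<^esub> (B i 1 \<otimes>\<^bsub>completion w\<^esub> E 1 j \<oplus>\<^bsub>completion w\<^esub> B i 2 \<otimes>\<^bsub>completion w\<^esub> E 2 j)"
      unfolding M_eq
      using Ac[of 1 j] Ac[of 2 j] Bc[of i 1] Bc[of i 2] Ec[of 1 j] Ec[of 2 j] by algebra
    ultimately show "(B \<otimes>\<^bsub>MC w\<^esub> cm w M) i j = \<one>\<^bsub>MC w\<^esub> i j \<ominus>\<^bsub>completion w\<^esub> (B i 1 \<otimes>\<^bsub>completion w\<^esub> E 1 j \<oplus>\<^bsub>completion w\<^esub> B i 2 \<otimes>\<^bsub>completion w\<^esub> E 2 j)"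
      by (simp add: cm_def mat2_simps)
  qed
  define D where "D i j = B i 1 \<otimes>\<^bsub>completion w\<^esub> E 1 j \<oplus>\<^bsub>completion w\<^esub> B i 2 \<otimes>\<^bsub>completion w\<^esub> E 2 j" for i j
  have D1: "cge w 1 (D i j)" for i j
  proof -
    have "cge w (- n + N) (D i j)" unfolding D_def E_def by (intro cge_add cge_mult n M)
    thus ?thesis by (rule cge_mono) (use n(1) in \<open>simp add: N_def\<close>)
  qed
  have Dc: "D i j \<in> carrier (completion w)" for i j using D1 cge_carrier by blast
  have lBM: "lint w (B \<otimes>\<^bsub>MC w\<^esub> cm w M)"
    unfolding BM D_def[symmetric] unfolding lint_def mat2_simps by (auto intro!: cge_diff cge_mono[OF D1])
  (* B M = 1 - D with D in the maximal ideal, so its determinant is congruent to 1. *)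
  have det1: "cge w 1 (\<one>\<^bsub>completion w\<^esub> \<ominus>\<^bsub>completion w\<^esub> det2 (completion w) (B \<otimes>\<^bsub>MC w\<^esub> cm w M))"
  proof -
    have "\<one>\<^bsub>completion w\<^esub> \<ominus>\<^bsub>completion w\<^esub> det2 (completion w) (B \<otimes>\<^bsub>MC w\<^esub> cm w M) =
      (D 1 1 \<oplus>\<^bsub>completion w\<^esub> D 2 2 \<ominus>\<^bsub>completion w\<^esub> D 1 1 \<otimes>\<^bsub>completion w\<^esub> D 2 2) \<oplus>\<^bsub>completion w\<^esub> D 1 2 \<otimes>\<^bsub>completion w\<^esub> D 2 1"
      unfolding BM D_def[symmetric] det2_def
      using Dc[of 1 1] Dc[of 1 2] Dc[of 2 1] Dc[of 2 2] by (simp add: mat2_simps) (algebra, simp add: C.a_ac)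
    moreover have "cge w 0 (D i j)" for i j using D1 by (rule cge_mono) simp
    ultimately show ?thesis using D1 by (auto intro!: cge_diff cge_add cge_mult_0(1))
  qed
  have detBM: "det2 (completion w) (B \<otimes>\<^bsub>MC w\<^esub> cm w M) = det2 (completion w) B \<otimes>\<^bsub>completion w\<^esub> to_completion w (mdet M)"
    using det2_mult[OF cring_completion B cm_carrier] by (simp only: det2_cm)
  have ncge: "\<not> cge w 1 (det2 (completion w) B \<otimes>\<^bsub>completion w\<^esub> to_completion w (mdet M))"
  proof
    assume *: "cge w 1 (det2 (completion w) B \<otimes>\<^bsub>completion w\<^esub> to_completion w (mdet M))"
    let ?d = "det2 (completion w) B \<otimes>\<^bsub>completion w\<^esub> to_completion w (mdet M)"
    have "cge w 1 ((\<one>\<^bsub>completion w\<^esub> \<ominus>\<^bsub>completion w\<^esub> ?d) \<oplus>\<^bsub>completion w\<^esub> ?d)"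
      using det1 * unfolding detBM by (rule cge_add)
    also have "(\<one>\<^bsub>completion w\<^esub> \<ominus>\<^bsub>completion w\<^esub> ?d) \<oplus>\<^bsub>completion w\<^esub> ?d = \<one>\<^bsub>completion w\<^esub>"
      using cge_carrier[OF *] by (simp add: a_minus_def C.a_assoc C.l_neg)
    finally show False by simp
  qed
  have dB: "cge w (- n + - n) (det2 (completion w) B)" by (rule det2_cge) (rule n(3))
  have "\<not> ord_ge w (2 * n + 1) (mdet M)"
  proof
    assume "ord_ge w (2 * n + 1) (mdet M)"
    hence "cge w ((- n + - n) + (2 * n + 1)) (det2 (completion w) B \<otimes>\<^bsub>completion w\<^esub> to_completion w (mdet M))"
      using dB by (intro cge_mult) auto
    thus False using ncge by simp
  qed
  hence dM: "mdet M \<noteq> 0" "ord w (mdet M) \<le> 2 * n" by (auto simp: ord_ge_def)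
  have mi: "ord_ge w (- (3 * n)) (minv M i j)" for i j
  proof -
    have "ord_ge w (- n) (madj M i j)"
      using Mn exhaust_2[of i] exhaust_2[of j] by (auto simp: madj_def)
    moreover have "ord_ge w (- (2 * n)) (inverse (mdet M))" using dM by (simp add: ord_ge_def ord_inverse)
    ultimately show ?thesis using ord_ge_mult[of w "- (2 * n)" "inverse (mdet M)" "- n" "madj M i j"]
      by (simp add: minv_def mscale_def)
  qed
  have MA: "cm w (minv M) \<otimes>\<^bsub>MC w\<^esub> A = (\<lambda>i j. to_completion w (mone i j) \<oplus>\<^bsub>completion w\<^esub>
      (to_completion w (minv M i 1) \<otimes>\<^bsub>completion w\<^esub> E 1 j \<oplus>\<^bsub>completion w\<^esub> to_completion w (minv M i 2) \<otimes>\<^bsub>completion w\<^esub> E 2 j))"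
  proof (intro ext)
    fix i j
    have "mone i j = minv M i 1 * M 1 j + minv M i 2 * M 2 j"
      using mmul_minv(2)[OF dM(1)] by (simp add: mmul_def fun_eq_iff)
    hence "to_completion w (mone i j) = to_completion w (minv M i 1) \<otimes>\<^bsub>completion w\<^esub> to_completion w (M 1 j)
      \<oplus>\<^bsub>completion w\<^esub> to_completion w (minv M i 2) \<otimes>\<^bsub>completion w\<^esub> to_completion w (M 2 j)"
      by (simp add: to_completion_ops)
    moreover have "(cm w (minv M) \<otimes>\<^bsub>MC w\<^esub> A) i j = to_completion w (minv M i 1) \<otimes>\<^bsub>completion w\<^esub> (to_completion w (M 1 j) \<oplus>\<^bsub>completion w\<^esub> E 1 j)
      \<oplus>\<^bsub>completion w\<^esub> to_completion w (minv M i 2) \<otimes>\<^bsub>completion w\<^esub> (to_completion w (M 2 j) \<oplus>\<^bsub>completion w\<^esub> E 2 j)"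
      by (simp add: cm_def mat2_simps flip: A_eq)
    ultimately show "(cm w (minv M) \<otimes>\<^bsub>MC w\<^esub> A) i j = to_completion w (mone i j) \<oplus>\<^bsub>completion w\<^esub>
      (to_completion w (minv M i 1) \<otimes>\<^bsub>completion w\<^esub> E 1 j \<oplus>\<^bsub>completion w\<^esub> to_completion w (minv M i 2) \<otimes>\<^bsub>completion w\<^esub> E 2 j)"
      using Ec by (simp add: C.r_distr C.a_ac)
  qed
  have mE: "cge w 0 (to_completion w (minv M i l) \<otimes>\<^bsub>completion w\<^esub> E l j)" for i j l
  proof -
    have "cge w (- (3 * n) + N) (to_completion w (minv M i l) \<otimes>\<^bsub>completion w\<^esub> E l j)"
      using mi M by (intro cge_mult) (auto simp: E_def)
    thus ?thesis by (rule cge_mono) (simp add: N_def)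
  qed
  have "cge w 0 (to_completion w (mone i j))" for i j
    using GL2O_mone[of w] by (simp add: GL2O_def mat_integral_def)
  hence "lint w (cm w (minv M) \<otimes>\<^bsub>MC w\<^esub> A)"
    unfolding MA lint_def by (intro allI cge_add mE)
  moreover have "(cm w (minv M) \<otimes>\<^bsub>MC w\<^esub> A) \<otimes>\<^bsub>MC w\<^esub> (B \<otimes>\<^bsub>MC w\<^esub> cm w M) = \<one>\<^bsub>MC w\<^esub>"
  proof -
    have "(cm w (minv M) \<otimes>\<^bsub>MC w\<^esub> A) \<otimes>\<^bsub>MC w\<^esub> (B \<otimes>\<^bsub>MC w\<^esub> cm w M) =
        cm w (minv M) \<otimes>\<^bsub>MC w\<^esub> (A \<otimes>\<^bsub>MC w\<^esub> B) \<otimes>\<^bsub>MC w\<^esub> cm w M"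
      using A B cm_carrier[of w M] cm_carrier[of w "minv M"] by (simp add: m_assoc)
    thus ?thesis using dM(1)
      by (simp add: cm_carrier AB(2) mmul_minv cm_mone flip: cm_mmul)
  qed
  moreover have "(B \<otimes>\<^bsub>MC w\<^esub> cm w M) \<otimes>\<^bsub>MC w\<^esub> (cm w (minv M) \<otimes>\<^bsub>MC w\<^esub> A) = \<one>\<^bsub>MC w\<^esub>"
  proof -
    have "(B \<otimes>\<^bsub>MC w\<^esub> cm w M) \<otimes>\<^bsub>MC w\<^esub> (cm w (minv M) \<otimes>\<^bsub>MC w\<^esub> A) =
        B \<otimes>\<^bsub>MC w\<^esub> (cm w M \<otimes>\<^bsub>MC w\<^esub> cm w (minv M)) \<otimes>\<^bsub>MC w\<^esub> A"
      using A B cm_carrier[of w M] cm_carrier[of w "minv M"] by (simp add: m_assoc)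
    thus ?thesis using A B dM(1)
      by (simp add: AB(1) mmul_minv cm_mone flip: cm_mmul)
  qed
  ultimately show ?thesis using dM(1) lBM unfolding LK_def by blast
qed

text \<open>The analogue of \<open>local_approximation\<close> for \<open>GL\<^sub>1\<close>: the rational
  factor of a central matrix can be chosen central.\<close>

lemma local_scalar_approximation:
  assumes "a \<in> carrier (completion w)" "b \<in> carrier (completion w)" "b \<otimes>\<^bsub>completion w\<^esub> a = \<one>\<^bsub>completion w\<^esub>"
  shows "\<exists>x. x \<noteq> 0 \<and> cge w 0 (to_completion w (inverse x) \<otimes>\<^bsub>completion w\<^esub> a) \<and> cge w 0 (to_completion w x \<otimes>\<^bsub>completion w\<^esub> b)"
proof -
  interpret C: cring "completion w" by (rule cring_completion)
  obtain N where N: "cge w N b" using cge_ex assms(2) by blast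
  define n where "n = \<bar>N\<bar>"
  have n: "n \<ge> 0" "cge w (- n) b" using cge_mono[OF N, of "- n"] by (auto simp: n_def)
  obtain x where x: "cge w (n + 1) (a \<ominus>\<^bsub>completion w\<^esub> to_completion w x)"
    using completion_approx[OF assms(1)] by blast
  define e where "e = a \<ominus>\<^bsub>completion w\<^esub> to_completion w x"
  have ec: "e \<in> carrier (completion w)" using assms by (simp add: e_def)
  have xe: "to_completion w x = a \<ominus>\<^bsub>completion w\<^esub> e" "a = to_completion w x \<oplus>\<^bsub>completion w\<^esub> e"
    using assms(1) by (simp add: e_def a_minus_def C.minus_add C.r_neg2)
      (use assms(1) in \<open>simp add: e_def a_minus_def C.a_ac C.r_neg1 C.r_neg2 C.r_neg\<close>)
  have be: "cge w 1 (b \<otimes>\<^bsub>completion w\<^esub> e)"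
    using cge_mult[OF n(2) x] by (simp add: e_def)
  have bx: "to_completion w x \<otimes>\<^bsub>completion w\<^esub> b = \<one>\<^bsub>completion w\<^esub> \<ominus>\<^bsub>completion w\<^esub> b \<otimes>\<^bsub>completion w\<^esub> e"
  proof -
    have "to_completion w x \<otimes>\<^bsub>completion w\<^esub> b = b \<otimes>\<^bsub>completion w\<^esub> a \<ominus>\<^bsub>completion w\<^esub> b \<otimes>\<^bsub>completion w\<^esub> e"
      unfolding xe(1) using assms(1,2) ec by algebra
    thus ?thesis by (simp only: assms(3))
  qed
  have 1: "cge w 0 (to_completion w x \<otimes>\<^bsub>completion w\<^esub> b)"
    unfolding bx by (intro cge_diff cge_mono[OF be]) auto
  have "\<not> ord_ge w (n + 1) x"
  proof
    assume "ord_ge w (n + 1) x"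
    hence "cge w ((n + 1) + - n) (to_completion w x \<otimes>\<^bsub>completion w\<^esub> b)" using n(2) by (intro cge_mult) auto
    hence "cge w 1 (to_completion w x \<otimes>\<^bsub>completion w\<^esub> b \<oplus>\<^bsub>completion w\<^esub> b \<otimes>\<^bsub>completion w\<^esub> e)"
      using be by (intro cge_add) auto
    also have "to_completion w x \<otimes>\<^bsub>completion w\<^esub> b \<oplus>\<^bsub>completion w\<^esub> b \<otimes>\<^bsub>completion w\<^esub> e = \<one>\<^bsub>completion w\<^esub>"
      unfolding bx using assms ec by (simp add: a_minus_def C.a_assoc C.l_neg)
    finally show False by simp
  qed
  hence x0: "x \<noteq> 0" "ord w x \<le> n" by (auto simp: ord_ge_def)
  have "to_completion w (inverse x) \<otimes>\<^bsub>completion w\<^esub> a = \<one>\<^bsub>completion w\<^esub> \<oplus>\<^bsub>completion w\<^esub> to_completion w (inverse x) \<otimes>\<^bsub>completion w\<^esub> e"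
    using x0 ec by (subst xe(2)) (simp add: C.r_distr to_completion_ops(1) flip: to_completion_ops(4))
  moreover have "cge w (- n + (n + 1)) (to_completion w (inverse x) \<otimes>\<^bsub>completion w\<^esub> e)"
    using x x0 by (intro cge_mult) (auto simp: e_def ord_ge_def ord_inverse)
  ultimately have "cge w 0 (to_completion w (inverse x) \<otimes>\<^bsub>completion w\<^esub> a)"
    by (auto intro!: cge_add intro: cge_mono)
  with 1 x0(1) show ?thesis by blast
qed

section \<open>The adelic group\<close>

lemma adele_ring_simps:
  "carrier adele_ring = {a. (\<forall>y. a y \<in> carrier (completion y)) \<and> finite {y. \<not> cge y 0 (a y)}}"
  "mult adele_ring = (\<lambda>a b y. a y \<otimes>\<^bsub>completion y\<^esub> b y)"
  "one adele_ring = (\<lambda>y. \<one>\<^bsub>completion y\<^esub>)"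
  "zero adele_ring = (\<lambda>y. \<zero>\<^bsub>completion y\<^esub>)"
  "add adele_ring = (\<lambda>a b y. a y \<oplus>\<^bsub>completion y\<^esub> b y)"
  by (simp_all add: adele_ring_def local_integers_iff)

lemma integral_adele_ring_simps:
  "carrier integral_adele_ring = {a. \<forall>y. cge y 0 (a y)}"
  "mult integral_adele_ring = mult adele_ring"
  "one integral_adele_ring = one adele_ring"
  "zero integral_adele_ring = zero adele_ring"
  "add integral_adele_ring = add adele_ring"
  by (simp_all add: integral_adele_ring_def local_integers_iff)

lemma cring_adele_ring: "cring (adele_ring :: 'k::{finite,field} adele ring)"
proof (rule cringI)
  interpret C: cring "completion y" for y :: "'k place" by (rule cring_completion)
  show "abelian_group (adele_ring :: 'k adele ring)"
  proof (rule abelian_groupI)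
    fix a b :: "'k adele" assume ab: "a \<in> carrier adele_ring" "b \<in> carrier adele_ring"
    have "{y. \<not> cge y 0 (a y \<oplus>\<^bsub>completion y\<^esub> b y)} \<subseteq> {y. \<not> cge y 0 (a y)} \<union> {y. \<not> cge y 0 (b y)}"
      using cge_add by blast
    thus "a \<oplus>\<^bsub>adele_ring\<^esub> b \<in> carrier adele_ring" using ab
      by (auto simp: adele_ring_simps intro: finite_subset)
  next
    fix a :: "'k adele" assume a: "a \<in> carrier adele_ring"
    have "finite {y. \<not> cge y 0 (\<ominus>\<^bsub>completion y\<^esub> a y)}"
      by (rule finite_subset[of _ "{y. \<not> cge y 0 (a y)}"]) (use a in \<open>auto simp: adele_ring_simps cge_a_inv\<close>)
    thus "\<exists>b\<in>carrier adele_ring. b \<oplus>\<^bsub>adele_ring\<^esub> a = \<zero>\<^bsub>adele_ring\<^esub>"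
      using a by (intro bexI[of _ "\<lambda>y. \<ominus>\<^bsub>completion y\<^esub> a y"])
        (auto simp: adele_ring_simps C.a_ac C.m_ac C.l_neg C.r_neg C.l_distr)
  qed (auto simp: adele_ring_simps C.a_ac C.m_ac C.l_neg C.r_neg C.l_distr)
  show "comm_monoid (adele_ring :: 'k adele ring)"
  proof (rule comm_monoidI)
    fix a b :: "'k adele" assume ab: "a \<in> carrier adele_ring" "b \<in> carrier adele_ring"
    have "{y. \<not> cge y 0 (a y \<otimes>\<^bsub>completion y\<^esub> b y)} \<subseteq> {y. \<not> cge y 0 (a y)} \<union> {y. \<not> cge y 0 (b y)}"
      using cge_mult_0(1) by blast
    thus "a \<otimes>\<^bsub>adele_ring\<^esub> b \<in> carrier adele_ring" using ab
      by (auto simp: adele_ring_simps intro: finite_subset)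
    show "a \<otimes>\<^bsub>adele_ring\<^esub> b = b \<otimes>\<^bsub>adele_ring\<^esub> a"
      using ab by (auto simp: adele_ring_simps C.m_comm)
  qed (auto simp: adele_ring_simps C.a_ac C.m_ac C.l_neg C.r_neg C.l_distr)
qed (auto simp: adele_ring_simps cring.cring_simprules[OF cring_completion])

lemma group_GA: "group GA"
  unfolding GL2_def by (rule monoid.units_group[OF monoid_mat2[OF cring_adele_ring]])

abbreviation loc :: "'k::{finite,field} place \<Rightarrow> 'k adele mat2 \<Rightarrow> 'k local_elt mat2" where
  "loc \<equiv> local_component"

lemma loc_mult: "loc w (g \<otimes>\<^bsub>GA\<^esub> h) = loc w g \<otimes>\<^bsub>MC w\<^esub> loc w h"
  by (simp add: local_component_def GL2_simps mat2_simps adele_ring_simps)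

lemma loc_one: "loc w \<one>\<^bsub>GA\<^esub> = \<one>\<^bsub>MC w\<^esub>"
  by (auto simp: local_component_def GL2_simps mat2_simps adele_ring_simps fun_eq_iff)

lemma loc_eqI: "(\<And>w. loc w g = loc w h) \<Longrightarrow> g = h"
  by (simp add: local_component_def fun_eq_iff)

definition glue :: "('k place \<Rightarrow> 'k local_elt mat2) \<Rightarrow> 'k adele mat2" where
  "glue m = (\<lambda>i j w. m w i j)"

lemma loc_glue [simp]: "loc w (glue m) = m w"
  by (simp add: local_component_def glue_def)

lemma carrier_mat2_adele:
  "g \<in> carrier (mat2_monoid adele_ring) \<longleftrightarrow> (\<forall>w. loc w g \<in> carrier (MC w)) \<and> finite {w. \<not> lint w (loc w g)}"
proof -
  have "{w. \<not> lint w (loc w g)} = (\<Union>i. \<Union>j. {w. \<not> cge w 0 (g i j w)})"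
    by (auto simp: lint_def local_component_def)
  thus ?thesis by (auto simp: mat2_simps adele_ring_simps local_component_def)
qed

lemma carrier_mat2_integral:
  "g \<in> carrier (mat2_monoid integral_adele_ring) \<longleftrightarrow> (\<forall>w. lint w (loc w g))"
  by (auto simp: mat2_simps integral_adele_ring_simps lint_def local_component_def)

lemma mat2_integral_adele: "mult (mat2_monoid integral_adele_ring) = mult (mat2_monoid adele_ring)"
  "one (mat2_monoid integral_adele_ring) = one (mat2_monoid adele_ring)"
  by (simp_all add: mat2_simps integral_adele_ring_simps cong: if_cong)

text \<open>Invertibility over the adeles is invertibility at every place with both the matrix and its
  inverse integral at almost all places.\<close>

lemma carrier_GA:
  fixes g :: "'k::{finite,field} adele mat2"
  shows
  "g \<in> carrier GA \<longleftrightarrow> (\<exists>h. (\<forall>w. loc w g \<in> carrier (MC w) \<and> loc w h \<in> carrier (MC w) \<and>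
      loc w h \<otimes>\<^bsub>MC w\<^esub> loc w g = \<one>\<^bsub>MC w\<^esub> \<and> loc w g \<otimes>\<^bsub>MC w\<^esub> loc w h = \<one>\<^bsub>MC w\<^esub>) \<and>
      finite {w. \<not> lint w (loc w g)} \<and> finite {w. \<not> lint w (loc w h)})" (is "_ \<longleftrightarrow> ?r")
proof -
  have eq: "a \<otimes>\<^bsub>mat2_monoid adele_ring\<^esub> b = \<one>\<^bsub>mat2_monoid adele_ring\<^esub> \<longleftrightarrow> (\<forall>w. loc w a \<otimes>\<^bsub>MC w\<^esub> loc w b = \<one>\<^bsub>MC w\<^esub>)" for a b :: "'k adele mat2"
    using loc_mult[of _ a b] loc_one loc_eqI[of "a \<otimes>\<^bsub>GA\<^esub> b" "\<one>\<^bsub>GA\<^esub>"]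
    unfolding GL2_simps by metis
  show ?thesis unfolding carrier_GL2 eq Bex_def carrier_mat2_adele by blast
qed

lemma LK_inverse_integral:
  assumes "LK w A" "B \<in> carrier (MC w)" "B \<otimes>\<^bsub>MC w\<^esub> A = \<one>\<^bsub>MC w\<^esub>"
  shows "lint w B"
proof -
  interpret monoid "MC w" by (rule monoid_MC)
  obtain B' where B': "LK w B'" "A \<otimes>\<^bsub>MC w\<^esub> B' = \<one>\<^bsub>MC w\<^esub>" using assms(1) by (rule LK_inverse)
  have c: "A \<in> carrier (MC w)" "B' \<in> carrier (MC w)" using assms(1) B'(1) LK_lint lint_carrier by blast+
  have "B = B \<otimes>\<^bsub>MC w\<^esub> (A \<otimes>\<^bsub>MC w\<^esub> B')" using assms(2) by (simp add: B')
  also have "\<dots> = B'" using assms c by (simp flip: m_assoc)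
  finally show ?thesis using B'(1) LK_lint by blast
qed

lemma KA_iff: "g \<in> KA \<longleftrightarrow> (\<forall>w. LK w (loc w g))"
proof
  assume "g \<in> KA"
  then obtain h where h: "\<And>w. lint w (loc w g)" "\<And>w. lint w (loc w h)"
    "h \<otimes>\<^bsub>GA\<^esub> g = \<one>\<^bsub>GA\<^esub>" "g \<otimes>\<^bsub>GA\<^esub> h = \<one>\<^bsub>GA\<^esub>"
    unfolding KA_def carrier_GL2 carrier_mat2_integral Bex_def mat2_integral_adele GL2_simps by blast
  have "loc w h \<otimes>\<^bsub>MC w\<^esub> loc w g = \<one>\<^bsub>MC w\<^esub>" "loc w g \<otimes>\<^bsub>MC w\<^esub> loc w h = \<one>\<^bsub>MC w\<^esub>" for w
    using h(3,4) by (metis loc_mult loc_one)+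
  thus "\<forall>w. LK w (loc w g)" using h(1,2) unfolding LK_def by blast
next
  assume g: "\<forall>w. LK w (loc w g)"
  then obtain B where B: "\<And>w. lint w (B w)" "\<And>w. loc w g \<otimes>\<^bsub>MC w\<^esub> B w = \<one>\<^bsub>MC w\<^esub>" "\<And>w. B w \<otimes>\<^bsub>MC w\<^esub> loc w g = \<one>\<^bsub>MC w\<^esub>"
    unfolding LK_def by metis
  have "glue B \<otimes>\<^bsub>GA\<^esub> g = \<one>\<^bsub>GA\<^esub>" "g \<otimes>\<^bsub>GA\<^esub> glue B = \<one>\<^bsub>GA\<^esub>"
    by (rule loc_eqI; simp add: loc_mult loc_one B)+
  thus "g \<in> KA" using g B(1) LK_lint
    unfolding KA_def carrier_GL2 carrier_mat2_integral Bex_def mat2_integral_adele GL2_simps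
    by (intro conjI allI exI[of _ "glue B"]) auto
qed

lemma KA_subset: "(KA :: 'k::{finite,field} adele mat2 set) \<subseteq> carrier GA"
proof
  fix k :: "'k adele mat2" assume "k \<in> KA"
  then obtain B where B: "\<And>w. lint w (loc w k)" "\<And>w. lint w (B w)" "\<And>w. loc w k \<otimes>\<^bsub>MC w\<^esub> B w = \<one>\<^bsub>MC w\<^esub>" "\<And>w. B w \<otimes>\<^bsub>MC w\<^esub> loc w k = \<one>\<^bsub>MC w\<^esub>"
    unfolding KA_iff LK_def by metis
  thus "k \<in> carrier GA" unfolding carrier_GA
    by (intro exI[of _ "glue B"]) (simp add: lint_carrier)
qed

lemma subgroup_KA: "subgroup (KA :: 'k::{finite,field} adele mat2 set) GA"
proof -
  interpret group GA by (rule group_GA)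
  show ?thesis
  proof (rule subgroupI)
    show "KA \<subseteq> carrier GA" by (rule KA_subset)
    have "LK w \<one>\<^bsub>MC w\<^esub>" for w :: "'k place"
      using LK_cm_iff[of mone w] by (simp add: cm_mone)
    hence "(\<one>\<^bsub>GA\<^esub> :: 'k adele mat2) \<in> KA" by (simp add: KA_iff loc_one)
    thus "(KA :: 'k adele mat2 set) \<noteq> {}" by blast
    fix k :: "'k adele mat2" assume k: "k \<in> KA"
    hence kc: "k \<in> carrier GA" using KA_subset by blast
    have "LK w (loc w (inv\<^bsub>GA\<^esub> k))" for w
    proof -
      have i: "loc w (inv\<^bsub>GA\<^esub> k) \<otimes>\<^bsub>MC w\<^esub> loc w k = \<one>\<^bsub>MC w\<^esub>" "loc w k \<otimes>\<^bsub>MC w\<^esub> loc w (inv\<^bsub>GA\<^esub> k) = \<one>\<^bsub>MC w\<^esub>"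
        using l_inv[OF kc] r_inv[OF kc] by (metis loc_mult loc_one)+
      have LK: "LK w (loc w k)" using k by (simp add: KA_iff)
      have "loc w (inv\<^bsub>GA\<^esub> k) \<in> carrier (MC w)" using inv_closed[OF kc] unfolding carrier_GA by blast
      hence "lint w (loc w (inv\<^bsub>GA\<^esub> k))" using LK_inverse_integral[OF LK _ i(1)] by blast
      thus ?thesis using i LK_lint[OF LK] unfolding LK_def by blast
    qed
    thus "inv\<^bsub>GA\<^esub> k \<in> KA" by (simp add: KA_iff)
  next
    fix k l :: "'k adele mat2" assume "k \<in> KA" "l \<in> KA"
    thus "k \<otimes>\<^bsub>GA\<^esub> l \<in> KA" by (simp add: KA_iff loc_mult LK_mult)
  qed
qed

subsection \<open>Matrices over the function field inside the adelic group\<close>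

definition emb :: "'k::{finite,field} mats \<Rightarrow> 'k adele mat2" where
  "emb M = glue (\<lambda>w. cm w (M w))"

lemma loc_emb [simp]: "loc w (emb M) = cm w (M w)"
  by (simp add: emb_def)

lemma emb_mult: "emb M \<otimes>\<^bsub>GA\<^esub> emb N = emb (\<lambda>w. mmul (M w) (N w))"
  by (rule loc_eqI) (simp add: loc_mult cm_mmul)

lemma emb_one: "emb (\<lambda>w. mone) = \<one>\<^bsub>GA\<^esub>"
  by (rule loc_eqI) (simp add: loc_one cm_mone)

lemma emb_carrier:
  assumes "M \<in> RP"
  shows "emb M \<in> carrier GA"
  unfolding carrier_GA
proof (intro exI[of _ "emb (\<lambda>w. minv (M w))"] conjI allI)
  have "{w. \<not> mat_integral w (M w)} \<subseteq> {w. \<not> GL2O w (M w)}"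
    "{w. \<not> mat_integral w (minv (M w))} \<subseteq> {w. \<not> GL2O w (M w)}"
    using GL2O_minv by (auto simp: GL2O_def)
  thus "finite {w. \<not> lint w (loc w (emb M))}" "finite {w. \<not> lint w (loc w (emb (\<lambda>w. minv (M w))))}"
    using assms by (auto simp: RP_def intro: finite_subset)
qed (use RP_det[OF assms] in \<open>simp_all add: cm_carrier mmul_minv cm_mone flip: cm_mmul\<close>)

lemma emb_inverse:
  assumes "M \<in> RP"
  shows "emb (\<lambda>w. minv (M w)) \<otimes>\<^bsub>GA\<^esub> emb M = \<one>\<^bsub>GA\<^esub>" "emb M \<otimes>\<^bsub>GA\<^esub> emb (\<lambda>w. minv (M w)) = \<one>\<^bsub>GA\<^esub>"
  using RP_det[OF assms] by (simp_all add: emb_mult mmul_minv emb_one)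

lemma emb_KA_iff: "M \<in> RP \<Longrightarrow> emb M \<in> KA \<longleftrightarrow> (\<forall>w. GL2O w (M w))"
  by (simp add: KA_iff LK_cm_iff RP_det)

text \<open>At almost all places the component is integral and invertible, and there the rational factor is
  taken to be \<open>1\<close>; elsewhere \<open>local_approximation\<close> applies.\<close>

theorem GA_decomposition:
  fixes g :: "'k::{finite,field} adele mat2"
  assumes "g \<in> carrier GA"
  shows "\<exists>M\<in>RP. \<exists>k\<in>KA. g = emb M \<otimes>\<^bsub>GA\<^esub> k"
proof -
  interpret group GA by (rule group_GA)
  obtain h where h: "\<And>w. loc w g \<in> carrier (MC w)" "\<And>w. loc w h \<in> carrier (MC w)"
      "\<And>w. loc w h \<otimes>\<^bsub>MC w\<^esub> loc w g = \<one>\<^bsub>MC w\<^esub>" "\<And>w. loc w g \<otimes>\<^bsub>MC w\<^esub> loc w h = \<one>\<^bsub>MC w\<^esub>"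
      "finite {w. \<not> lint w (loc w g)}" "finite {w. \<not> lint w (loc w h)}"
    using assms unfolding carrier_GA by blast
  have "\<exists>M. mdet M \<noteq> 0 \<and> LK w (cm w (minv M) \<otimes>\<^bsub>MC w\<^esub> loc w g) \<and> (LK w (loc w g) \<longrightarrow> M = mone)" for w
  proof (cases "LK w (loc w g)")
    case True
    have "minv (mone :: 'k ratfun mat2) = mone" by (simp add: minv_def madj_def mone_def mscale_mk)
    thus ?thesis using True monoid.l_one[OF monoid_MC h(1)]
      by (intro exI[of _ mone]) (simp add: cm_mone)
  next
    case False
    thus ?thesis using local_approximation[OF h(1,2,3,4)] by blast
  qed
  then obtain M where M: "\<And>w. mdet (M w) \<noteq> 0" "\<And>w. LK w (cm w (minv (M w)) \<otimes>\<^bsub>MC w\<^esub> loc w g)"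
    "\<And>w. LK w (loc w g) \<Longrightarrow> M w = mone" by metis
  have "LK w (loc w g)" if "lint w (loc w g)" "lint w (loc w h)" for w
    using h(3,4) that unfolding LK_def by blast
  hence "{w. \<not> GL2O w (M w)} \<subseteq> {w. \<not> lint w (loc w g)} \<union> {w. \<not> lint w (loc w h)}"
    using M(3) GL2O_mone by force
  hence RP: "M \<in> RP" using h(5,6) M(1) by (auto simp: RP_def intro: finite_subset)
  define k where "k = emb (\<lambda>w. minv (M w)) \<otimes>\<^bsub>GA\<^esub> g"
  have "k \<in> KA" by (simp add: KA_iff k_def loc_mult M(2))
  moreover have "g = emb M \<otimes>\<^bsub>GA\<^esub> k"
    unfolding k_def using emb_carrier[OF RP] emb_carrier[OF RP_minv[OF RP]] assms emb_inverse[OF RP]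
    by (simp flip: m_assoc)
  ultimately show ?thesis using RP by blast
qed

lemma GF_eq: "(GF :: 'k::{finite,field} adele mat2 set) = {emb (\<lambda>w. A) | A. mdet A \<noteq> 0}"
proof -
  let ?T = "ring_of_type_algebra :: 'k ratfun ring"
  have T: "carrier ?T = UNIV" "mult ?T = (*)" "one ?T = 1" "add ?T = (+)" "zero ?T = 0"
    by (simp_all add: ring_of_type_algebra_def fun_eq_iff)
  have one: "\<one>\<^bsub>mat2_monoid ?T\<^esub> = mone" by (auto simp: mat2_simps T mone_def fun_eq_iff forall_2)
  have mult: "A \<otimes>\<^bsub>mat2_monoid ?T\<^esub> B = mmul A B" for A B by (simp add: mat2_simps T mmul_def)
  have "A \<in> carrier (GL2 ?T) \<longleftrightarrow> mdet A \<noteq> 0" for A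
  proof -
    have "A \<in> carrier (GL2 ?T) \<longleftrightarrow> (\<exists>B. mmul B A = mone \<and> mmul A B = mone)"
      unfolding carrier_GL2 one mult by (simp add: mat2_simps T)
    also have "\<dots> \<longleftrightarrow> mdet A \<noteq> 0"
      using mmul_minv by (metis mdet_mmul mdet_mone mult_zero_left zero_neq_one)
    finally show ?thesis .
  qed
  thus ?thesis by (auto simp: GF_def emb_def glue_def cm_def principal_adele_def)
qed

subsection \<open>The centre\<close>

definition scal :: "('k::{finite,field} place \<Rightarrow> 'k ratfun) \<Rightarrow> 'k mats" where
  "scal x = (\<lambda>w. mscale (x w) mone)"

lemma scal_RP: "(\<And>w. x w \<noteq> 0) \<Longrightarrow> finite {w. ord w (x w) \<noteq> 0} \<Longrightarrow> scal x \<in> RP"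
  unfolding scal_def by (rule RP_scalar)

lemma scal_ZA:
  fixes x :: "'k::{finite,field} place \<Rightarrow> 'k ratfun"
  assumes "\<And>w. x w \<noteq> 0" "finite {w. ord w (x w) \<noteq> 0}"
  shows "emb (scal x) \<in> ZA"
  unfolding ZA_def group_center_def
proof (intro CollectI conjI ballI)
  show "emb (scal x) \<in> carrier GA" by (intro emb_carrier scal_RP assms)
  fix g assume g: "g \<in> carrier (GA :: 'k adele mat2 monoid)"
  show "emb (scal x) \<otimes>\<^bsub>GA\<^esub> g = g \<otimes>\<^bsub>GA\<^esub> emb (scal x)"
  proof (rule loc_eqI)
    fix w :: "'k place"
    interpret C: cring "completion w" by (rule cring_completion)
    have c: "loc w g i j \<in> carrier (completion w)" for i j
      using g unfolding carrier_GA by (auto simp: mat2_simps)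
    have "cm w (mscale (x w) mone) = (\<lambda>i j. if i = j then to_completion w (x w) else \<zero>\<^bsub>completion w\<^esub>)"
      by (auto simp: cm_def mone_def mscale_mk fun_eq_iff forall_2 to_completion_ops)
    thus "loc w (emb (scal x) \<otimes>\<^bsub>GA\<^esub> g) = loc w (g \<otimes>\<^bsub>GA\<^esub> emb (scal x))"
      using c by (auto simp: loc_mult scal_def mat2_simps fun_eq_iff forall_2 C.m_comm)
  qed
qed

text \<open>Central elements commute with the two elementary unipotent matrices.\<close>

lemma ZA_scalar:
  assumes "z \<in> ZA"
  shows "loc w z 1 2 = \<zero>\<^bsub>completion w\<^esub>" "loc w z 2 1 = \<zero>\<^bsub>completion w\<^esub>" "loc w z 1 1 = loc w z 2 2"
proof -
  interpret C: cring "completion w" by (rule cring_completion)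
  have z: "z \<in> carrier GA" "\<And>g. g \<in> carrier GA \<Longrightarrow> z \<otimes>\<^bsub>GA\<^esub> g = g \<otimes>\<^bsub>GA\<^esub> z"
    using assms by (auto simp: ZA_def group_center_def)
  have c: "loc w z i j \<in> carrier (completion w)" for i j
    using z(1) unfolding carrier_GA by (auto simp: mat2_simps)
  have comm: "loc w z \<otimes>\<^bsub>MC w\<^esub> cm w A = cm w A \<otimes>\<^bsub>MC w\<^esub> loc w z" if "mdet A \<noteq> 0" for A
    using z(2)[OF emb_carrier[OF RP_const[OF that]]] by (metis loc_emb loc_mult)
  note u = comm[of "mk 1 1 0 1", unfolded mat2_simps fun_eq_iff]
  note l = comm[of "mk 1 0 1 1", unfolded mat2_simps fun_eq_iff]
  have cmk: "cm w (mk a b a' b') 1 1 = to_completion w a" "cm w (mk a b a' b') 1 2 = to_completion w b"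
    "cm w (mk a b a' b') 2 1 = to_completion w a'" "cm w (mk a b a' b') 2 2 = to_completion w b'" for a b a' b'
    by (simp_all add: cm_def)
  have "loc w z 1 1 = loc w z 1 1 \<oplus>\<^bsub>completion w\<^esub> loc w z 2 1"
    using u[rule_format, of 1 1] c by (simp add: cmk to_completion_ops)
  thus "loc w z 2 1 = \<zero>\<^bsub>completion w\<^esub>" using C.add.l_cancel_one'[of "loc w z 1 1" "loc w z 2 1"] c by simp
  have "loc w z 1 1 \<oplus>\<^bsub>completion w\<^esub> loc w z 1 2 = loc w z 1 2 \<oplus>\<^bsub>completion w\<^esub> loc w z 2 2"
    using u[rule_format, of 1 2] c by (simp add: cmk to_completion_ops)
  thus "loc w z 1 1 = loc w z 2 2" using c by (metis C.a_comm C.add.l_cancel)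
  have "loc w z 1 1 \<oplus>\<^bsub>completion w\<^esub> loc w z 1 2 = loc w z 1 1"
    using l[rule_format, of 1 1] c by (simp add: cmk to_completion_ops)
  thus "loc w z 1 2 = \<zero>\<^bsub>completion w\<^esub>" using C.add.l_cancel_one[of "loc w z 1 1" "loc w z 1 2"] c by simp
qed

text \<open>The compact factor is central as a quotient of two central elements.\<close>

lemma ZA_decomposition:
  assumes "z \<in> ZA"
  shows "\<exists>x k. (\<forall>w. x w \<noteq> 0) \<and> finite {w. ord w (x w) \<noteq> 0} \<and> k \<in> KA \<inter> ZA \<and> z = emb (scal x) \<otimes>\<^bsub>GA\<^esub> k"
proof -
  interpret group GA by (rule group_GA)
  have zc: "z \<in> carrier GA" using assms by (simp add: ZA_def group_center_def)
  then obtain h where h: "\<And>w. loc w z \<in> carrier (MC w)" "\<And>w. loc w h \<in> carrier (MC w)"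
      "\<And>w. loc w h \<otimes>\<^bsub>MC w\<^esub> loc w z = \<one>\<^bsub>MC w\<^esub>" "\<And>w. loc w z \<otimes>\<^bsub>MC w\<^esub> loc w h = \<one>\<^bsub>MC w\<^esub>"
      "finite {w. \<not> lint w (loc w z)}" "finite {w. \<not> lint w (loc w h)}"
    unfolding carrier_GA by blast
  have c: "loc w z i j \<in> carrier (completion w)" "loc w h i j \<in> carrier (completion w)" for w i j
    using h(1,2) by (auto simp: mat2_simps)
  note sc = ZA_scalar[OF assms]
  have entries: "loc w h 1 2 = \<zero>\<^bsub>completion w\<^esub> \<and> loc w h 2 1 = \<zero>\<^bsub>completion w\<^esub> \<and> loc w h 2 2 = loc w h 1 1 \<and>
     loc w h 1 1 \<otimes>\<^bsub>completion w\<^esub> loc w z 1 1 = \<one>\<^bsub>completion w\<^esub>" for w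
  proof -
    interpret C: cring "completion w" by (rule cring_completion)
    let ?a = "loc w z 1 1" and ?b = "loc w h"
    have e: "?b i j \<otimes>\<^bsub>completion w\<^esub> ?a = \<one>\<^bsub>MC w\<^esub> i j" for i j
    proof -
      have "(loc w h \<otimes>\<^bsub>MC w\<^esub> loc w z) i j = ?b i j \<otimes>\<^bsub>completion w\<^esub> ?a"
        using exhaust_2[of j] by (elim disjE; simp add: mat2_simps c sc)
      thus ?thesis using h(3)[of w] by simp
    qed
    have z0: "x = \<zero>\<^bsub>completion w\<^esub>" if "x \<in> carrier (completion w)" "x \<otimes>\<^bsub>completion w\<^esub> ?a = \<zero>\<^bsub>completion w\<^esub>" for x
    proof -
      have "x = x \<otimes>\<^bsub>completion w\<^esub> ?a \<otimes>\<^bsub>completion w\<^esub> ?b 1 1"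
        using e[of 1 1] c[of w] that(1) by (simp add: mat2_simps C.m_assoc C.m_comm[of ?a])
      thus ?thesis using that c[of w] by simp
    qed
    have "?b 2 2 = ?b 2 2 \<otimes>\<^bsub>completion w\<^esub> ?a \<otimes>\<^bsub>completion w\<^esub> ?b 1 1"
      using e[of 1 1] c[of w] by (simp add: mat2_simps C.m_assoc C.m_comm[of ?a])
    hence "?b 2 2 = ?b 1 1" using e[of 2 2] c[of w] by (simp add: mat2_simps)
    thus ?thesis using z0[of "?b 1 2"] z0[of "?b 2 1"] e[of 1 2] e[of 2 1] e[of 1 1] c[of w]
      by (simp add: mat2_simps)
  qed
  have "\<exists>x. x \<noteq> 0 \<and> cge w 0 (to_completion w (inverse x) \<otimes>\<^bsub>completion w\<^esub> loc w z 1 1) \<and>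
     cge w 0 (to_completion w x \<otimes>\<^bsub>completion w\<^esub> loc w h 1 1) \<and> (lint w (loc w z) \<and> lint w (loc w h) \<longrightarrow> x = 1)" for w
  proof (cases "lint w (loc w z) \<and> lint w (loc w h)")
    case True
    interpret C: cring "completion w" by (rule cring_completion)
    show ?thesis using True c[of w] by (intro exI[of _ 1]) (simp add: to_completion_ops lint_def)
  next
    case False
    have "loc w h 1 1 \<otimes>\<^bsub>completion w\<^esub> loc w z 1 1 = \<one>\<^bsub>completion w\<^esub>" using entries by blast
    from local_scalar_approximation[OF c(1) c(2) this] False show ?thesis by blast
  qed
  then obtain x where x: "\<And>w. x w \<noteq> 0" "\<And>w. cge w 0 (to_completion w (inverse (x w)) \<otimes>\<^bsub>completion w\<^esub> loc w z 1 1)"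
    "\<And>w. cge w 0 (to_completion w (x w) \<otimes>\<^bsub>completion w\<^esub> loc w h 1 1)"
    "\<And>w. lint w (loc w z) \<Longrightarrow> lint w (loc w h) \<Longrightarrow> x w = 1" by metis
  have fin: "finite {w. Defs.ord w (x w) \<noteq> 0}"
    by (rule finite_subset[OF _ finite_UnI[OF h(5,6)]]) (use x(4) in force)
  define k where "k = emb (scal (\<lambda>w. inverse (x w))) \<otimes>\<^bsub>GA\<^esub> z"
  have inv: "emb (scal x) \<otimes>\<^bsub>GA\<^esub> emb (scal (\<lambda>w. inverse (x w))) = \<one>\<^bsub>GA\<^esub>"
    using x(1) by (simp add: emb_mult scal_def mscale_mmul mscale_mscale emb_one)
  have s: "emb (scal x) \<in> ZA" "emb (scal (\<lambda>w. inverse (x w))) \<in> ZA"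
    using x(1) fin by (auto intro!: scal_ZA simp: ord_inverse)
  hence sG: "emb (scal x) \<in> carrier GA" "emb (scal (\<lambda>w. inverse (x w))) \<in> carrier GA"
    by (auto simp: ZA_def group_center_def)
  have scalm: "cm w (mscale a mone) = (\<lambda>i j. if i = j then to_completion w a else \<zero>\<^bsub>completion w\<^esub>)" for w a
    by (auto simp: cm_def mone_def mscale_mk fun_eq_iff forall_2 to_completion_ops)
  have "LK w (loc w k)" for w
  proof -
    interpret C: cring "completion w" by (rule cring_completion)
    interpret M: monoid "MC w" by (rule monoid_MC)
    have k: "loc w k = cm w (mscale (inverse (x w)) mone) \<otimes>\<^bsub>MC w\<^esub> loc w z"
      by (simp add: k_def loc_mult scal_def)
    let ?l = "loc w h \<otimes>\<^bsub>MC w\<^esub> cm w (mscale (x w) mone)"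
    have "lint w (loc w k)" unfolding k scalm
      using x(2)[of w] sc[of w] c[of w] by (auto simp: lint_def mat2_simps forall_2)
    moreover have "lint w ?l" unfolding scalm
      using x(3)[of w] entries[of w] c[of w] by (auto simp: lint_def mat2_simps forall_2 C.m_comm)
    moreover have s1: "cm w (mscale (x w) mone) \<otimes>\<^bsub>MC w\<^esub> cm w (mscale (inverse (x w)) mone) = \<one>\<^bsub>MC w\<^esub>"
      "cm w (mscale (inverse (x w)) mone) \<otimes>\<^bsub>MC w\<^esub> cm w (mscale (x w) mone) = \<one>\<^bsub>MC w\<^esub>"
      using x(1)[of w] by (simp_all add: mscale_mmul mscale_mscale cm_mone flip: cm_mmul)
    have "?l \<otimes>\<^bsub>MC w\<^esub> loc w k = loc w h \<otimes>\<^bsub>MC w\<^esub> (cm w (mscale (x w) mone) \<otimes>\<^bsub>MC w\<^esub> cm w (mscale (inverse (x w)) mone)) \<otimes>\<^bsub>MC w\<^esub> loc w z"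
      unfolding k using h(1,2) by (simp add: M.m_assoc cm_carrier)
    hence "?l \<otimes>\<^bsub>MC w\<^esub> loc w k = \<one>\<^bsub>MC w\<^esub>" using h(1-3) by (simp add: s1)
    moreover have "loc w k \<otimes>\<^bsub>MC w\<^esub> ?l = cm w (mscale (inverse (x w)) mone) \<otimes>\<^bsub>MC w\<^esub> (loc w z \<otimes>\<^bsub>MC w\<^esub> loc w h) \<otimes>\<^bsub>MC w\<^esub> cm w (mscale (x w) mone)"
      unfolding k using h(1,2) by (simp add: M.m_assoc cm_carrier)
    hence "loc w k \<otimes>\<^bsub>MC w\<^esub> ?l = \<one>\<^bsub>MC w\<^esub>" using h(4) by (simp add: s1 cm_carrier)
    ultimately show ?thesis unfolding LK_def by blast
  qed
  hence "k \<in> KA" by (simp add: KA_iff)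
  moreover have "k \<in> ZA"
  proof -
    let ?s = "emb (scal (\<lambda>w. inverse (x w)))"
    have "k \<otimes>\<^bsub>GA\<^esub> g = g \<otimes>\<^bsub>GA\<^esub> k" if g: "g \<in> carrier GA" for g
    proof -
      have "k \<otimes>\<^bsub>GA\<^esub> g = ?s \<otimes>\<^bsub>GA\<^esub> (z \<otimes>\<^bsub>GA\<^esub> g)" using g zc sG by (simp add: k_def m_assoc)
      also have "z \<otimes>\<^bsub>GA\<^esub> g = g \<otimes>\<^bsub>GA\<^esub> z" using assms g by (simp add: ZA_def group_center_def)
      also have "?s \<otimes>\<^bsub>GA\<^esub> (g \<otimes>\<^bsub>GA\<^esub> z) = (?s \<otimes>\<^bsub>GA\<^esub> g) \<otimes>\<^bsub>GA\<^esub> z" using g zc sG by (simp add: m_assoc)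
      also have "?s \<otimes>\<^bsub>GA\<^esub> g = g \<otimes>\<^bsub>GA\<^esub> ?s" using s(2) g by (simp add: ZA_def group_center_def)
      finally show ?thesis using g zc sG by (simp add: k_def m_assoc)
    qed
    thus ?thesis using sG zc by (simp add: ZA_def group_center_def k_def)
  qed
  moreover have "z = emb (scal x) \<otimes>\<^bsub>GA\<^esub> k"
    unfolding k_def using sG zc inv by (simp flip: m_assoc)
  ultimately show ?thesis using x(1) fin by blast
qed

section \<open>The type of an adelic matrix\<close>

definition adelic_type :: "'k::{finite,field} adele mat2 \<Rightarrow> nat" where
  "adelic_type g = (THE n. \<exists>M\<in>RP. \<exists>k\<in>KA. g = emb M \<otimes>\<^bsub>GA\<^esub> k \<and> has_type M (int n))"

text \<open>Two rational families representing the same adelic matrix differ by a rational family that is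
  integral and invertible at every place.\<close>

lemma has_type_of_decomposition_unique:
  fixes M N :: "'k::{finite,field} mats"
  assumes "M \<in> RP" "N \<in> RP" "k \<in> KA" "l \<in> KA" "emb M \<otimes>\<^bsub>GA\<^esub> k = emb N \<otimes>\<^bsub>GA\<^esub> l"
  shows "has_type N n \<longleftrightarrow> has_type M n"
proof -
  interpret G: group "GA :: 'k adele mat2 monoid" by (rule group_GA)
  interpret KA: subgroup "KA :: 'k adele mat2 set" GA by (rule subgroup_KA)
  define \<kappa> where "\<kappa> w = mmul (minv (M w)) (N w)" for w
  have RP: "\<kappa> \<in> RP" unfolding \<kappa>_def using assms(1,2) by (intro RP_mmul RP_minv)
  have c: "emb M \<in> carrier GA" "emb N \<in> carrier GA" "k \<in> carrier GA" "l \<in> carrier GA"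
    "emb (\<lambda>w. minv (M w)) \<in> carrier GA"
    using assms(1-4) by (auto intro: emb_carrier RP_minv)
  have "emb N = emb M \<otimes>\<^bsub>GA\<^esub> (k \<otimes>\<^bsub>GA\<^esub> inv\<^bsub>GA\<^esub> l)"
  proof -
    have "emb M \<otimes>\<^bsub>GA\<^esub> (k \<otimes>\<^bsub>GA\<^esub> inv\<^bsub>GA\<^esub> l) = emb N \<otimes>\<^bsub>GA\<^esub> l \<otimes>\<^bsub>GA\<^esub> inv\<^bsub>GA\<^esub> l"
      using c assms(5) by (metis G.inv_closed G.m_assoc)
    also have "\<dots> = emb N" using c by (simp add: G.m_assoc)
    finally show ?thesis by simp
  qed
  hence "emb (\<lambda>w. minv (M w)) \<otimes>\<^bsub>GA\<^esub> emb N = k \<otimes>\<^bsub>GA\<^esub> inv\<^bsub>GA\<^esub> l"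
    using c by (simp add: emb_inverse[OF assms(1)] flip: G.m_assoc)
  hence "emb \<kappa> \<in> KA" using assms(3,4) by (simp add: emb_mult \<kappa>_def[abs_def])
  hence "\<forall>w. GL2O w (\<kappa> w)" using emb_KA_iff[OF RP] by blast
  moreover have "N = (\<lambda>w. mmul (M w) (\<kappa> w))"
    using RP_det[OF assms(1)] by (simp add: \<kappa>_def mmul_minv flip: mmul_assoc)
  ultimately show ?thesis using has_type_right[OF assms(1), of \<kappa> n] by simp
qed

lemma adelic_type_eqI:
  assumes "M \<in> RP" "k \<in> KA" "has_type M (int n)"
  shows "adelic_type (emb M \<otimes>\<^bsub>GA\<^esub> k) = n"
  unfolding adelic_type_def
proof (rule the_equality)
  show "\<exists>M'\<in>RP. \<exists>k'\<in>KA. emb M \<otimes>\<^bsub>GA\<^esub> k = emb M' \<otimes>\<^bsub>GA\<^esub> k' \<and> has_type M' (int n)"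
    using assms by blast
  fix m assume "\<exists>M'\<in>RP. \<exists>k'\<in>KA. emb M \<otimes>\<^bsub>GA\<^esub> k = emb M' \<otimes>\<^bsub>GA\<^esub> k' \<and> has_type M' (int m)"
  then obtain M' k' where "M' \<in> RP" "k' \<in> KA" "emb M \<otimes>\<^bsub>GA\<^esub> k = emb M' \<otimes>\<^bsub>GA\<^esub> k'" "has_type M' (int m)"
    by blast
  hence "has_type M (int m)" using has_type_of_decomposition_unique assms(1,2) by blast
  from has_type_unique[OF this assms(3)] show "m = n" by simp
qed

lemma one_in_KA: "(\<one>\<^bsub>GA\<^esub> :: 'k::{finite,field} adele mat2) \<in> KA"
  by (rule subgroup.one_closed[OF subgroup_KA])

lemma emb_one_right: "M \<in> RP \<Longrightarrow> emb M \<otimes>\<^bsub>GA\<^esub> \<one>\<^bsub>GA\<^esub> = emb M"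
  using monoid.r_one[OF group.is_monoid[OF group_GA] emb_carrier] .

lemma adelic_type_emb: "M \<in> RP \<Longrightarrow> has_type M (int n) \<Longrightarrow> adelic_type (emb M) = n"
  using adelic_type_eqI[OF _ one_in_KA] emb_one_right by metis

lemma has_type_exists:
  assumes "M \<in> RP"
  shows "\<exists>n. equivalent M (std_mat n) \<and> has_type M (int n)"
proof -
  obtain n where n: "equivalent M (std_mat n)" using reduction[OF assms] by blast
  thus ?thesis using has_type_equivalent[OF n assms] has_type_std_mat by blast
qed

lemma adelic_type_decomposition:
  assumes "g \<in> carrier GA"
  shows "\<exists>M\<in>RP. \<exists>k\<in>KA. g = emb M \<otimes>\<^bsub>GA\<^esub> k \<and> has_type M (int (adelic_type g)) \<and> equivalent M (std_mat (adelic_type g))"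
proof -
  obtain M k where M: "M \<in> RP" "k \<in> KA" "g = emb M \<otimes>\<^bsub>GA\<^esub> k" using GA_decomposition[OF assms] by blast
  obtain n where n: "equivalent M (std_mat n)" "has_type M (int n)" using has_type_exists[OF M(1)] by blast
  have "adelic_type g = n" using adelic_type_eqI M n by blast
  thus ?thesis using M n by blast
qed

lemma adelic_type_std_mat: "adelic_type (emb (std_mat n)) = n"
  by (intro adelic_type_emb std_mat_RP has_type_std_mat)

lemma adelic_type_GF:
  fixes g :: "'k::{finite,field} adele mat2"
  assumes "\<gamma> \<in> GF" "g \<in> carrier GA"
  shows "adelic_type (\<gamma> \<otimes>\<^bsub>GA\<^esub> g) = adelic_type g"
proof -
  interpret G: group "GA :: 'k adele mat2 monoid" by (rule group_GA)
  obtain A where A: "\<gamma> = emb (\<lambda>w. A)" "mdet A \<noteq> 0" using assms(1) unfolding GF_eq by blast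
  obtain M k where M: "M \<in> RP" "k \<in> KA" "g = emb M \<otimes>\<^bsub>GA\<^esub> k" "has_type M (int (adelic_type g))"
    using adelic_type_decomposition[OF assms(2)] by blast
  have "\<gamma> \<otimes>\<^bsub>GA\<^esub> g = emb (\<lambda>w. mmul A (M w)) \<otimes>\<^bsub>GA\<^esub> k"
    using M(1-3) A emb_carrier[OF RP_const[OF A(2)]] emb_carrier[OF M(1)] KA_subset
    by (auto simp: G.m_assoc simp flip: emb_mult)
  moreover have "has_type (\<lambda>w. mmul A (M w)) (int (adelic_type g))"
    using has_type_left[OF M(1) A(2)] M(4) by blast
  ultimately show ?thesis using adelic_type_eqI[OF RP_mmul[OF RP_const[OF A(2)] M(1)] M(2)] by metis
qed

lemma adelic_type_KA:
  fixes g :: "'k::{finite,field} adele mat2"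
  assumes "l \<in> KA" "g \<in> carrier GA"
  shows "adelic_type (g \<otimes>\<^bsub>GA\<^esub> l) = adelic_type g"
proof -
  interpret G: group "GA :: 'k adele mat2 monoid" by (rule group_GA)
  obtain M k where M: "M \<in> RP" "k \<in> KA" "g = emb M \<otimes>\<^bsub>GA\<^esub> k" "has_type M (int (adelic_type g))"
    using adelic_type_decomposition[OF assms(2)] by blast
  have "g \<otimes>\<^bsub>GA\<^esub> l = emb M \<otimes>\<^bsub>GA\<^esub> (k \<otimes>\<^bsub>GA\<^esub> l)"
  proof -
    have "k \<in> carrier GA" "l \<in> carrier GA" using M(2) assms(1) KA_subset by blast+
    thus ?thesis using M(3) emb_carrier[OF M(1)] by (metis G.m_assoc)
  qed
  thus ?thesis using adelic_type_eqI[OF M(1) subgroup.m_closed[OF subgroup_KA M(2) assms(1)] M(4)] by simp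
qed

lemma adelic_type_ZA:
  fixes g :: "'k::{finite,field} adele mat2"
  assumes "z \<in> ZA" "g \<in> carrier GA"
  shows "adelic_type (z \<otimes>\<^bsub>GA\<^esub> g) = adelic_type g"
proof -
  interpret G: group "GA :: 'k adele mat2 monoid" by (rule group_GA)
  obtain x l where x: "\<And>w. x w \<noteq> 0" "finite {w. Defs.ord w (x w) \<noteq> 0}" "l \<in> KA" "l \<in> ZA" "z = emb (scal x) \<otimes>\<^bsub>GA\<^esub> l"
    using ZA_decomposition[OF assms(1)] by blast
  obtain M k where M: "M \<in> RP" "k \<in> KA" "g = emb M \<otimes>\<^bsub>GA\<^esub> k" "has_type M (int (adelic_type g))"
    using adelic_type_decomposition[OF assms(2)] by blast
  have RP: "scal x \<in> RP" by (rule scal_RP[OF x(1,2)])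
  have c: "emb (scal x) \<in> carrier GA" "emb M \<in> carrier GA" "k \<in> carrier GA" "l \<in> carrier GA"
    using emb_carrier RP M KA_subset x(3) by blast+
  have "z \<otimes>\<^bsub>GA\<^esub> g = emb (scal x) \<otimes>\<^bsub>GA\<^esub> (l \<otimes>\<^bsub>GA\<^esub> g)" using c assms(2) by (simp add: x(5) G.m_assoc)
  also have "l \<otimes>\<^bsub>GA\<^esub> g = g \<otimes>\<^bsub>GA\<^esub> l" using x(4) assms(2) by (simp add: ZA_def group_center_def)
  also have "emb (scal x) \<otimes>\<^bsub>GA\<^esub> (g \<otimes>\<^bsub>GA\<^esub> l) = (emb (scal x) \<otimes>\<^bsub>GA\<^esub> emb M) \<otimes>\<^bsub>GA\<^esub> (k \<otimes>\<^bsub>GA\<^esub> l)"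
    using c by (simp add: M(3) G.m_assoc)
  also have "emb (scal x) \<otimes>\<^bsub>GA\<^esub> emb M = emb (\<lambda>w. mscale (x w) (M w))"
    by (simp add: emb_mult scal_def mscale_mmul)
  finally have eq: "z \<otimes>\<^bsub>GA\<^esub> g = emb (\<lambda>w. mscale (x w) (M w)) \<otimes>\<^bsub>GA\<^esub> (k \<otimes>\<^bsub>GA\<^esub> l)" .
  have "(\<lambda>w. mscale (x w) (M w)) = (\<lambda>w. mmul (scal x w) (M w))" by (simp add: scal_def mscale_mmul)
  hence "(\<lambda>w. mscale (x w) (M w)) \<in> RP" using RP_mmul[OF RP M(1)] by simp
  moreover have "has_type (\<lambda>w. mscale (x w) (M w)) (int (adelic_type g))"
    using has_type_mscale[OF M(1), of x] x(1) M(4) by blast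
  ultimately show ?thesis unfolding eq
    using adelic_type_eqI[OF _ subgroup.m_closed[OF subgroup_KA M(2) x(3)]] by blast
qed

text \<open>By \<open>adelic_type_decomposition\<close> the matrix lies in the double coset of a standard
  one, and each of the three factors leading there preserves the value.\<close>

theorem invariant_determined_by_type:
  fixes f :: "'k::{finite,field} adele mat2 \<Rightarrow> 'b"
  assumes F: "\<And>\<gamma> g. \<gamma> \<in> GF \<Longrightarrow> g \<in> carrier GA \<Longrightarrow> f (\<gamma> \<otimes>\<^bsub>GA\<^esub> g) = f g"
    "\<And>z g. z \<in> ZA \<Longrightarrow> g \<in> carrier GA \<Longrightarrow> f (z \<otimes>\<^bsub>GA\<^esub> g) = f g"
    "\<And>k g. k \<in> KA \<Longrightarrow> g \<in> carrier GA \<Longrightarrow> f (g \<otimes>\<^bsub>GA\<^esub> k) = f g"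
    and g: "g \<in> carrier GA"
  shows "f g = f (emb (std_mat (adelic_type g)))"
proof -
  interpret G: group "GA :: 'k adele mat2 monoid" by (rule group_GA)
  obtain M k where M: "M \<in> RP" "k \<in> KA" "g = emb M \<otimes>\<^bsub>GA\<^esub> k" "equivalent M (std_mat (adelic_type g))"
    using adelic_type_decomposition[OF g] by blast
  obtain A x l where 1: "mdet A \<noteq> 0" "\<And>w. x w \<noteq> 0" "finite {w. Defs.ord w (x w) \<noteq> 0}" "\<And>w. GL2O w (l w)"
    "\<And>w. std_mat (adelic_type g) w = mscale (x w) (mmul A (mmul (M w) (l w)))"
    using M(4) unfolding equivalent_def by blast
  have l: "l \<in> RP" using RP_integral 1(4) by blast
  have RP: "scal x \<in> RP" by (rule scal_RP[OF 1(2,3)])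
  note c = emb_carrier[OF RP] emb_carrier[OF RP_const[OF 1(1)]] emb_carrier[OF M(1)] emb_carrier[OF l]
  have "emb (std_mat (adelic_type g)) = emb (scal x) \<otimes>\<^bsub>GA\<^esub> (emb (\<lambda>w. A) \<otimes>\<^bsub>GA\<^esub> (emb M \<otimes>\<^bsub>GA\<^esub> emb l))"
    unfolding emb_mult by (rule arg_cong[of _ _ emb]) (rule ext, simp add: 1(5) scal_def mscale_mmul)
  hence "f (emb (std_mat (adelic_type g))) = f (emb (\<lambda>w. A) \<otimes>\<^bsub>GA\<^esub> (emb M \<otimes>\<^bsub>GA\<^esub> emb l))"
    using F(2)[OF scal_ZA[OF 1(2,3)]] c by simp
  also have "\<dots> = f (emb M \<otimes>\<^bsub>GA\<^esub> emb l)"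
    using 1(1) c by (intro F(1)) (auto simp: GF_eq)
  also have "\<dots> = f (emb M)" using l 1(4) c by (intro F(3)) (simp_all add: emb_KA_iff)
  also have "\<dots> = f g" using M c by (simp add: F(3))
  finally show ?thesis by simp
qed

section \<open>The type is bounded by the height\<close>

lemma card_field_gt_1: "CARD('k::{finite,field}) > 1"
  using card_mono[of UNIV "{0, 1 :: 'k}"] by simp

lemma local_abs_le_1:
  fixes w :: "'k::{finite,field} place"
  assumes "cge w 0 x"
  shows "local_abs w x \<le> 1"
proof (cases "x = \<zero>\<^bsub>completion w\<^esub>")
  case False
  hence "0 \<le> local_ord w x" using local_ord_cge[OF cge_carrier[OF assms]] assms by blast
  hence "- (int (place_degree w) * local_ord w x) \<le> 0" by simp
  hence "real CARD('k) powi (- (int (place_degree w) * local_ord w x)) \<le> real CARD('k) powi 0"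
    using card_field_gt_1[where 'k = 'k] by (intro power_int_increasing) auto
  thus ?thesis using False by (simp add: local_abs_def)
qed (simp add: local_abs_def)

lemma local_abs_ge:
  fixes w :: "'k::{finite,field} place"
  assumes "x \<in> carrier (completion w)" "\<not> cge w (1 - int H) x"
  shows "real CARD('k) ^ (place_degree w * H) \<le> local_abs w x"
proof -
  have nz: "x \<noteq> \<zero>\<^bsub>completion w\<^esub>" using assms(2) by auto
  hence "local_ord w x \<le> - int H" using local_ord_cge[OF assms(1) nz, of "1 - int H"] assms(2) by simp
  hence "int (place_degree w) * int H \<le> int (place_degree w) * (- local_ord w x)"
    by (intro mult_left_mono) auto
  hence "real CARD('k) powi int (place_degree w * H) \<le> real CARD('k) powi (- (int (place_degree w) * local_ord w x))"
    using card_field_gt_1[where 'k = 'k] by (intro power_int_increasing) auto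
  thus ?thesis using nz unfolding power_int_of_nat by (simp add: local_abs_def)
qed

text \<open>With \<open>B\<close> the inverse of \<open>A\<close>, let \<open>H\<close> be least such that
  all entries of \<open>A\<close> and the inverse determinant \<open>det B\<close> have order at
  least \<open>- H\<close>. One of these elements then has order exactly \<open>- H\<close>, and
  it realises the maximum in the height. If \<open>H = 0\<close> this holds because they cannot
  all have positive order: the determinants of \<open>A\<close> and \<open>B\<close> multiply to
  \<open>1\<close>.\<close>

lemma local_height_bound:
  fixes w :: "'k::{finite,field} place"
  assumes A: "A \<in> carrier (MC w)" and B: "B \<in> carrier (MC w)" and AB: "A \<otimes>\<^bsub>MC w\<^esub> B = \<one>\<^bsub>MC w\<^esub>"
  shows "\<exists>H. real CARD('k) ^ (place_degree w * H) \<le> local_height w A \<and> (\<forall>i j. cge w (- int H) (A i j)) \<and>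
     cge w (- int H) (det2 (completion w) B)"
    "lint w A \<Longrightarrow> lint w B \<Longrightarrow> local_height w A \<le> 1"
proof -
  interpret C: cring "completion w" by (rule cring_completion)
  have dc: "det2 (completion w) A \<in> carrier (completion w)" "det2 (completion w) B \<in> carrier (completion w)"
    by (rule det2_closed[OF cring_completion A] det2_closed[OF cring_completion B])+
  have d1: "det2 (completion w) A \<otimes>\<^bsub>completion w\<^esub> det2 (completion w) B = \<one>\<^bsub>completion w\<^esub>"
    using det2_mult[OF cring_completion A B] det2_one[OF cring_completion] AB by metis
  hence inv: "inv\<^bsub>completion w\<^esub> det2 (completion w) A = det2 (completion w) B"
    using dc by (intro C.comm_inv_char)
  have Ac: "A i j \<in> carrier (completion w)" for i j using A by (simp add: mat2_simps)
  define S where "S = insert (local_abs w (det2 (completion w) B)) (range (\<lambda>(i, j). local_abs w (A i j)))"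
  have lh: "local_height w A = Max S" by (simp add: local_height_def inv S_def)
  have finS: "finite S" by (simp add: S_def)
  {
    assume "lint w A" "lint w B"
    hence "cge w (0 + 0) (det2 (completion w) B)" by (intro det2_cge) (simp add: lint_def)
    thus "local_height w A \<le> 1" unfolding lh using \<open>lint w A\<close> finS
      by (subst Max_le_iff) (auto simp: S_def lint_def intro!: local_abs_le_1)
  }
  define P where "P H \<longleftrightarrow> (\<forall>i j. cge w (- int H) (A i j)) \<and> cge w (- int H) (det2 (completion w) B)" for H
  obtain n where n: "n \<ge> 0" "\<And>i j. cge w (- n) (A i j)" using common_bound[OF A] by blast
  obtain m where m: "cge w m (det2 (completion w) B)" using cge_ex dc by blast
  have "P (nat (n + \<bar>m\<bar>))" unfolding P_def
    using n(1) by (auto intro: cge_mono[OF n(2)] cge_mono[OF m])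
  define H where "H = (LEAST H. P H)"
  have H: "P H" unfolding H_def using LeastI[of P] \<open>P (nat (n + \<bar>m\<bar>))\<close> by blast
  have "\<not> ((\<forall>i j. cge w (1 - int H) (A i j)) \<and> cge w (1 - int H) (det2 (completion w) B))"
  proof
    assume *: "(\<forall>i j. cge w (1 - int H) (A i j)) \<and> cge w (1 - int H) (det2 (completion w) B)"
    show False
    proof (cases H)
      case 0
      hence "cge w (1 + 1) (det2 (completion w) A)" using * by (intro det2_cge) simp
      hence "cge w (1 + 1 + 1) \<one>\<^bsub>completion w\<^esub>" using * 0 cge_mult d1 by fastforce
      thus False by simp
    next
      case (Suc H')
      hence "P H'" using * by (simp add: P_def)
      hence "H \<le> H'" unfolding H_def by (rule Least_le)
      thus False using Suc by simp
    qed
  qed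
  then consider (entry) i j where "\<not> cge w (1 - int H) (A i j)"
    | (det) "\<not> cge w (1 - int H) (det2 (completion w) B)" by blast
  hence "\<exists>s\<in>S. real CARD('k) ^ (place_degree w * H) \<le> s"
  proof cases
    case entry
    hence "real CARD('k) ^ (place_degree w * H) \<le> local_abs w (A i j)" using local_abs_ge Ac by blast
    thus ?thesis by (auto simp: S_def)
  next
    case det
    hence "real CARD('k) ^ (place_degree w * H) \<le> local_abs w (det2 (completion w) B)"
      using local_abs_ge dc by blast
    thus ?thesis by (auto simp: S_def)
  qed
  then obtain s where s: "s \<in> S" "real CARD('k) ^ (place_degree w * H) \<le> s" by blast
  have "real CARD('k) ^ (place_degree w * H) \<le> local_height w A"
    unfolding lh using s Max_ge[OF finS s(1)] by linarith
  thus "\<exists>H. real CARD('k) ^ (place_degree w * H) \<le> local_height w A \<and> (\<forall>i j. cge w (- int H) (A i j)) \<and>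
     cge w (- int H) (det2 (completion w) B)" using H unfolding P_def by blast
qed

text \<open>From \<open>det A v = A (adj A v)\<close> the order of \<open>adj A v\<close> exceeds that of a
  coordinate of \<open>det A v\<close> by at most \<open>H\<close>.\<close>

lemma local_degree_bound:
  assumes "\<And>i j. ord_ge w (- int H) (A i j)" "mdet A \<noteq> 0" "Defs.ord w (mdet A) \<le> int H" "v i \<noteq> 0"
  shows "local_degree w A v \<le> 2 * Defs.ord w (v i) + 3 * int H"
proof -
  have v: "v \<noteq> (\<lambda>i. 0)" using assms(4) by auto
  define u where "u = mapply (madj A) v"
  have u: "u \<noteq> (\<lambda>i. 0)" unfolding u_def by (rule mapply_nonzero) (use assms v in auto)
  have "\<forall>j. ord_ge w (vec_ord w u) (u j)" using vec_ord_ge_iff[OF u] by blast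
  hence "ord_ge w (- int H + vec_ord w u) (mapply A u i)"
    unfolding mapply_def by (intro ord_ge_add ord_ge_mult assms) auto
  also have "mapply A u = (\<lambda>i. mdet A * v i)"
    unfolding u_def by (simp add: mmul_madj mapply_mscale flip: mapply_mmul)
  finally have "- int H + vec_ord w u \<le> Defs.ord w (mdet A) + Defs.ord w (v i)"
    using assms(2,4) by (simp add: ord_ge_iff ord_mult)
  thus ?thesis using assms(3) by (simp add: local_degree_def u_def)
qed

text \<open>Let \<open>v\<close> be a vector of maximal degree. By \<open>local_degree_bound\<close> each
  local degree is at most three times the logarithm of the local height, in the unit of the place,
  plus twice the order of a nonzero coordinate of \<open>v\<close>; the latter terms sum to zero
  by the product formula.\<close>

theorem type_le_height:
  fixes g :: "'k::{finite,field} adele mat2"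
  assumes g: "g \<in> carrier GA"
  shows "real CARD('k) ^ adelic_type g \<le> height g ^ 3"
proof -
  interpret G: group "GA :: 'k adele mat2 monoid" by (rule group_GA)
  let ?q = "real CARD('k)"
  have q: "?q > 1" using card_field_gt_1[where 'k = 'k] by simp
  obtain M k where M: "M \<in> RP" "k \<in> KA" "g = emb M \<otimes>\<^bsub>GA\<^esub> k" "has_type M (int (adelic_type g))"
    using adelic_type_decomposition[OF g] by blast
  have kc: "k \<in> carrier GA" "inv\<^bsub>GA\<^esub> k \<in> KA" "inv\<^bsub>GA\<^esub> k \<in> carrier GA"
    using M(2) KA_subset subgroup.m_inv_closed[OF subgroup_KA] by auto
  have embM: "emb M = g \<otimes>\<^bsub>GA\<^esub> inv\<^bsub>GA\<^esub> k"
    using M kc emb_carrier[OF M(1)] by (simp add: G.m_assoc)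
  have gi: "inv\<^bsub>GA\<^esub> g \<in> carrier GA" using g by simp
  have lc: "loc w a \<in> carrier (MC w)" if "a \<in> carrier GA" for a :: "'k adele mat2" and w
    using that unfolding carrier_GA by blast
  have "emb (\<lambda>w. minv (M w)) = inv\<^bsub>GA\<^esub> emb M"
    by (rule G.inv_equality[symmetric]) (use emb_inverse[OF M(1)] emb_carrier M(1) RP_minv in auto)
  also have "\<dots> = k \<otimes>\<^bsub>GA\<^esub> inv\<^bsub>GA\<^esub> g" using embM g kc by (simp add: G.inv_mult_group)
  finally have embMi: "emb (\<lambda>w. minv (M w)) = k \<otimes>\<^bsub>GA\<^esub> inv\<^bsub>GA\<^esub> g" .
  have one: "loc w g \<otimes>\<^bsub>MC w\<^esub> loc w (inv\<^bsub>GA\<^esub> g) = \<one>\<^bsub>MC w\<^esub>" for w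
    using G.r_inv[OF g] by (metis loc_mult loc_one)
  have "\<forall>w. \<exists>H. ?q ^ (place_degree w * H) \<le> local_height w (loc w g) \<and> (\<forall>i j. cge w (- int H) (loc w g i j)) \<and>
     cge w (- int H) (det2 (completion w) (loc w (inv\<^bsub>GA\<^esub> g)))"
    using local_height_bound(1)[OF lc[OF g] lc[OF gi] one] by blast
  then obtain H where H: "\<And>w. ?q ^ (place_degree w * H w) \<le> local_height w (loc w g)"
    "\<And>w i j. cge w (- int (H w)) (loc w g i j)" "\<And>w. cge w (- int (H w)) (det2 (completion w) (loc w (inv\<^bsub>GA\<^esub> g)))"
    by metis
  have ge1: "1 \<le> local_height w (loc w g)" for w
    using H(1)[of w] one_le_power[of ?q "place_degree w * H w"] q by linarith
  have fin: "finite {w. local_height w (loc w g) \<noteq> 1}"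
  proof -
    have f: "finite {w. \<not> lint w (loc w g)}" "finite {w. \<not> lint w (loc w (inv\<^bsub>GA\<^esub> g))}"
      using g gi unfolding carrier_GA by blast+
    show ?thesis
    proof (rule finite_subset[OF _ finite_UnI[OF f]], rule subsetI, rule ccontr)
      fix w assume "w \<in> {w. local_height w (loc w g) \<noteq> 1}"
        "w \<notin> {w. \<not> lint w (loc w g)} \<union> {w. \<not> lint w (loc w (inv\<^bsub>GA\<^esub> g))}"
      thus False using local_height_bound(2)[OF lc[OF g] lc[OF gi] one, of w] ge1[of w] by auto
    qed
  qed
  (* This makes H finitely supported, so that it has a degree. *)
  have H0: "H w = 0" if "local_height w (loc w g) = 1" for w
  proof (rule ccontr)
    assume "H w \<noteq> 0"
    hence "place_degree w * H w > 0" using geom_degree_pos[of w] by (simp add: place_degree_eq)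
    hence "?q ^ (place_degree w * H w) > 1" using q by (intro one_less_power) auto
    thus False using H(1)[of w] that by simp
  qed
  have finH: "finite {w. int (H w) \<noteq> 0}"
    by (rule finite_subset[OF _ fin]) (use H0 in auto)
  define h where "h = (\<Sum>w\<in>{w. local_height w (loc w g) \<noteq> 1}. place_degree w * H w)"
  have "?q ^ h = (\<Prod>w\<in>{w. local_height w (loc w g) \<noteq> 1}. ?q ^ (place_degree w * H w))"
    unfolding h_def by (rule power_sum)
  also have "\<dots> \<le> (\<Prod>w\<in>{w. local_height w (loc w g) \<noteq> 1}. local_height w (loc w g))"
    using H(1) q by (intro prod_mono) auto
  also have "\<dots> = height g" by (simp add: height_def Prod_any.expand_set)
  finally have hh: "?q ^ h \<le> height g" .
  have wH: "weighted_sum (\<lambda>w. int (H w)) = int h"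
  proof -
    have "weighted_sum (\<lambda>w. int (H w)) = (\<Sum>w\<in>{w. local_height w (loc w g) \<noteq> 1}. int (geom_degree w) * int (H w))"
      unfolding weighted_sum_def by (rule Sum_any.expand_superset[OF fin]) (use H0 in auto)
    thus ?thesis by (simp add: h_def place_degree_eq)
  qed
  (* M differs from g by an integral factor, so the bounds for g carry over to M and its determinant. *)
  have MH: "ord_ge w (- int (H w)) (M w i j)" for w i j
  proof -
    have "cm w (M w) = loc w g \<otimes>\<^bsub>MC w\<^esub> loc w (inv\<^bsub>GA\<^esub> k)" using embM by (metis loc_emb loc_mult)
    hence "to_completion w (M w i j) = (loc w g \<otimes>\<^bsub>MC w\<^esub> loc w (inv\<^bsub>GA\<^esub> k)) i j"
      by (metis cm_def)
    moreover have "lint w (loc w (inv\<^bsub>GA\<^esub> k))" using kc(2) by (auto simp: KA_iff intro: LK_lint)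
    ultimately have "cge w (- int (H w)) (to_completion w (M w i j))"
      using H(2)[of w] by (auto simp: mat2_simps lint_def intro!: cge_add cge_mult_0(2))
    thus ?thesis by simp
  qed
  have MdH: "Defs.ord w (mdet (M w)) \<le> int (H w)" for w
  proof -
    have "cm w (minv (M w)) = loc w k \<otimes>\<^bsub>MC w\<^esub> loc w (inv\<^bsub>GA\<^esub> g)" using embMi by (metis loc_emb loc_mult)
    hence "to_completion w (mdet (minv (M w))) = det2 (completion w) (loc w k) \<otimes>\<^bsub>completion w\<^esub> det2 (completion w) (loc w (inv\<^bsub>GA\<^esub> g))"
      using det2_mult[OF cring_completion lc[OF kc(1)] lc[OF gi], of w] by (metis det2_cm)
    moreover have "lint w (loc w k)" using M(2) by (simp add: KA_iff LK_lint)
    hence "cge w (0 + 0) (det2 (completion w) (loc w k))" by (intro det2_cge) (simp add: lint_def)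
    ultimately have "cge w (- int (H w)) (to_completion w (mdet (minv (M w))))"
      using H(3)[of w] by (auto intro: cge_mult_0(1))
    thus ?thesis using RP_det[OF M(1), of w] by (simp add: mdet_minv ord_ge_def ord_inverse)
  qed
  obtain v where v: "v \<noteq> (\<lambda>i. 0)" "line_degree M v = int (adelic_type g)"
    using M(4) unfolding has_type_def by blast
  then obtain i where i: "v i \<noteq> 0" by auto
  have fv: "finite {w. 2 * Defs.ord w (v i) \<noteq> 0}" "finite {w. 3 * int (H w) \<noteq> 0}"
    using product_formula(1)[OF i] finH by simp_all
  have "int (adelic_type g) \<le> weighted_sum (\<lambda>w. 2 * Defs.ord w (v i) + 3 * int (H w))"
    unfolding v(2)[symmetric] line_degree_def
  proof (rule weighted_sum_mono)
    show "finite {w. local_degree w (M w) v \<noteq> 0}" by (rule finite_local_degree[OF M(1) v(1)])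
    show "finite {w. 2 * Defs.ord w (v i) + 3 * int (H w) \<noteq> 0}"
      by (rule finite_subset[OF _ finite_UnI[OF fv]]) auto
    show "local_degree w (M w) v \<le> 2 * Defs.ord w (v i) + 3 * int (H w)" for w
      using MH MdH RP_det[OF M(1)] i by (intro local_degree_bound)
  qed
  also have "\<dots> = 3 * int h"
    using fv weighted_sum_ord[OF i] wH by (simp add: weighted_sum_add weighted_sum_mult)
  finally have "adelic_type g \<le> h * 3" by simp
  hence "?q ^ adelic_type g \<le> ?q ^ (h * 3)" using q by (intro power_increasing) auto
  also have "\<dots> = (?q ^ h) ^ 3" by (simp add: power_mult)
  also have "\<dots> \<le> height g ^ 3" using hh q by (intro power_mono) auto
  finally show ?thesis .
qed

section \<open>A linear recursion\<close>

text \<open>The eigenvalue equation for functions of the type; \<open>S\<close> indexes the neighbours and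
  \<open>r n C\<close> is the type of the neighbour \<open>C\<close> of the standard matrix of
  type \<open>n\<close>.\<close>

definition recursive_solution ::
    "'c set \<Rightarrow> (nat \<Rightarrow> 'c \<Rightarrow> nat) \<Rightarrow> complex \<Rightarrow> (nat \<Rightarrow> complex) \<Rightarrow> bool" where
  "recursive_solution S r c \<phi> \<longleftrightarrow> (\<forall>n. (\<Sum>C\<in>S. \<phi> (r n C)) = c * \<phi> n)"

context
  fixes S :: "'c set" and r :: "nat \<Rightarrow> 'c \<Rightarrow> nat" and d :: nat
  assumes finS: "finite S" and d: "d > 0"
    and le: "\<forall>n. \<forall>C\<in>S. r n C \<le> n + d"
    and top: "\<And>n. \<exists>C\<in>S. r n C = n + d"
begin

private definition top_mult :: "nat \<Rightarrow> nat" where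
  "top_mult n = card {C \<in> S. r n C = n + d}"

private lemma top_mult_pos: "top_mult n > 0"
  using top[of n] finS by (auto simp: top_mult_def card_gt_0_iff)

private lemma recursion_sum:
  "(\<Sum>C\<in>S. \<phi> (r n C)) = of_nat (top_mult n) * \<phi> (n + d) + (\<Sum>C | C \<in> S \<and> r n C < n + d. \<phi> (r n C))"
  for \<phi> :: "nat \<Rightarrow> complex"
proof -
  have "S = {C \<in> S. r n C = n + d} \<union> {C \<in> S. r n C < n + d}"
    using le by (force simp: le_less)
  hence "(\<Sum>C\<in>S. \<phi> (r n C)) = (\<Sum>C\<in>{C \<in> S. r n C = n + d} \<union> {C \<in> S. r n C < n + d}. \<phi> (r n C))" by simp
  also have "\<dots> = (\<Sum>C | C \<in> S \<and> r n C = n + d. \<phi> (r n C)) + (\<Sum>C | C \<in> S \<and> r n C < n + d. \<phi> (r n C))"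
    using finS by (intro sum.union_disjoint) auto
  also have "(\<Sum>C | C \<in> S \<and> r n C = n + d. \<phi> (r n C)) = of_nat (top_mult n) * \<phi> (n + d)"
    by (simp add: top_mult_def)
  finally show ?thesis .
qed

text \<open>The coefficient of the highest term is a positive integer, so the equation can be solved for it.\<close>

private lemma recursive_solution_step:
  "recursive_solution S r c \<phi> \<longleftrightarrow>
     (\<forall>n. \<phi> (n + d) = (c * \<phi> n - (\<Sum>C | C \<in> S \<and> r n C < n + d. \<phi> (r n C))) / of_nat (top_mult n))"
proof -
  have "(\<Sum>C\<in>S. \<phi> (r n C)) = c * \<phi> n \<longleftrightarrow>
      \<phi> (n + d) = (c * \<phi> n - (\<Sum>C | C \<in> S \<and> r n C < n + d. \<phi> (r n C))) / of_nat (top_mult n)" for n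
    unfolding recursion_sum using top_mult_pos[of n] by (auto simp: field_simps)
  thus ?thesis by (simp add: recursive_solution_def)
qed

lemma recursive_solution_unique:
  assumes "recursive_solution S r c \<phi>" "\<And>i. i < d \<Longrightarrow> \<phi> i = 0"
  shows "\<phi> n = 0"
proof (induction n rule: less_induct)
  case (less n)
  show ?case
  proof (cases "n < d")
    case False
    then obtain m where m: "n = m + d" by (metis add.commute le_Suc_ex not_less)
    have "\<phi> m = 0" using less[of m] d m by simp
    moreover have "(\<Sum>C | C \<in> S \<and> r m C < m + d. \<phi> (r m C)) = 0"
      using less m by (intro sum.neutral) auto
    ultimately show ?thesis using assms(1) unfolding recursive_solution_step m by simp
  qed (use assms in auto)
qed

lemma recursive_solution_exists: "\<exists>\<phi>. recursive_solution S r c \<phi> \<and> (\<forall>i<d. \<phi> i = a i)"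
proof -
  define H where "H \<phi> m = (if m < d then a m else
     (c * \<phi> (m - d) - (\<Sum>C | C \<in> S \<and> r (m - d) C < m. \<phi> (r (m - d) C))) / of_nat (top_mult (m - d)))"
    for \<phi> :: "nat \<Rightarrow> complex" and m
  define \<phi> where "\<phi> = wfrec less_than H"
  have \<phi>: "\<phi> m = H \<phi> m" for m
  proof -
    have "\<phi> m = H (cut \<phi> less_than m) m" unfolding \<phi>_def by (rule wfrec[OF wf_less_than])
    also have "\<dots> = H \<phi> m"
    proof (cases "m < d")
      case False
      hence "cut \<phi> less_than m (m - d) = \<phi> (m - d)" using d by (simp add: cut_apply)
      moreover have "(\<Sum>C | C \<in> S \<and> r (m - d) C < m. cut \<phi> less_than m (r (m - d) C)) =
          (\<Sum>C | C \<in> S \<and> r (m - d) C < m. \<phi> (r (m - d) C))"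
        by (intro sum.cong refl) (simp add: cut_apply)
      ultimately show ?thesis using False by (simp add: H_def)
    qed (simp add: H_def)
    finally show ?thesis .
  qed
  have "recursive_solution S r c \<phi>" unfolding recursive_solution_step
  proof
    fix n
    show "\<phi> (n + d) = (c * \<phi> n - (\<Sum>C | C \<in> S \<and> r n C < n + d. \<phi> (r n C))) / of_nat (top_mult n)"
      by (subst \<phi>) (simp add: H_def)
  qed
  moreover have "\<phi> i = a i" if "i < d" for i
    using that by (subst \<phi>) (simp add: H_def)
  ultimately show ?thesis by blast
qed

text \<open>The recursion bounds \<open>\<phi> n\<close> by \<open>norm c + card S\<close> times a bound for
  the earlier values, so each step costs at most a constant factor.\<close>

lemma recursive_solution_growth:
  assumes "recursive_solution S r c \<phi>"
  shows "\<exists>B A. A \<ge> 1 \<and> (\<forall>n. norm (\<phi> n) \<le> B * A ^ n)"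
proof -
  define B where "B = (\<Sum>i<d. norm (\<phi> i))"
  (* The summand 1 ensures that A is at least 1, so that the bounds B * A ^ n increase with n. *)
  define A where "A = norm c + real (card S) + 1"
  have B: "B \<ge> 0" by (simp add: B_def sum_nonneg)
  have A: "A \<ge> 1" by (simp add: A_def)
  have "norm (\<phi> n) \<le> B * A ^ n" for n
  proof (induction n rule: less_induct)
    case (less n)
    show ?case
    proof (cases "n < d")
      case True
      hence "norm (\<phi> n) \<le> B" unfolding B_def by (intro member_le_sum) auto
      also have "\<dots> \<le> B * A ^ n" using B A mult_left_mono[OF one_le_power[OF A, of n] B] by simp
      finally show ?thesis .
    next
      case False
      then obtain m where m: "n = m + d" by (metis add.commute le_Suc_ex not_less)
      define D where "D = B * A ^ (n - 1)"
      have bound: "norm (\<phi> i) \<le> D" if "i < n" for i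
      proof -
        have "norm (\<phi> i) \<le> B * A ^ i" using less that by blast
        also have "\<dots> \<le> D" unfolding D_def using that A B by (intro mult_left_mono power_increasing) auto
        finally show ?thesis .
      qed
      have D: "D \<ge> 0" using B A by (simp add: D_def)
      let ?T = "{C \<in> S. r m C < m + d}"
      have "norm (\<phi> n) = norm (c * \<phi> m - (\<Sum>C\<in>?T. \<phi> (r m C))) / real (top_mult m)"
        using assms unfolding recursive_solution_step m by (simp add: norm_divide)
      also have "\<dots> \<le> norm (c * \<phi> m - (\<Sum>C\<in>?T. \<phi> (r m C)))"
        using top_mult_pos[of m] by (simp add: divide_le_eq mult_le_cancel_left1)
      also have "\<dots> \<le> norm (c * \<phi> m) + norm (\<Sum>C\<in>?T. \<phi> (r m C))" by (rule norm_triangle_ineq4)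
      also have "norm (c * \<phi> m) \<le> norm c * D"
        unfolding norm_mult using bound[of m] d m by (intro mult_left_mono) auto
      also have "norm (\<Sum>C\<in>?T. \<phi> (r m C)) \<le> real (card ?T) * D"
        using bound m by (intro sum_norm_bound) auto
      also have "real (card ?T) * D \<le> real (card S) * D"
        using D finS by (intro mult_right_mono of_nat_mono card_mono) auto
      finally have "norm (\<phi> n) \<le> (norm c + real (card S)) * D" by (simp add: algebra_simps)
      also have "\<dots> \<le> A * D" using D by (intro mult_right_mono) (auto simp: A_def)
      also have "A * D = B * A ^ Suc (n - 1)" by (simp add: D_def)
      also have "Suc (n - 1) = n" using d m by simp
      finally show ?thesis .
    qed
  qed
  with A show ?thesis by blast
qed

end

section \<open>The Hecke operator\<close>

definition hecke_mat :: "'k::{finite,field} place \<Rightarrow> 'k ratfun \<Rightarrow> 'k mats" where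
  "hecke_mat y p = (\<lambda>w. if w = y then mk p 0 0 1 else mone)"

lemma local_inclusion_eq:
  "local_inclusion y (diag2 (completion y) (to_completion y p) \<one>\<^bsub>completion y\<^esub>) = emb (hecke_mat y p)"
proof (rule loc_eqI)
  fix w
  have "cm y (mk p 0 0 1) = diag2 (completion y) (to_completion y p) \<one>\<^bsub>completion y\<^esub>"
    by (auto simp: cm_def diag2_def fun_eq_iff forall_2 to_completion_ops)
  moreover have "loc w (local_inclusion y (diag2 (completion y) (to_completion y p) \<one>\<^bsub>completion y\<^esub>)) =
      (if w = y then diag2 (completion y) (to_completion y p) \<one>\<^bsub>completion y\<^esub> else \<one>\<^bsub>MC w\<^esub>)"
    by (auto simp: local_component_def local_inclusion_def fun_eq_iff)
  ultimately show "loc w (local_inclusion y (diag2 (completion y) (to_completion y p) \<one>\<^bsub>completion y\<^esub>)) = loc w (emb (hecke_mat y p))"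
    by (simp add: hecke_mat_def cm_mone)
qed

lemma hecke_mat_RP:
  assumes "p \<noteq> 0"
  shows "hecke_mat y p \<in> RP"
proof -
  have "{w. \<not> GL2O w (hecke_mat y p w)} \<subseteq> {y}" by (auto simp: hecke_mat_def)
  thus ?thesis using assms by (auto simp: RP_def hecke_mat_def intro: finite_subset)
qed

definition hecke_set :: "'k::{finite,field} place \<Rightarrow> 'k ratfun \<Rightarrow> 'k adele mat2 set" where
  "hecke_set y p = {k \<otimes>\<^bsub>GA\<^esub> emb (hecke_mat y p) \<otimes>\<^bsub>GA\<^esub> l | k l. k \<in> KA \<and> l \<in> KA}"

lemma hecke_place_eq: "hecke_place y p = indicator (hecke_set y p)"
  unfolding hecke_place_def local_inclusion_eq hecke_set_def
  by (rule arg_cong[of _ _ indicator]) (auto simp: set_mult_def r_coset_def)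

text \<open>Away from \<open>y\<close> the Hecke matrix is the identity, so there the rational
  representative \<open>N\<close> is a product of integral invertible matrices. At
  \<open>y\<close> the determinant of \<open>N\<close> is \<open>p\<close> up to a unit; the two
  inequalities for its order come from writing \<open>N\<close> in terms of the Hecke matrix and
  conversely.\<close>

lemma hecke_set_decomposition:
  fixes h :: "'k::{finite,field} adele mat2"
  assumes p: "uniformizer y p" and h: "h \<in> hecke_set y p"
  shows "\<exists>N\<in>RP. \<exists>\<kappa>\<in>KA. h = emb N \<otimes>\<^bsub>GA\<^esub> \<kappa> \<and> (\<forall>w. w \<noteq> y \<longrightarrow> GL2O w (N w)) \<and>
     mat_integral y (N y) \<and> Defs.ord y (mdet (N y)) = 1"
proof -
  interpret G: group "GA :: 'k adele mat2 monoid" by (rule group_GA)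
  interpret C: cring "completion y" by (rule cring_completion)
  have p0: "p \<noteq> 0" "Defs.ord y p = 1" using p uniformizer_nonzero by (auto simp: uniformizer_def)
  let ?a = "emb (hecke_mat y p)"
  have a: "?a \<in> carrier GA" by (rule emb_carrier[OF hecke_mat_RP[OF p0(1)]])
  obtain k l where kl: "k \<in> KA" "l \<in> KA" "h = k \<otimes>\<^bsub>GA\<^esub> ?a \<otimes>\<^bsub>GA\<^esub> l" using h by (auto simp: hecke_set_def)
  have c: "k \<in> carrier GA" "l \<in> carrier GA" using kl KA_subset by blast+
  hence hc: "h \<in> carrier GA" using a kl(3) by simp
  obtain N \<kappa> where N: "N \<in> RP" "\<kappa> \<in> KA" "h = emb N \<otimes>\<^bsub>GA\<^esub> \<kappa>" using GA_decomposition[OF hc] by blast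
  have \<kappa>c: "\<kappa> \<in> carrier GA" using N(2) KA_subset by blast
  define m where "m = l \<otimes>\<^bsub>GA\<^esub> inv\<^bsub>GA\<^esub> \<kappa>"
  have m: "m \<in> KA" unfolding m_def
    using kl(2) N(2) subgroup.m_closed[OF subgroup_KA] subgroup.m_inv_closed[OF subgroup_KA] by blast
  have mc: "m \<in> carrier GA" using m KA_subset by blast
  have Nc: "emb N \<in> carrier GA" by (rule emb_carrier[OF N(1)])
  have "emb N = h \<otimes>\<^bsub>GA\<^esub> inv\<^bsub>GA\<^esub> \<kappa>" using Nc \<kappa>c by (simp add: N(3) G.m_assoc)
  also have "\<dots> = k \<otimes>\<^bsub>GA\<^esub> ?a \<otimes>\<^bsub>GA\<^esub> m" using c a \<kappa>c by (simp add: kl(3) m_def G.m_assoc)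
  finally have eN: "emb N = k \<otimes>\<^bsub>GA\<^esub> ?a \<otimes>\<^bsub>GA\<^esub> m" .
  have "inv\<^bsub>GA\<^esub> k \<otimes>\<^bsub>GA\<^esub> emb N \<otimes>\<^bsub>GA\<^esub> inv\<^bsub>GA\<^esub> m = (inv\<^bsub>GA\<^esub> k \<otimes>\<^bsub>GA\<^esub> k) \<otimes>\<^bsub>GA\<^esub> ?a \<otimes>\<^bsub>GA\<^esub> (m \<otimes>\<^bsub>GA\<^esub> inv\<^bsub>GA\<^esub> m)"
    unfolding eN using c(1) a mc G.inv_closed[OF c(1)] G.inv_closed[OF mc]
    by (simp only: G.m_assoc G.m_closed)
  also have "\<dots> = ?a" using c(1) a mc by simp
  finally have ea: "?a = inv\<^bsub>GA\<^esub> k \<otimes>\<^bsub>GA\<^esub> emb N \<otimes>\<^bsub>GA\<^esub> inv\<^bsub>GA\<^esub> m" by simp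
  have locN: "cm w (N w) = loc w k \<otimes>\<^bsub>MC w\<^esub> cm w (hecke_mat y p w) \<otimes>\<^bsub>MC w\<^esub> loc w m" for w
    using eN by (metis loc_emb loc_mult)
  have loca: "cm y (hecke_mat y p y) = loc y (inv\<^bsub>GA\<^esub> k) \<otimes>\<^bsub>MC y\<^esub> cm y (N y) \<otimes>\<^bsub>MC y\<^esub> loc y (inv\<^bsub>GA\<^esub> m)"
    using ea by (metis loc_emb loc_mult)
  have LK: "LK w (loc w b)" if "b \<in> KA" for w and b :: "'k adele mat2" using that by (simp add: KA_iff)
  have mi: "inv\<^bsub>GA\<^esub> k \<in> KA" "inv\<^bsub>GA\<^esub> m \<in> KA" using kl m subgroup.m_inv_closed[OF subgroup_KA] by blast+
  have lc: "loc y b \<in> carrier (MC y)" if "b \<in> KA" for b :: "'k adele mat2"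
    using LK[OF that] LK_lint lint_carrier by blast
  have det0: "cge y 0 (det2 (completion y) (loc y b))" if "b \<in> KA" for b :: "'k adele mat2"
    using det2_cge[of y 0 "loc y b"] LK_lint[OF LK[OF that]] by (simp add: lint_def)
  have detprod: "det2 (completion y) (A \<otimes>\<^bsub>MC y\<^esub> B \<otimes>\<^bsub>MC y\<^esub> C) =
      det2 (completion y) A \<otimes>\<^bsub>completion y\<^esub> det2 (completion y) B \<otimes>\<^bsub>completion y\<^esub> det2 (completion y) C"
    if "A \<in> carrier (MC y)" "B \<in> carrier (MC y)" "C \<in> carrier (MC y)" for A B C
    using that monoid.m_closed[OF monoid_MC that(1,2)] by (simp add: det2_mult[OF cring_completion])
  have GL: "GL2O w (N w)" if "w \<noteq> y" for w
  proof -
    have "LK w (cm w mone)" using LK_cm_iff[of mone w] by simp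
    hence "LK w (cm w (N w))" unfolding locN using that LK kl(1) m
      by (simp add: hecke_mat_def LK_mult)
    thus ?thesis using LK_cm_iff[OF RP_det[OF N(1)]] by blast
  qed
  have "lint y (cm y (hecke_mat y p y))"
    using p0 by (simp add: hecke_mat_def mat_integral_mk ord_ge_def)
  hence "lint y (cm y (N y))" unfolding locN using LK kl(1) m by (intro lint_mult) (auto intro: LK_lint)
  hence int: "mat_integral y (N y)" by simp
  have "to_completion y (mdet (N y)) = det2 (completion y) (loc y k) \<otimes>\<^bsub>completion y\<^esub> to_completion y p \<otimes>\<^bsub>completion y\<^esub> det2 (completion y) (loc y m)"
    using detprod[OF lc[OF kl(1)] cm_carrier[of y "hecke_mat y p y"] lc[OF m]] unfolding locN[symmetric] det2_cm by (simp add: hecke_mat_def)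
  moreover have "cge y 1 \<dots>" using det0 kl(1) m p0 by (intro cge_mult_0) (auto simp: ord_ge_def)
  ultimately have "cge y 1 (to_completion y (mdet (N y)))" by simp
  hence 1: "1 \<le> Defs.ord y (mdet (N y))" using RP_det[OF N(1), of y] by (simp add: ord_ge_def)
  have "to_completion y p = det2 (completion y) (loc y (inv\<^bsub>GA\<^esub> k)) \<otimes>\<^bsub>completion y\<^esub> to_completion y (mdet (N y)) \<otimes>\<^bsub>completion y\<^esub> det2 (completion y) (loc y (inv\<^bsub>GA\<^esub> m))"
    using detprod[OF lc[OF mi(1)] cm_carrier[of y "N y"] lc[OF mi(2)]] unfolding loca[symmetric] det2_cm by (simp add: hecke_mat_def)
  moreover have "cge y (Defs.ord y (mdet (N y))) \<dots>" using det0 mi by (intro cge_mult_0) (auto simp: ord_ge_def)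
  ultimately have "cge y (Defs.ord y (mdet (N y))) (to_completion y p)" by simp
  hence "Defs.ord y (mdet (N y)) \<le> 1" using p0 by (simp add: ord_ge_def)
  with 1 GL int N show ?thesis by (intro bexI[of _ N] bexI[of _ \<kappa>]) auto
qed

lemma hecke_set_carrier:
  assumes "p \<noteq> 0"
  shows "hecke_set y p \<subseteq> carrier GA"
proof
  fix h assume "h \<in> hecke_set y p"
  then obtain k l where kl: "k \<in> KA" "l \<in> KA" "h = k \<otimes>\<^bsub>GA\<^esub> emb (hecke_mat y p) \<otimes>\<^bsub>GA\<^esub> l" by (auto simp: hecke_set_def)
  interpret G: group "GA :: 'a adele mat2 monoid" by (rule group_GA)
  have "k \<in> carrier GA" "l \<in> carrier GA" using kl KA_subset by blast+
  thus "h \<in> carrier GA" using emb_carrier[OF hecke_mat_RP[OF assms]] kl(3) by simp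
qed

lemma hecke_set_KA:
  fixes h :: "'k::{finite,field} adele mat2"
  assumes "p \<noteq> 0" "h \<in> hecke_set y p" "k \<in> KA"
  shows "k \<otimes>\<^bsub>GA\<^esub> h \<in> hecke_set y p" "h \<otimes>\<^bsub>GA\<^esub> k \<in> hecke_set y p"
proof -
  interpret G: group "GA :: 'k adele mat2 monoid" by (rule group_GA)
  let ?a = "emb (hecke_mat y p)"
  obtain m l where kl: "m \<in> KA" "l \<in> KA" "h = m \<otimes>\<^bsub>GA\<^esub> ?a \<otimes>\<^bsub>GA\<^esub> l" using assms(2) by (auto simp: hecke_set_def)
  have c: "m \<in> carrier GA" "l \<in> carrier GA" "k \<in> carrier GA" "?a \<in> carrier GA"
    using kl assms KA_subset emb_carrier[OF hecke_mat_RP[OF assms(1)]] by blast+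
  have "k \<otimes>\<^bsub>GA\<^esub> h = (k \<otimes>\<^bsub>GA\<^esub> m) \<otimes>\<^bsub>GA\<^esub> ?a \<otimes>\<^bsub>GA\<^esub> l" "h \<otimes>\<^bsub>GA\<^esub> k = m \<otimes>\<^bsub>GA\<^esub> ?a \<otimes>\<^bsub>GA\<^esub> (l \<otimes>\<^bsub>GA\<^esub> k)"
    using c by (simp_all add: kl(3) G.m_assoc)
  thus "k \<otimes>\<^bsub>GA\<^esub> h \<in> hecke_set y p" "h \<otimes>\<^bsub>GA\<^esub> k \<in> hecke_set y p"
    using kl(1,2) assms(3) subgroup.m_closed[OF subgroup_KA] unfolding hecke_set_def by blast+
qed

text \<open>By \<open>line_degree_step\<close>, passing back to the original bundle lowers the degree of a
  vector that is maximal for the neighbour by at most the degree of \<open>y\<close>. The compact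
  factor \<open>k\<close> of \<open>g\<close> is absorbed into the double coset.\<close>

lemma adelic_type_hecke_le:
  fixes g :: "'k::{finite,field} adele mat2"
  assumes p: "uniformizer y p" and g: "g \<in> carrier GA" and h: "h \<in> hecke_set y p"
  shows "adelic_type (g \<otimes>\<^bsub>GA\<^esub> h) \<le> adelic_type g + geom_degree y"
proof -
  interpret G: group "GA :: 'k adele mat2 monoid" by (rule group_GA)
  have p0: "p \<noteq> 0" using p by (rule uniformizer_nonzero)
  obtain M k where M: "M \<in> RP" "k \<in> KA" "g = emb M \<otimes>\<^bsub>GA\<^esub> k" "has_type M (int (adelic_type g))"
    using adelic_type_decomposition[OF g] by blast
  obtain N \<kappa> where N: "N \<in> RP" "\<kappa> \<in> KA" "k \<otimes>\<^bsub>GA\<^esub> h = emb N \<otimes>\<^bsub>GA\<^esub> \<kappa>" "\<And>w. w \<noteq> y \<Longrightarrow> GL2O w (N w)"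
     "mat_integral y (N y)" "Defs.ord y (mdet (N y)) = 1"
    using hecke_set_decomposition[OF p hecke_set_KA(1)[OF p0 h M(2)]] by blast
  have c: "emb M \<in> carrier GA" "k \<in> carrier GA" "emb N \<in> carrier GA" "\<kappa> \<in> carrier GA" "h \<in> carrier GA"
    using M N KA_subset emb_carrier h hecke_set_carrier[OF p0] by blast+
  have eq: "g \<otimes>\<^bsub>GA\<^esub> h = emb (\<lambda>w. mmul (M w) (N w)) \<otimes>\<^bsub>GA\<^esub> \<kappa>"
    using c by (simp add: M(3) G.m_assoc N(3) flip: emb_mult)
  have RP: "(\<lambda>w. mmul (M w) (N w)) \<in> RP" by (rule RP_mmul[OF M(1) N(1)])
  obtain n where n: "has_type (\<lambda>w. mmul (M w) (N w)) (int n)" using has_type_exists[OF RP] by blast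
  have tn: "adelic_type (g \<otimes>\<^bsub>GA\<^esub> h) = n" unfolding eq by (rule adelic_type_eqI[OF RP N(2) n])
  obtain v where v: "v \<noteq> (\<lambda>i. 0)" "line_degree (\<lambda>w. mmul (M w) (N w)) v = int n"
    using n unfolding has_type_def by blast
  have "int n \<le> line_degree M v + int (geom_degree y)"
    unfolding v(2)[symmetric] by (rule line_degree_step[OF M(1) N(1) N(4-6) v(1)])
  also have "line_degree M v \<le> int (adelic_type g)" using M(4) v(1) unfolding has_type_def by blast
  finally show ?thesis using tn by simp
qed

lemma adelic_type_hecke_top:
  fixes y :: "'k::{finite,field} place"
  assumes p: "uniformizer y p"
  shows "adelic_type (emb (std_mat n) \<otimes>\<^bsub>GA\<^esub> emb (hecke_mat y p)) = n + geom_degree y"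
  unfolding emb_mult
  using has_type_std_mat_step[OF p, of n] RP_mmul[OF std_mat_RP hecke_mat_RP[OF uniformizer_nonzero[OF p]]]
  by (intro adelic_type_emb) (auto simp: hecke_mat_def)

subsection \<open>Cosets\<close>

definition left_coset :: "'k::{finite,field} adele mat2 \<Rightarrow> 'k adele mat2 set" where
  "left_coset h = (\<lambda>k. h \<otimes>\<^bsub>GA\<^esub> k) ` KA"

definition hecke_cosets :: "'k::{finite,field} place \<Rightarrow> 'k ratfun \<Rightarrow> 'k adele mat2 set set" where
  "hecke_cosets y p = left_coset ` hecke_set y p"

lemma left_coset_self:
  fixes h :: "'k::{finite,field} adele mat2"
  shows "h \<in> carrier GA \<Longrightarrow> h \<in> left_coset h"
  using one_in_KA monoid.r_one[OF group.is_monoid[OF group_GA], of h] unfolding left_coset_def by force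

lemma left_coset_eq:
  fixes h :: "'k::{finite,field} adele mat2"
  assumes "h \<in> carrier GA" "g \<in> left_coset h"
  shows "left_coset g = left_coset h"
proof -
  interpret G: group "GA :: 'k adele mat2 monoid" by (rule group_GA)
  obtain k where k: "k \<in> KA" "g = h \<otimes>\<^bsub>GA\<^esub> k" using assms(2) by (auto simp: left_coset_def)
  have kc: "k \<in> carrier GA" "inv\<^bsub>GA\<^esub> k \<in> KA" "inv\<^bsub>GA\<^esub> k \<in> carrier GA"
    using k KA_subset subgroup.m_inv_closed[OF subgroup_KA] by blast+
  show ?thesis
  proof (intro equalityI subsetI)
    fix x assume "x \<in> left_coset g"
    then obtain l where l: "l \<in> KA" "x = g \<otimes>\<^bsub>GA\<^esub> l" by (auto simp: left_coset_def)
    moreover have "l \<in> carrier GA" using l KA_subset by blast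
    ultimately have "x = h \<otimes>\<^bsub>GA\<^esub> (k \<otimes>\<^bsub>GA\<^esub> l)" using k kc assms(1) by (simp add: G.m_assoc)
    thus "x \<in> left_coset h" using subgroup.m_closed[OF subgroup_KA k(1) l(1)] by (auto simp: left_coset_def)
  next
    fix x assume "x \<in> left_coset h"
    then obtain l where l: "l \<in> KA" "x = h \<otimes>\<^bsub>GA\<^esub> l" by (auto simp: left_coset_def)
    have lc: "l \<in> carrier GA" using l KA_subset by blast
    have "g \<otimes>\<^bsub>GA\<^esub> (inv\<^bsub>GA\<^esub> k \<otimes>\<^bsub>GA\<^esub> l) = h \<otimes>\<^bsub>GA\<^esub> ((k \<otimes>\<^bsub>GA\<^esub> inv\<^bsub>GA\<^esub> k) \<otimes>\<^bsub>GA\<^esub> l)"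
      unfolding k(2) using assms(1) kc(1,3) lc by (simp only: G.m_assoc G.m_closed)
    also have "\<dots> = x" using lc kc l(2) by simp
    finally have "x = g \<otimes>\<^bsub>GA\<^esub> (inv\<^bsub>GA\<^esub> k \<otimes>\<^bsub>GA\<^esub> l)" by simp
    thus "x \<in> left_coset g" using subgroup.m_closed[OF subgroup_KA kc(2) l(1)] by (auto simp: left_coset_def)
  qed
qed

lemma hecke_cosets_subset: "p \<noteq> 0 \<Longrightarrow> C \<in> hecke_cosets y p \<Longrightarrow> C \<subseteq> hecke_set y p"
  by (auto simp: hecke_cosets_def left_coset_def hecke_set_KA(2))

lemma hecke_coset_rep:
  assumes "p \<noteq> 0" "C \<in> hecke_cosets y p" "h \<in> C"
  shows "C = left_coset h"
proof -
  obtain g where "g \<in> hecke_set y p" "C = left_coset g" using assms(2) by (auto simp: hecke_cosets_def)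
  thus ?thesis using left_coset_eq[of g h] assms hecke_set_carrier by blast
qed

lemma hecke_coset_nonempty: "p \<noteq> 0 \<Longrightarrow> C \<in> hecke_cosets y p \<Longrightarrow> \<exists>h. h \<in> C"
  unfolding hecke_cosets_def using left_coset_self hecke_set_carrier by blast

definition residue_rep :: "'k::{finite,field} place \<Rightarrow> 'k local_elt \<Rightarrow> 'k poly" where
  "residue_rep y x = (SOME a. a \<in> polys_below (geom_degree y) \<and> cge y 1 (x \<ominus>\<^bsub>completion y\<^esub> to_completion y (to_fract a)))"

lemma residue_rep:
  assumes "cge y 0 x"
  shows "residue_rep y x \<in> polys_below (geom_degree y)"
    "cge y 1 (x \<ominus>\<^bsub>completion y\<^esub> to_completion y (to_fract (residue_rep y x)))"
proof -
  interpret C: cring "completion y" by (rule cring_completion)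
  have xc: "x \<in> carrier (completion y)" using assms by (rule cge_carrier)
  obtain a where a: "cge y 1 (x \<ominus>\<^bsub>completion y\<^esub> to_completion y a)" using completion_approx[OF xc] by blast
  have "cge y 0 (x \<ominus>\<^bsub>completion y\<^esub> (x \<ominus>\<^bsub>completion y\<^esub> to_completion y a))"
    by (rule cge_diff[OF assms cge_mono[OF a]]) simp
  also have "x \<ominus>\<^bsub>completion y\<^esub> (x \<ominus>\<^bsub>completion y\<^esub> to_completion y a) = to_completion y a"
    using xc by (simp add: a_minus_def C.minus_add C.r_neg2)
  finally have "ord_ge y 0 a" by simp
  then obtain b where b: "b \<in> polys_below (geom_degree y)" "ord_ge y 1 (a - to_fract b)"
    using residue_rep_exists by blast
  have "cge y 1 ((x \<ominus>\<^bsub>completion y\<^esub> to_completion y a) \<oplus>\<^bsub>completion y\<^esub> to_completion y (a - to_fract b))"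
    using a b(2) by (intro cge_add) auto
  also have "(x \<ominus>\<^bsub>completion y\<^esub> to_completion y a) \<oplus>\<^bsub>completion y\<^esub> to_completion y (a - to_fract b) = x \<ominus>\<^bsub>completion y\<^esub> to_completion y (to_fract b)"
    unfolding to_completion_ops using xc by (simp add: a_minus_def C.a_assoc C.r_neg1)
  finally have "\<exists>a. a \<in> polys_below (geom_degree y) \<and> cge y 1 (x \<ominus>\<^bsub>completion y\<^esub> to_completion y (to_fract a))"
    using b(1) by blast
  hence "residue_rep y x \<in> polys_below (geom_degree y) \<and> cge y 1 (x \<ominus>\<^bsub>completion y\<^esub> to_completion y (to_fract (residue_rep y x)))"
    unfolding residue_rep_def by (rule someI_ex)
  thus "residue_rep y x \<in> polys_below (geom_degree y)"
    "cge y 1 (x \<ominus>\<^bsub>completion y\<^esub> to_completion y (to_fract (residue_rep y x)))" by blast+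
qed

lemma residue_rep_eq_imp:
  assumes "cge y 0 x" "cge y 0 z" "residue_rep y x = residue_rep y z"
  shows "cge y 1 (x \<ominus>\<^bsub>completion y\<^esub> z)"
proof -
  interpret C: cring "completion y" by (rule cring_completion)
  let ?a = "to_completion y (to_fract (residue_rep y x))"
  have "cge y 1 ((x \<ominus>\<^bsub>completion y\<^esub> ?a) \<ominus>\<^bsub>completion y\<^esub> (z \<ominus>\<^bsub>completion y\<^esub> ?a))"
    using cge_diff[OF residue_rep(2)[OF assms(1)] residue_rep(2)[OF assms(2)]] by (simp only: assms(3))
  also have "(x \<ominus>\<^bsub>completion y\<^esub> ?a) \<ominus>\<^bsub>completion y\<^esub> (z \<ominus>\<^bsub>completion y\<^esub> ?a) = x \<ominus>\<^bsub>completion y\<^esub> z"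
    using assms(1,2)[THEN cge_carrier] by (simp add: a_minus_def C.minus_add C.a_ac C.r_neg1 C.r_neg2 C.r_neg)
  finally show ?thesis .
qed

text \<open>Conjugation by \<open>diag (p, 1)\<close> multiplies the lower left entry by \<open>p\<close>
  and divides the upper right entry by \<open>p\<close>. The upper right entry of
  \<open>k\<^sup>-\<^sup>1 k'\<close> is linear in the second column of \<open>k'\<close> and
  vanishes for \<open>k' = k\<close>, so it lies in the maximal ideal when the second columns are
  congruent.\<close>

lemma hecke_conjugation_integral:
  fixes k k' :: "'k::{finite,field} adele mat2"
  assumes p: "uniformizer y p" and k: "k \<in> KA" "k' \<in> KA"
    and eq: "residue_rep y (loc y k 1 2) = residue_rep y (loc y k' 1 2)" "residue_rep y (loc y k 2 2) = residue_rep y (loc y k' 2 2)"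
  shows "lint y (loc y (emb (\<lambda>w. minv (hecke_mat y p w)) \<otimes>\<^bsub>GA\<^esub> (inv\<^bsub>GA\<^esub> k \<otimes>\<^bsub>GA\<^esub> k') \<otimes>\<^bsub>GA\<^esub> emb (hecke_mat y p)))"
proof -
  interpret G: group "GA :: 'k adele mat2 monoid" by (rule group_GA)
  interpret C: cring "completion y" by (rule cring_completion)
  have p0: "p \<noteq> 0" "Defs.ord y p = 1" using p uniformizer_nonzero by (auto simp: uniformizer_def)
  let ?\<kappa> = "loc y (inv\<^bsub>GA\<^esub> k)" and ?P = "loc y (inv\<^bsub>GA\<^esub> k \<otimes>\<^bsub>GA\<^esub> k')"
  have ki: "inv\<^bsub>GA\<^esub> k \<in> KA" "k \<in> carrier GA" using k subgroup.m_inv_closed[OF subgroup_KA] KA_subset by blast+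
  have int: "cge y 0 (loc y b i j)" if "b \<in> KA" for b :: "'k adele mat2" and i j
    using that LK_lint[of y "loc y b"] by (simp add: KA_iff lint_def)
  have c: "loc y b i j \<in> carrier (completion y)" if "b \<in> KA" for b :: "'k adele mat2" and i j
    using int[OF that] by (rule cge_carrier)
  have PK: "inv\<^bsub>GA\<^esub> k \<otimes>\<^bsub>GA\<^esub> k' \<in> KA" using ki k subgroup.m_closed[OF subgroup_KA] by blast
  have "?\<kappa> \<otimes>\<^bsub>MC y\<^esub> loc y k = \<one>\<^bsub>MC y\<^esub>" using G.l_inv[OF ki(2)] by (metis loc_mult loc_one)
  hence z: "?\<kappa> 1 1 \<otimes>\<^bsub>completion y\<^esub> loc y k 1 2 \<oplus>\<^bsub>completion y\<^esub> ?\<kappa> 1 2 \<otimes>\<^bsub>completion y\<^esub> loc y k 2 2 = \<zero>\<^bsub>completion y\<^esub>"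
    by (simp add: mat2_simps fun_eq_iff forall_2)
  have "?P 1 2 = ?\<kappa> 1 1 \<otimes>\<^bsub>completion y\<^esub> loc y k' 1 2 \<oplus>\<^bsub>completion y\<^esub> ?\<kappa> 1 2 \<otimes>\<^bsub>completion y\<^esub> loc y k' 2 2"
    by (simp add: loc_mult mat2_simps)
  (* The subtracted expression is the upper right entry of the identity. *)
  also have "\<dots> = (?\<kappa> 1 1 \<otimes>\<^bsub>completion y\<^esub> loc y k' 1 2 \<oplus>\<^bsub>completion y\<^esub> ?\<kappa> 1 2 \<otimes>\<^bsub>completion y\<^esub> loc y k' 2 2) \<ominus>\<^bsub>completion y\<^esub>
      (?\<kappa> 1 1 \<otimes>\<^bsub>completion y\<^esub> loc y k 1 2 \<oplus>\<^bsub>completion y\<^esub> ?\<kappa> 1 2 \<otimes>\<^bsub>completion y\<^esub> loc y k 2 2)"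
    unfolding z using c ki k by (simp add: a_minus_def)
  also have "\<dots> = ?\<kappa> 1 1 \<otimes>\<^bsub>completion y\<^esub> (loc y k' 1 2 \<ominus>\<^bsub>completion y\<^esub> loc y k 1 2) \<oplus>\<^bsub>completion y\<^esub>
      ?\<kappa> 1 2 \<otimes>\<^bsub>completion y\<^esub> (loc y k' 2 2 \<ominus>\<^bsub>completion y\<^esub> loc y k 2 2)"
    using c[OF ki(1), of 1 1] c[OF ki(1), of 1 2] c[OF k(1), of 1 2] c[OF k(1), of 2 2] c[OF k(2), of 1 2] c[OF k(2), of 2 2]
    by algebra
  finally have "cge y 1 (?P 1 2)"
    using int ki k eq by (auto intro!: cge_add cge_mult_0(1) residue_rep_eq_imp)
  hence "cge y (-1 + 1) (to_completion y (inverse p) \<otimes>\<^bsub>completion y\<^esub> ?P 1 2)"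
    using p0 by (intro cge_mult) (auto simp: ord_ge_def ord_inverse)
  hence e12: "cge y 0 (to_completion y (inverse p) \<otimes>\<^bsub>completion y\<^esub> ?P 1 2)" by simp
  have e21: "cge y 0 (?P 2 1 \<otimes>\<^bsub>completion y\<^esub> to_completion y p)"
    using int[OF PK] p0 by (intro cge_mult_0(1)) (auto simp: ord_ge_def)
  have Pc: "?P i j \<in> carrier (completion y)" for i j by (rule c[OF PK])
  have e11: "to_completion y (inverse p) \<otimes>\<^bsub>completion y\<^esub> ?P 1 1 \<otimes>\<^bsub>completion y\<^esub> to_completion y p = ?P 1 1"
  proof -
    have "to_completion y (inverse p) \<otimes>\<^bsub>completion y\<^esub> ?P 1 1 \<otimes>\<^bsub>completion y\<^esub> to_completion y p =
        (to_completion y (inverse p) \<otimes>\<^bsub>completion y\<^esub> to_completion y p) \<otimes>\<^bsub>completion y\<^esub> ?P 1 1"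
      using Pc by (simp add: C.m_ac)
    thus ?thesis using Pc p0 by (simp add: to_completion_ops(1) flip: to_completion_ops(4))
  qed
  have mi: "minv (mk p 0 0 1) = mk (inverse p) 0 0 1"
    using p0 by (simp add: minv_def madj_def mscale_mk)
  have cmk: "cm y (mk a b a' b') 1 1 = to_completion y a" "cm y (mk a b a' b') 1 2 = to_completion y b"
    "cm y (mk a b a' b') 2 1 = to_completion y a'" "cm y (mk a b a' b') 2 2 = to_completion y b'" for a b a' b'
    by (simp_all add: cm_def)
  have eq: "loc y (emb (\<lambda>w. minv (hecke_mat y p w)) \<otimes>\<^bsub>GA\<^esub> (inv\<^bsub>GA\<^esub> k \<otimes>\<^bsub>GA\<^esub> k') \<otimes>\<^bsub>GA\<^esub> emb (hecke_mat y p)) =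
     cm y (mk (inverse p) 0 0 1) \<otimes>\<^bsub>MC y\<^esub> ?P \<otimes>\<^bsub>MC y\<^esub> cm y (mk p 0 0 1)"
    by (simp only: loc_mult loc_emb) (simp add: hecke_mat_def mi)
  show ?thesis unfolding eq
    using e11 e12 e21 int[OF PK] Pc
    by (simp add: lint_def mat2_simps forall_2 cmk to_completion_ops(1,2))
qed

lemma hecke_coset_eqI:
  fixes k k' :: "'k::{finite,field} adele mat2"
  assumes p: "uniformizer y p" and k: "k \<in> KA" "k' \<in> KA"
    and eq: "residue_rep y (loc y k 1 2) = residue_rep y (loc y k' 1 2)" "residue_rep y (loc y k 2 2) = residue_rep y (loc y k' 2 2)"
  shows "left_coset (k' \<otimes>\<^bsub>GA\<^esub> emb (hecke_mat y p)) = left_coset (k \<otimes>\<^bsub>GA\<^esub> emb (hecke_mat y p))"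
proof -
  interpret G: group "GA :: 'k adele mat2 monoid" by (rule group_GA)
  let ?a = "emb (hecke_mat y p)" and ?b = "emb (\<lambda>w. minv (hecke_mat y p w))"
  have RP: "hecke_mat y p \<in> RP" by (rule hecke_mat_RP[OF uniformizer_nonzero[OF p]])
  have c: "k \<in> carrier GA" "k' \<in> carrier GA" "?a \<in> carrier GA" "?b \<in> carrier GA"
    using k KA_subset emb_carrier[OF RP] emb_carrier[OF RP_minv[OF RP]] by blast+
  note ba = emb_inverse[OF RP]
  have canc: "x \<otimes>\<^bsub>GA\<^esub> (inv\<^bsub>GA\<^esub> x \<otimes>\<^bsub>GA\<^esub> z) = z" "inv\<^bsub>GA\<^esub> x \<otimes>\<^bsub>GA\<^esub> (x \<otimes>\<^bsub>GA\<^esub> z) = z" "?a \<otimes>\<^bsub>GA\<^esub> (?b \<otimes>\<^bsub>GA\<^esub> z) = z"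
    if "x \<in> carrier GA" "z \<in> carrier GA" for x z
    using that c ba by (simp_all flip: G.m_assoc)
  define m where "m = ?b \<otimes>\<^bsub>GA\<^esub> (inv\<^bsub>GA\<^esub> k \<otimes>\<^bsub>GA\<^esub> k') \<otimes>\<^bsub>GA\<^esub> ?a"
  define m' where "m' = ?b \<otimes>\<^bsub>GA\<^esub> (inv\<^bsub>GA\<^esub> k' \<otimes>\<^bsub>GA\<^esub> k) \<otimes>\<^bsub>GA\<^esub> ?a"
  have mm: "m \<otimes>\<^bsub>GA\<^esub> m' = \<one>\<^bsub>GA\<^esub>" "m' \<otimes>\<^bsub>GA\<^esub> m = \<one>\<^bsub>GA\<^esub>"
    unfolding m_def m'_def using c ba by (simp_all add: G.m_assoc canc)
  have "LK w (loc w m)" for w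
  proof (cases "w = y")
    case True
    have "lint y (loc y m)" "lint y (loc y m')"
      unfolding m_def m'_def using eq k p by (intro hecke_conjugation_integral; simp)+
    moreover have "loc y m \<otimes>\<^bsub>MC y\<^esub> loc y m' = \<one>\<^bsub>MC y\<^esub>" "loc y m' \<otimes>\<^bsub>MC y\<^esub> loc y m = \<one>\<^bsub>MC y\<^esub>"
      using mm by (metis loc_mult loc_one)+
    ultimately show ?thesis unfolding LK_def True by blast
  next
    case False
    have "GL2O w (hecke_mat y p w)" using False by (simp add: hecke_mat_def)
    hence "LK w (cm w (hecke_mat y p w))" "LK w (cm w (minv (hecke_mat y p w)))"
      using LK_cm_iff[OF RP_det[OF RP]] LK_cm_iff[OF RP_det[OF RP_minv[OF RP]]] GL2O_minv by blast+
    moreover have "inv\<^bsub>GA\<^esub> k \<otimes>\<^bsub>GA\<^esub> k' \<in> KA"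
      using k subgroup.m_closed[OF subgroup_KA] subgroup.m_inv_closed[OF subgroup_KA] by blast
    hence "LK w (loc w (inv\<^bsub>GA\<^esub> k \<otimes>\<^bsub>GA\<^esub> k'))" by (simp add: KA_iff)
    ultimately show ?thesis unfolding m_def by (simp only: loc_mult[of w _ ?a] loc_mult[of w ?b] loc_emb LK_mult)
  qed
  hence "m \<in> KA" by (simp add: KA_iff)
  moreover have "k' \<otimes>\<^bsub>GA\<^esub> ?a = (k \<otimes>\<^bsub>GA\<^esub> ?a) \<otimes>\<^bsub>GA\<^esub> m"
    unfolding m_def using c by (simp add: G.m_assoc canc)
  ultimately have "k' \<otimes>\<^bsub>GA\<^esub> ?a \<in> left_coset (k \<otimes>\<^bsub>GA\<^esub> ?a)" by (auto simp: left_coset_def)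
  thus ?thesis using c by (intro left_coset_eq) auto
qed

text \<open>By \<open>hecke_coset_eqI\<close> the coset of \<open>k\<close> times the Hecke matrix depends
  only on the residue classes of the second column of \<open>k\<close> at \<open>y\<close>, of
  which there are finitely many.\<close>

lemma finite_hecke_cosets:
  fixes y :: "'k::{finite,field} place"
  assumes p: "uniformizer y p"
  shows "finite (hecke_cosets y p)"
proof -
  interpret G: group "GA :: 'k adele mat2 monoid" by (rule group_GA)
  define F where "F k = left_coset (k \<otimes>\<^bsub>GA\<^esub> emb (hecke_mat y p))" for k :: "'k adele mat2"
  define \<rho> where "\<rho> k = (residue_rep y (loc y k 1 2), residue_rep y (loc y k 2 2))" for k :: "'k adele mat2"
  have a: "emb (hecke_mat y p) \<in> carrier GA"
    by (rule emb_carrier[OF hecke_mat_RP[OF uniformizer_nonzero[OF p]]])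
  have "hecke_cosets y p \<subseteq> F ` KA"
  proof
    fix C assume "C \<in> hecke_cosets y p"
    then obtain k l where kl: "k \<in> KA" "l \<in> KA" "C = left_coset (k \<otimes>\<^bsub>GA\<^esub> emb (hecke_mat y p) \<otimes>\<^bsub>GA\<^esub> l)"
      by (auto simp: hecke_cosets_def hecke_set_def)
    moreover have "k \<in> carrier GA" using kl KA_subset by blast
    ultimately have "C = F k" unfolding F_def kl(3) using a
      by (intro left_coset_eq) (auto simp: left_coset_def)
    thus "C \<in> F ` KA" using kl(1) by blast
  qed
  moreover have "finite (F ` KA)"
  proof -
    have "finite (polys_below (geom_degree y) :: 'k poly set)"
      using card_polys_below[of "geom_degree y", where 'k = 'k] by (intro card_ge_0_finite) simp
    moreover have "\<rho> ` KA \<subseteq> polys_below (geom_degree y) \<times> polys_below (geom_degree y)"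
    proof
      fix x assume "x \<in> \<rho> ` KA"
      then obtain k where k: "k \<in> KA" "x = \<rho> k" by blast
      have "cge y 0 (loc y k i j)" for i j
        using k(1) LK_lint[of y "loc y k"] by (simp add: KA_iff lint_def)
      thus "x \<in> polys_below (geom_degree y) \<times> polys_below (geom_degree y)"
        using residue_rep(1)[of y "loc y k 1 2"] residue_rep(1)[of y "loc y k 2 2"] by (simp add: k(2) \<rho>_def)
    qed
    ultimately have "finite (\<rho> ` KA)" by (meson finite_SigmaI finite_subset)
    moreover have "F ` KA = (\<lambda>x. F (SOME k. k \<in> KA \<and> \<rho> k = x)) ` (\<rho> ` KA)"
      unfolding image_image
    proof (rule image_cong[OF refl])
      fix k :: "'k adele mat2" assume k: "k \<in> KA"
      hence "\<exists>k'. k' \<in> KA \<and> \<rho> k' = \<rho> k" by blast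
      hence "(SOME k'. k' \<in> KA \<and> \<rho> k' = \<rho> k) \<in> KA \<and> \<rho> (SOME k'. k' \<in> KA \<and> \<rho> k' = \<rho> k) = \<rho> k" by (rule someI_ex)
      thus "F k = F (SOME k'. k' \<in> KA \<and> \<rho> k' = \<rho> k)"
        unfolding F_def using k by (intro hecke_coset_eqI[OF p]) (auto simp: \<rho>_def)
    qed
    ultimately show ?thesis by simp
  qed
  ultimately show ?thesis by (rule finite_subset)
qed

definition coset_rep :: "'k::{finite,field} adele mat2 set \<Rightarrow> 'k adele mat2" where
  "coset_rep C = (SOME h. h \<in> C)"

lemma coset_rep: "p \<noteq> 0 \<Longrightarrow> C \<in> hecke_cosets y p \<Longrightarrow> coset_rep C \<in> C"
  unfolding coset_rep_def by (rule someI_ex[OF hecke_coset_nonempty])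

lemma coset_rep_hecke_set: "p \<noteq> 0 \<Longrightarrow> C \<in> hecke_cosets y p \<Longrightarrow> coset_rep C \<in> hecke_set y p"
  using coset_rep hecke_cosets_subset by blast

definition right_invariant :: "('k::{finite,field} adele mat2 \<Rightarrow> 'b) \<Rightarrow> bool" where
  "right_invariant f \<longleftrightarrow> (\<forall>k\<in>KA. \<forall>g\<in>carrier GA. f (g \<otimes>\<^bsub>GA\<^esub> k) = f g)"

lemma right_invariant_coset:
  fixes f :: "'k::{finite,field} adele mat2 \<Rightarrow> 'b"
  assumes f: "right_invariant f" and p: "p \<noteq> 0" and g: "g \<in> carrier GA" and C: "C \<in> hecke_cosets y p" "h \<in> C"
  shows "f (g \<otimes>\<^bsub>GA\<^esub> h) = f (g \<otimes>\<^bsub>GA\<^esub> coset_rep C)"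
proof -
  interpret G: group "GA :: 'k adele mat2 monoid" by (rule group_GA)
  have r: "coset_rep C \<in> carrier GA" using coset_rep_hecke_set[OF p C(1)] hecke_set_carrier[OF p] by blast
  have "h \<in> left_coset (coset_rep C)" using hecke_coset_rep[OF p C(1) coset_rep[OF p C(1)]] C(2) by simp
  then obtain k where k: "k \<in> KA" "h = coset_rep C \<otimes>\<^bsub>GA\<^esub> k" by (auto simp: left_coset_def)
  have "k \<in> carrier GA" using k KA_subset by blast
  hence "g \<otimes>\<^bsub>GA\<^esub> h = (g \<otimes>\<^bsub>GA\<^esub> coset_rep C) \<otimes>\<^bsub>GA\<^esub> k" using g r by (simp add: k(2) G.m_assoc)
  thus ?thesis using f k(1) g r by (simp add: right_invariant_def)
qed

definition coset_sum :: "'k::{finite,field} place \<Rightarrow> 'k ratfun \<Rightarrow> ('k adele mat2 \<Rightarrow> complex) \<Rightarrow> 'k adele mat2 \<Rightarrow> complex" where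
  "coset_sum y p f g = (\<Sum>C\<in>hecke_cosets y p. f (g \<otimes>\<^bsub>GA\<^esub> coset_rep C))"

text \<open>The subgroup \<open>KA\<close> is measurable because its measure is not \<open>0\<close>, the
  value at sets that are not measurable. By left invariance its translates have measure
  \<open>1\<close>, so they are measurable for the same reason. The double coset is a finite
  disjoint union of such translates, and the integrand is constant on each of them.\<close>

theorem hecke_action_eq_coset_sum:
  fixes f :: "'k::{finite,field} adele mat2 \<Rightarrow> complex"
  assumes p: "uniformizer y p" and \<mu>: "haar_measure GA GA_topology \<mu>" "emeasure \<mu> KA = 1"
    and f: "right_invariant f" and g: "g \<in> carrier GA"
  shows "hecke_action \<mu> (hecke_place y p) f g = coset_sum y p f g"
proof -
  have p0: "p \<noteq> 0" using p by (rule uniformizer_nonzero)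
  have KA: "KA \<in> sets \<mu>" using \<mu>(2) by (intro emeasure_neq_0_sets) simp
  have C1: "emeasure \<mu> C = 1" if "C \<in> hecke_cosets y p" for C
  proof -
    obtain h where h: "h \<in> hecke_set y p" "C = left_coset h" using \<open>C \<in> hecke_cosets y p\<close> by (auto simp: hecke_cosets_def)
    have "h \<in> carrier GA" using h(1) hecke_set_carrier[OF p0] by blast
    hence "emeasure \<mu> ((\<lambda>k. h \<otimes>\<^bsub>GA\<^esub> k) ` KA) = emeasure \<mu> KA"
      using \<mu>(1) KA unfolding haar_measure_def by blast
    thus ?thesis by (simp add: h(2) left_coset_def \<mu>(2))
  qed
  have C2: "C \<in> sets \<mu>" if "C \<in> hecke_cosets y p" for C
    using C1[OF that] by (intro emeasure_neq_0_sets) simp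
  have pt: "hecke_place y p h * f (g \<otimes>\<^bsub>GA\<^esub> h) =
      (\<Sum>C\<in>hecke_cosets y p. indicator C h *\<^sub>R f (g \<otimes>\<^bsub>GA\<^esub> coset_rep C))" for h
  proof (cases "h \<in> hecke_set y p")
    case True
    hence hc: "h \<in> carrier GA" using hecke_set_carrier[OF p0] by blast
    let ?D = "left_coset h"
    have D: "?D \<in> hecke_cosets y p" "h \<in> ?D" using True left_coset_self[OF hc] by (auto simp: hecke_cosets_def)
    have "indicator C h *\<^sub>R f (g \<otimes>\<^bsub>GA\<^esub> coset_rep C) = 0" if "C \<in> hecke_cosets y p - {?D}" for C
      using that hecke_coset_rep[OF p0, of C y h] by (auto simp: indicator_def)
    hence "(\<Sum>C\<in>hecke_cosets y p - {?D}. indicator C h *\<^sub>R f (g \<otimes>\<^bsub>GA\<^esub> coset_rep C)) = 0"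
      by (intro sum.neutral ballI)
    hence "(\<Sum>C\<in>hecke_cosets y p. indicator C h *\<^sub>R f (g \<otimes>\<^bsub>GA\<^esub> coset_rep C)) = indicator ?D h *\<^sub>R f (g \<otimes>\<^bsub>GA\<^esub> coset_rep ?D)"
      by (simp add: sum.remove[OF finite_hecke_cosets[OF p] D(1)])
    also have "\<dots> = f (g \<otimes>\<^bsub>GA\<^esub> h)" using D(2) right_invariant_coset[OF f p0 g D] by simp
    finally show ?thesis using True by (simp add: hecke_place_eq)
  next
    case False
    hence "indicator C h *\<^sub>R f (g \<otimes>\<^bsub>GA\<^esub> coset_rep C) = 0" if "C \<in> hecke_cosets y p" for C
      using hecke_cosets_subset[OF p0 that] by (auto simp: indicator_def)
    hence "(\<Sum>C\<in>hecke_cosets y p. indicator C h *\<^sub>R f (g \<otimes>\<^bsub>GA\<^esub> coset_rep C)) = 0"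
      by (intro sum.neutral ballI)
    thus ?thesis using False by (simp add: hecke_place_eq)
  qed
  have "has_bochner_integral \<mu> (\<lambda>h. \<Sum>C\<in>hecke_cosets y p. indicator C h *\<^sub>R f (g \<otimes>\<^bsub>GA\<^esub> coset_rep C))
      (\<Sum>C\<in>hecke_cosets y p. measure \<mu> C *\<^sub>R f (g \<otimes>\<^bsub>GA\<^esub> coset_rep C))"
    by (intro has_bochner_integral_sum has_bochner_integral_indicator) (auto simp: C1 C2)
  moreover have "(\<Sum>C\<in>hecke_cosets y p. measure \<mu> C *\<^sub>R f (g \<otimes>\<^bsub>GA\<^esub> coset_rep C)) = coset_sum y p f g"
    unfolding coset_sum_def by (intro sum.cong refl) (simp add: measure_def C1)
  ultimately show ?thesis using g unfolding hecke_action_def pt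
    by (simp add: has_bochner_integral_integral_eq)
qed

lemma coset_sum_left:
  fixes f :: "'k::{finite,field} adele mat2 \<Rightarrow> complex"
  assumes p: "p \<noteq> 0" and x: "x \<in> carrier GA" "\<And>g. g \<in> carrier GA \<Longrightarrow> f (x \<otimes>\<^bsub>GA\<^esub> g) = f g" and g: "g \<in> carrier GA"
  shows "coset_sum y p f (x \<otimes>\<^bsub>GA\<^esub> g) = coset_sum y p f g"
  unfolding coset_sum_def
proof (rule sum.cong[OF refl])
  interpret G: group "GA :: 'k adele mat2 monoid" by (rule group_GA)
  fix C assume C: "C \<in> hecke_cosets y p"
  have "coset_rep C \<in> carrier GA" using coset_rep_hecke_set[OF p C] hecke_set_carrier[OF p] by blast
  thus "f (x \<otimes>\<^bsub>GA\<^esub> g \<otimes>\<^bsub>GA\<^esub> coset_rep C) = f (g \<otimes>\<^bsub>GA\<^esub> coset_rep C)"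
    using x g by (simp add: G.m_assoc)
qed

text \<open>Left multiplication by an element of the compact subgroup permutes the cosets in the double
  coset.\<close>

lemma coset_sum_right:
  fixes f :: "'k::{finite,field} adele mat2 \<Rightarrow> complex"
  assumes p: "uniformizer y p" and f: "right_invariant f" and k: "k \<in> KA" and g: "g \<in> carrier GA"
  shows "coset_sum y p f (g \<otimes>\<^bsub>GA\<^esub> k) = coset_sum y p f g"
proof -
  interpret G: group "GA :: 'k adele mat2 monoid" by (rule group_GA)
  have p0: "p \<noteq> 0" using p by (rule uniformizer_nonzero)
  have kc: "k \<in> carrier GA" using k KA_subset by blast
  let ?S = "hecke_cosets y p"
  define T where "T C = left_coset (k \<otimes>\<^bsub>GA\<^esub> coset_rep C)" for C :: "'k adele mat2 set"
  have rep: "coset_rep C \<in> hecke_set y p" "coset_rep C \<in> carrier GA" if "C \<in> ?S" for C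
    using coset_rep_hecke_set[OF p0 that] hecke_set_carrier[OF p0] by blast+
  have TS: "T C \<in> ?S" if "C \<in> ?S" for C
    using hecke_set_KA(1)[OF p0 rep(1)[OF that] k] by (simp add: T_def hecke_cosets_def)
  have inj: "inj_on T ?S"
  proof (rule inj_onI)
    fix C D assume CD: "C \<in> ?S" "D \<in> ?S" "T C = T D"
    have "k \<otimes>\<^bsub>GA\<^esub> coset_rep D \<in> left_coset (k \<otimes>\<^bsub>GA\<^esub> coset_rep C)"
      using CD(3) left_coset_self[of "k \<otimes>\<^bsub>GA\<^esub> coset_rep D"] kc rep[OF CD(2)] by (simp add: T_def)
    then obtain l where l: "l \<in> KA" "k \<otimes>\<^bsub>GA\<^esub> coset_rep D = k \<otimes>\<^bsub>GA\<^esub> coset_rep C \<otimes>\<^bsub>GA\<^esub> l"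
      by (auto simp: left_coset_def)
    have lc: "l \<in> carrier GA" using l(1) KA_subset by blast
    have "coset_rep D = coset_rep C \<otimes>\<^bsub>GA\<^esub> l"
      using l(2) kc lc rep(2)[OF CD(1)] rep(2)[OF CD(2)] by (simp add: G.m_assoc)
    hence "coset_rep D \<in> left_coset (coset_rep C)" using l(1) by (auto simp: left_coset_def)
    also have "\<dots> = C" using hecke_coset_rep[OF p0 CD(1) coset_rep[OF p0 CD(1)]] by simp
    finally have "C = left_coset (coset_rep D)" by (rule hecke_coset_rep[OF p0 CD(1)])
    also have "\<dots> = D" using hecke_coset_rep[OF p0 CD(2) coset_rep[OF p0 CD(2)]] by simp
    finally show "C = D" .
  qed
  have "T ` ?S = ?S" using finite_hecke_cosets[OF p] TS inj by (intro endo_inj_surj) auto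
  with inj have bij: "bij_betw T ?S ?S" by (simp add: bij_betw_def)
  have "coset_sum y p f (g \<otimes>\<^bsub>GA\<^esub> k) = (\<Sum>C\<in>?S. f (g \<otimes>\<^bsub>GA\<^esub> coset_rep (T C)))"
    unfolding coset_sum_def
  proof (rule sum.cong[OF refl])
    fix C assume C: "C \<in> ?S"
    have "k \<otimes>\<^bsub>GA\<^esub> coset_rep C \<in> T C" unfolding T_def using kc rep[OF C] by (intro left_coset_self) simp
    hence "f (g \<otimes>\<^bsub>GA\<^esub> (k \<otimes>\<^bsub>GA\<^esub> coset_rep C)) = f (g \<otimes>\<^bsub>GA\<^esub> coset_rep (T C))"
      by (rule right_invariant_coset[OF f p0 g TS[OF C]])
    thus "f (g \<otimes>\<^bsub>GA\<^esub> k \<otimes>\<^bsub>GA\<^esub> coset_rep C) = f (g \<otimes>\<^bsub>GA\<^esub> coset_rep (T C))"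
      using g kc rep[OF C] by (simp add: G.m_assoc)
  qed
  also have "\<dots> = coset_sum y p f g" unfolding coset_sum_def
    by (rule sum.reindex_bij_betw[OF bij])
  finally show ?thesis .
qed

section \<open>The eigenspace\<close>

text \<open>The form attached to a sequence; the value \<open>0\<close> outside the group is the one that
  the forms have there by convention.\<close>

definition radial :: "(nat \<Rightarrow> complex) \<Rightarrow> 'k::{finite,field} adele mat2 \<Rightarrow> complex" where
  "radial \<phi> g = (if g \<in> carrier GA then \<phi> (adelic_type g) else 0)"

lemma GF_carrier: "GF \<subseteq> carrier (GA :: 'k::{finite,field} adele mat2 monoid)"
  using emb_carrier RP_const by (auto simp: GF_eq)

lemma ZA_carrier: "ZA \<subseteq> carrier GA"
  by (auto simp: ZA_def group_center_def)

lemma radial_invariant: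
  fixes g :: "'k::{finite,field} adele mat2"
  assumes "g \<in> carrier GA"
  shows "\<gamma> \<in> GF \<Longrightarrow> radial \<phi> (\<gamma> \<otimes>\<^bsub>GA\<^esub> g) = radial \<phi> g"
    "z \<in> ZA \<Longrightarrow> radial \<phi> (z \<otimes>\<^bsub>GA\<^esub> g) = radial \<phi> g"
    "k \<in> KA \<Longrightarrow> radial \<phi> (g \<otimes>\<^bsub>GA\<^esub> k) = radial \<phi> g"
proof -
  interpret G: group "GA :: 'k adele mat2 monoid" by (rule group_GA)
  show "radial \<phi> (\<gamma> \<otimes>\<^bsub>GA\<^esub> g) = radial \<phi> g" if "\<gamma> \<in> GF"
    using that assms GF_carrier adelic_type_GF[OF that assms] by (auto simp: radial_def)
  show "radial \<phi> (z \<otimes>\<^bsub>GA\<^esub> g) = radial \<phi> g" if "z \<in> ZA"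
    using that assms ZA_carrier adelic_type_ZA[OF that assms] by (auto simp: radial_def)
  show "radial \<phi> (g \<otimes>\<^bsub>GA\<^esub> k) = radial \<phi> g" if "k \<in> KA"
    using that assms KA_subset adelic_type_KA[OF that assms] by (auto simp: radial_def)
qed

text \<open>With \<open>q\<close> the number of constants and \<open>a = log q A\<close>, the bound
  \<open>A ^ n = (q ^ n) powr a\<close> at a matrix of type \<open>n\<close> is at most the third
  power of the height, raised to \<open>a\<close>.\<close>

lemma radial_automorphic:
  assumes "A \<ge> 1" "\<And>n. norm (\<phi> n) \<le> B * A ^ n"
  shows "radial \<phi> \<in> (unramified_automorphic_forms :: ('k::{finite,field} adele mat2 \<Rightarrow> complex) set)"
proof -
  let ?q = "real CARD('k)"
  have q: "?q > 1" using card_field_gt_1[where 'k = 'k] by simp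
  have B: "B \<ge> 0" using assms(2)[of 0] order_trans[OF norm_ge_zero[of "\<phi> 0"], of B] by simp
  define a where "a = log ?q A"
  have a: "a \<ge> 0" "A = ?q powr a" using assms(1) q by (simp_all add: a_def)
  have "norm (radial \<phi> g) \<le> B * height g powr (3 * a)" if g: "g \<in> carrier (GA :: 'k adele mat2 monoid)" for g
  proof -
    have h: "?q ^ adelic_type g \<le> height g ^ 3" by (rule type_le_height[OF g])
    moreover have "?q ^ adelic_type g > 0" using q by simp
    ultimately have "height g ^ 3 > 0" by linarith
    hence hp: "height g > 0" by (simp add: zero_less_power_eq)
    have "A ^ adelic_type g = (?q ^ adelic_type g) powr a"
      using q by (simp add: a(2) powr_powr powr_realpow[symmetric] mult.commute)
    also have "\<dots> \<le> (height g ^ 3) powr a" using h a(1) by (intro powr_mono2) auto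
    also have "height g ^ 3 = height g powr 3" using hp by simp
    also have "(height g powr 3) powr a = height g powr (3 * a)" by (rule powr_powr)
    finally have "B * A ^ adelic_type g \<le> B * height g powr (3 * a)" using B by (intro mult_left_mono)
    thus ?thesis using assms(2)[of "adelic_type g"] g by (simp add: radial_def)
  qed
  hence "\<exists>C N. \<forall>g\<in>carrier (GA :: 'k adele mat2 monoid). norm (radial \<phi> g) \<le> C * height g powr N" by blast
  moreover have "radial \<phi> g = 0" if "g \<notin> carrier GA" for g :: "'k adele mat2"
    using that by (simp add: radial_def)
  ultimately show ?thesis
    unfolding unramified_automorphic_forms_def
  proof (intro CollectI conjI)
    show "\<forall>\<gamma>\<in>GF. \<forall>g\<in>carrier GA. radial \<phi> (\<gamma> \<otimes>\<^bsub>GA\<^esub> g) = radial \<phi> g"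
      by (intro ballI radial_invariant(1))
    show "\<forall>z\<in>ZA. \<forall>g\<in>carrier GA. radial \<phi> (z \<otimes>\<^bsub>GA\<^esub> g) = radial \<phi> g"
      by (intro ballI radial_invariant(2))
    show "\<forall>k\<in>KA. \<forall>g\<in>carrier GA. radial \<phi> (g \<otimes>\<^bsub>GA\<^esub> k) = radial \<phi> g"
      by (intro ballI radial_invariant(3))
  qed blast+
qed

lemma automorphic_radial:
  fixes f :: "'k::{finite,field} adele mat2 \<Rightarrow> complex"
  assumes "f \<in> unramified_automorphic_forms"
  shows "f = radial (\<lambda>n. f (emb (std_mat n)))"
proof
  fix g :: "'k adele mat2"
  show "f g = radial (\<lambda>n. f (emb (std_mat n))) g"
  proof (cases "g \<in> carrier GA")
    case True
    have "f g = f (emb (std_mat (adelic_type g)))"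
      by (rule invariant_determined_by_type) (use assms True in \<open>auto simp: unramified_automorphic_forms_def\<close>)
    thus ?thesis using True by (simp add: radial_def)
  next
    case False
    thus ?thesis using assms by (simp add: unramified_automorphic_forms_def radial_def)
  qed
qed

definition neighbour_type :: "nat \<Rightarrow> 'k::{finite,field} adele mat2 set \<Rightarrow> nat" where
  "neighbour_type n C = adelic_type (emb (std_mat n) \<otimes>\<^bsub>GA\<^esub> coset_rep C)"

lemma neighbour_type_le:
  assumes "uniformizer y p"
  shows "\<forall>n. \<forall>C\<in>hecke_cosets y p. neighbour_type n C \<le> n + geom_degree y"
  using adelic_type_hecke_le[OF assms emb_carrier[OF std_mat_RP] coset_rep_hecke_set[OF uniformizer_nonzero[OF assms]]]
  by (auto simp: neighbour_type_def adelic_type_std_mat)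

lemma neighbour_type_top:
  fixes y :: "'k::{finite,field} place"
  assumes p: "uniformizer y p"
  shows "\<exists>C\<in>hecke_cosets y p. neighbour_type n C = n + geom_degree y"
proof -
  interpret G: group "GA :: 'k adele mat2 monoid" by (rule group_GA)
  have p0: "p \<noteq> 0" using p by (rule uniformizer_nonzero)
  let ?a = "emb (hecke_mat y p)"
  have a: "?a \<in> carrier GA" by (rule emb_carrier[OF hecke_mat_RP[OF p0]])
  have "?a = \<one>\<^bsub>GA\<^esub> \<otimes>\<^bsub>GA\<^esub> ?a \<otimes>\<^bsub>GA\<^esub> \<one>\<^bsub>GA\<^esub>" using a by simp
  hence "?a \<in> hecke_set y p" unfolding hecke_set_def using one_in_KA by blast
  hence C: "left_coset ?a \<in> hecke_cosets y p" "?a \<in> left_coset ?a"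
    using left_coset_self[OF a] by (auto simp: hecke_cosets_def)
  have "right_invariant (adelic_type :: 'k adele mat2 \<Rightarrow> nat)"
    by (simp add: right_invariant_def adelic_type_KA)
  from right_invariant_coset[OF this p0 emb_carrier[OF std_mat_RP] C]
  have "neighbour_type n (left_coset ?a) = n + geom_degree y"
    by (simp add: neighbour_type_def adelic_type_hecke_top[OF p])
  with C(1) show ?thesis by blast
qed

text \<open>For a function of the type the eigenvalue equation need only be checked at the standard
  matrices, because both sides are invariant; there it is the recursion.\<close>

lemma hecke_eigenspace_eq:
  fixes y :: "'k::{finite,field} place"
  assumes p: "uniformizer y p" and \<mu>: "haar_measure GA GA_topology \<mu>" "emeasure \<mu> KA = 1"
  shows "hecke_eigenspace \<mu> (hecke_place y p) c =
     radial ` {\<phi>. recursive_solution (hecke_cosets y p) neighbour_type c \<phi>}"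
proof (intro equalityI subsetI)
  note rec = recursive_solution_def
  have p0: "p \<noteq> 0" using p by (rule uniformizer_nonzero)
  have cs: "coset_sum y p (radial \<phi>) (emb (std_mat n)) = (\<Sum>C\<in>hecke_cosets y p. \<phi> (neighbour_type n C))" for \<phi> n
    unfolding coset_sum_def
  proof (rule sum.cong[OF refl])
    interpret G: group "GA :: 'k adele mat2 monoid" by (rule group_GA)
    fix C assume C: "C \<in> hecke_cosets y p"
    have "coset_rep C \<in> carrier GA" using coset_rep_hecke_set[OF p0 C] hecke_set_carrier[OF p0] by blast
    thus "radial \<phi> (emb (std_mat n) \<otimes>\<^bsub>GA\<^esub> coset_rep C) = \<phi> (neighbour_type n C)"
      by (simp add: radial_def neighbour_type_def emb_carrier[OF std_mat_RP])
  qed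
  have std: "radial \<phi> (emb (std_mat n) :: 'k adele mat2) = \<phi> n" for \<phi> n
    by (simp add: radial_def adelic_type_std_mat emb_carrier[OF std_mat_RP])
  have ri: "right_invariant (radial \<phi> :: 'k adele mat2 \<Rightarrow> complex)" for \<phi>
    by (simp add: right_invariant_def radial_invariant)
  {
    fix f assume f: "f \<in> hecke_eigenspace \<mu> (hecke_place y p) c"
    define \<phi> where "\<phi> n = f (emb (std_mat n))" for n
    have fr: "f = radial \<phi>" using f automorphic_radial by (auto simp: hecke_eigenspace_def \<phi>_def[abs_def])
    have "(\<Sum>C\<in>hecke_cosets y p. \<phi> (neighbour_type n C)) = c * \<phi> n" for n
    proof -
      have "(\<Sum>C\<in>hecke_cosets y p. \<phi> (neighbour_type n C)) = hecke_action \<mu> (hecke_place y p) f (emb (std_mat n))"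
        unfolding cs[symmetric] fr by (rule hecke_action_eq_coset_sum[OF p \<mu> ri emb_carrier[OF std_mat_RP], symmetric])
      also have "\<dots> = c * f (emb (std_mat n))" using f by (simp add: hecke_eigenspace_def)
      finally show ?thesis by (simp add: \<phi>_def)
    qed
    thus "f \<in> radial ` {\<phi>. recursive_solution (hecke_cosets y p) neighbour_type c \<phi>}"
      using fr by (simp add: rec)
  next
    fix f :: "'k adele mat2 \<Rightarrow> complex"
    assume "f \<in> radial ` {\<phi>. recursive_solution (hecke_cosets y p) neighbour_type c \<phi>}"
    then obtain \<phi> where \<phi>: "f = radial \<phi>" "recursive_solution (hecke_cosets y p) neighbour_type c \<phi>" by blast
    obtain B A where "A \<ge> 1" "\<And>n. norm (\<phi> n) \<le> B * A ^ n"
      using recursive_solution_growth[OF finite_hecke_cosets[OF p] geom_degree_pos neighbour_type_le[OF p] neighbour_type_top[OF p] \<phi>(2)]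
      by blast
    hence af: "f \<in> unramified_automorphic_forms" unfolding \<phi>(1) by (rule radial_automorphic)
    have "hecke_action \<mu> (hecke_place y p) f g = c * f g" for g
    proof (cases "g \<in> carrier GA")
      case True
      have "coset_sum y p f g = coset_sum y p f (emb (std_mat (adelic_type g)))"
      proof (rule invariant_determined_by_type[OF _ _ _ True])
        show "coset_sum y p f (\<gamma> \<otimes>\<^bsub>GA\<^esub> g) = coset_sum y p f g" if "\<gamma> \<in> GF" "g \<in> carrier GA" for \<gamma> g
          using that GF_carrier by (intro coset_sum_left[OF p0]) (auto simp: \<phi>(1) radial_invariant(1))
        show "coset_sum y p f (z \<otimes>\<^bsub>GA\<^esub> g) = coset_sum y p f g" if "z \<in> ZA" "g \<in> carrier GA" for z g
          using that ZA_carrier by (intro coset_sum_left[OF p0]) (auto simp: \<phi>(1) radial_invariant(2))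
        show "coset_sum y p f (g \<otimes>\<^bsub>GA\<^esub> k) = coset_sum y p f g" if "k \<in> KA" "g \<in> carrier GA" for k g
          using that ri unfolding \<phi>(1) by (intro coset_sum_right[OF p])
      qed
      also have "\<dots> = c * \<phi> (adelic_type g)" using \<phi>(2) by (simp add: \<phi>(1) cs rec)
      finally show ?thesis using hecke_action_eq_coset_sum[OF p \<mu> ri True, of \<phi>] True
        by (simp add: \<phi>(1) radial_def)
    next
      case False
      thus ?thesis by (simp add: hecke_action_def \<phi>(1) radial_def)
    qed
    thus "f \<in> hecke_eigenspace \<mu> (hecke_place y p) c" using af by (auto simp: hecke_eigenspace_def)
  }
qed

theorem theorem1:
  fixes y :: "'k::{finite,field} place" and p :: "'k ratfun"
    and \<mu> :: "'k adele mat2 measure" and d :: nat and c :: complex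
  assumes "place_degree y = d"
    and "uniformizer y p"
    and "haar_measure GA GA_topology \<mu>"
    and "emeasure \<mu> KA = 1"
    and "c \<noteq> 0"
  shows "fun_dim (hecke_eigenspace \<mu> (hecke_place y p) c) = d"
proof -
  interpret vs: vector_space "fun_scale :: complex \<Rightarrow> ('k adele mat2 \<Rightarrow> complex) \<Rightarrow> _"
    by (rule vector_space_fun_scale)
  have d: "geom_degree y = d" using assms(1) by (simp add: place_degree_eq)
  note asm = finite_hecke_cosets[OF assms(2)] geom_degree_pos neighbour_type_le[OF assms(2)] neighbour_type_top[OF assms(2)]
  note rec_def = recursive_solution_def and rec_exists = recursive_solution_exists[OF asm]
    and rec_unique = recursive_solution_unique[OF asm]
  let ?rec = "recursive_solution (hecke_cosets y p) neighbour_type c"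
  let ?V = "hecke_eigenspace \<mu> (hecke_place y p) c"
  have V: "?V = radial ` {\<phi>. ?rec \<phi>}" by (rule hecke_eigenspace_eq[OF assms(2-4)])
  have std: "radial \<phi> (emb (std_mat n) :: 'k adele mat2) = \<phi> n" for \<phi> n
    by (simp add: radial_def adelic_type_std_mat emb_carrier[OF std_mat_RP])
  (* The basis: solutions of the recursion with unit vectors as initial values. *)
  have "\<forall>i. \<exists>\<phi>. ?rec \<phi> \<and> (\<forall>j<d. \<phi> j = (if j = i then 1 else 0))"
  proof
    fix i
    show "\<exists>\<phi>. ?rec \<phi> \<and> (\<forall>j<d. \<phi> j = (if j = i then 1 else 0))"
      using rec_exists[of c "\<lambda>j. if j = i then 1 else 0"] unfolding d .
  qed
  from choice[OF this] obtain b
    where "\<forall>i. ?rec (b i) \<and> (\<forall>j<d. b i j = (if j = i then 1 else 0))" by blast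
  hence b: "\<And>i. ?rec (b i)" "\<And>i j. j < d \<Longrightarrow> b i j = (if j = i then 1 else 0)" by blast+
  define e where "e i = (radial (b i) :: 'k adele mat2 \<Rightarrow> complex)" for i
  have e_std: "e i (emb (std_mat j)) = (if j = i then 1 else 0)" if "j < d" for i j
    using b(2)[OF that] by (simp add: e_def std)
  have inj: "inj_on e {..<d}"
  proof (rule inj_onI)
    fix i j assume ij: "i \<in> {..<d}" "j \<in> {..<d}" "e i = e j"
    have "e i (emb (std_mat i)) = e j (emb (std_mat i))" using ij(3) by simp
    thus "i = j" using ij(1,2) by (simp add: e_std split: if_splits)
  qed
  have sum_apply: "(\<Sum>i\<in>I. fun_scale (a i) (e i)) g = (\<Sum>i\<in>I. a i * e i g)" for I a g
    by (induction I rule: infinite_finite_induct) (auto simp: fun_scale_def)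
  have "vs.dim ?V = d"
  proof (rule vs.dim_unique)
    show "e ` {..<d} \<subseteq> ?V" using b(1) unfolding V e_def by blast
    show "?V \<subseteq> vs.span (e ` {..<d})"
    proof
      fix f assume "f \<in> ?V"
      then obtain \<phi> where \<phi>: "?rec \<phi>" "f = radial \<phi>" unfolding V by blast
      (* The difference solves the recursion with initial values 0, hence vanishes. *)
      define \<psi> where "\<psi> n = \<phi> n - (\<Sum>i<d. \<phi> i * b i n)" for n
      have "?rec \<psi>"
        unfolding rec_def
      proof
        fix n
        have "(\<Sum>C\<in>hecke_cosets y p. \<psi> (neighbour_type n C)) = (\<Sum>C\<in>hecke_cosets y p. \<phi> (neighbour_type n C)) -
            (\<Sum>i<d. \<phi> i * (\<Sum>C\<in>hecke_cosets y p. b i (neighbour_type n C)))"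
          unfolding \<psi>_def sum_subtractf sum_distrib_left
          by (simp add: sum.swap[of _ "hecke_cosets y p"])
        also have "\<dots> = c * \<psi> n"
          using \<phi>(1) b(1) unfolding rec_def by (simp add: \<psi>_def right_diff_distrib sum_distrib_left mult_ac)
        finally show "(\<Sum>C\<in>hecke_cosets y p. \<psi> (neighbour_type n C)) = c * \<psi> n" .
      qed
      moreover have "\<psi> i = 0" if "i < geom_degree y" for i
      proof -
        have i: "i < d" using that d by simp
        have "(\<Sum>j<d. \<phi> j * b j i) = (\<Sum>j<d. if j = i then \<phi> j else 0)"
          by (intro sum.cong refl) (use b(2)[OF i] in auto)
        thus ?thesis using i by (simp add: \<psi>_def)
      qed
      ultimately have "\<psi> n = 0" for n by (rule rec_unique)
      hence \<phi>n: "\<phi> n = (\<Sum>i<d. \<phi> i * b i n)" for n unfolding \<psi>_def by (metis eq_iff_diff_eq_0)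
      have "f = (\<Sum>i<d. fun_scale (\<phi> i) (e i))"
      proof
        fix g :: "'k adele mat2"
        show "f g = (\<Sum>i<d. fun_scale (\<phi> i) (e i)) g"
          unfolding sum_apply unfolding \<phi>(2) e_def radial_def using \<phi>n[of "adelic_type g"] by simp
      qed
      moreover have "(\<Sum>i<d. fun_scale (\<phi> i) (e i)) \<in> vs.span (e ` {..<d})"
        by (rule vs.span_sum, rule vs.span_scale, rule vs.span_base) simp
      ultimately show "f \<in> vs.span (e ` {..<d})" by simp
    qed
    show "vs.independent (e ` {..<d})"
    proof (rule vs.independent_if_scalars_zero)
      fix a x assume s: "(\<Sum>x\<in>e ` {..<d}. fun_scale (a x) x) = 0" and "x \<in> e ` {..<d}"
      then obtain j where j: "j < d" "x = e j" by blast
      have "(\<Sum>i<d. fun_scale (a (e i)) (e i)) = 0" using s by (simp add: sum.reindex[OF inj])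
      hence "(\<Sum>i<d. a (e i) * e i (emb (std_mat j))) = 0"
        using sum_apply[of "\<lambda>i. a (e i)" "{..<d}" "emb (std_mat j)"] by simp
      also have "(\<Sum>i<d. a (e i) * e i (emb (std_mat j))) = (\<Sum>i<d. if i = j then a (e i) else 0)"
        using j(1) by (intro sum.cong refl) (auto simp: e_std)
      finally show "a x = 0" using j by simp
    qed simp
    show "card (e ` {..<d}) = d" using card_image[OF inj] by simp
  qed
  thus ?thesis by (simp add: fun_dim_def)
qed

end
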